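(* Every nontrivial planar graph $G$ of girth at least $5$ is partially DP-nice.
   Context: All graphs are nonempty, finite and simple. Nontrivial means having at least two vertices; an acyclic graph has infinite girth. For $m\in\mathbb{N}=\{1,2,\dots\}$ write $[m]=\{1,\dots,m\}$. For $S,U\subseteq V(H)$, $E_H(S,U)$ is the set of edges of $H$ with at least one endpoint in $S$ and at least one endpoint in $U$. A cover of a graph $G$ is a pair $\mathcal{H}=(L,H)$ where $H$ is a graph and $L:V(G)\to\mathcal{P}(V(H))$ satisfies: (1) the sets $L(u)$, $u\in V(G)$, partition $V(H)$; (2) $H[L(u)]$ is complete for every $u\in V(G)$; (3) for every $uv\in E(G)$, $E_H(L(u),L(v))$ is a (possibly empty) matching; (4) if $u\neq v$ and $uv\notin E(G)$, then $E_H(L(u),L(v))=\emptyset$. The cover is $m$-fold if $|L(u)|=m$ for all $u\in V(G)$. An $\mathcal{H}$-coloring of $G$ is an independent set of size $|V(G)|$ in $H$. The DP-chromatic number $\chi_{DP}(G)$ is the smallest $m$ such that $G$ has an $\mathcal{H}$-coloring for every $m$-fold cover $\mathcal{H}$ of $G$. For $t\in\mathbb{N}$, the partial DP $t$-chromatic number $\alpha_t^{DP}(G)$ is the minimum of $\alpha(H)$ (the independence number of $H$) over all $t$-fold covers $\mathcal{H}=(L,H)$ of $G$. A graph $G$ is partially DP-nice if $\alpha_t^{DP}(G)\ge t|V(G)|/\chi_{DP}(G)$ for all $t\in[\chi_{DP}(G)]$. *)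

theory Defs
  imports "HOL-Analysis.Analysis" "HOL-Library.Extended_Nat" "HOL-Library.Disjoint_Sets"
begin

section \<open>Finite simple graphs\<close>

type_synonym 'a graph = "'a set \<times> 'a set set"

abbreviation verts :: "'a graph \<Rightarrow> 'a set" where
  "verts G \<equiv> fst G"

abbreviation edges :: "'a graph \<Rightarrow> 'a set set" where
  "edges G \<equiv> snd G"

definition simple_graph :: "'a graph \<Rightarrow> bool" where
  "simple_graph G \<longleftrightarrow> finite (verts G) \<and> verts G \<noteq> {} \<and>
     (\<forall>e\<in>edges G. e \<subseteq> verts G \<and> card e = 2)"

definition nontrivial :: "'a graph \<Rightarrow> bool" where
  "nontrivial G \<longleftrightarrow> card (verts G) \<ge> 2"

definition independent_set :: "'a graph \<Rightarrow> 'a set \<Rightarrow> bool" where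
  "independent_set G S \<longleftrightarrow> S \<subseteq> verts G \<and> (\<forall>x\<in>S. \<forall>y\<in>S. {x, y} \<notin> edges G)"

definition independence_number :: "'a graph \<Rightarrow> nat" where
  "independence_number G = Max {card S | S. independent_set G S}"

definition cycle :: "'a graph \<Rightarrow> 'a list \<Rightarrow> bool" where
  "cycle G xs \<longleftrightarrow> length xs \<ge> 3 \<and> distinct xs \<and>
     (\<forall>i<length xs. {xs ! i, xs ! (Suc i mod length xs)} \<in> edges G)"

text \<open>The infimum of the empty set in \<^typ>\<open>enat\<close> is \<open>\<infinity>\<close>, so acyclic graphs have infinite girth.\<close>

definition girth :: "'a graph \<Rightarrow> enat" where
  "girth G = Inf {enat (length xs) | xs. cycle G xs}"

text \<open>
  A drawing in the plane: vertices are distinct points, every edge is a simple arc joining its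
  two ends, and the interior of an edge contains no vertex and no point of any other edge.
\<close>

definition plane_drawing :: "'a graph \<Rightarrow> ('a \<Rightarrow> complex) \<Rightarrow> ('a set \<Rightarrow> real \<Rightarrow> complex) \<Rightarrow> bool" where
  "plane_drawing G p \<gamma> \<longleftrightarrow> inj_on p (verts G) \<and>
     (\<forall>e\<in>edges G. arc (\<gamma> e) \<and> {pathstart (\<gamma> e), pathfinish (\<gamma> e)} = p ` e \<and>
        (path_image (\<gamma> e) - p ` e) \<inter> p ` verts G = {} \<and>
        (\<forall>f\<in>edges G. f \<noteq> e \<longrightarrow> (path_image (\<gamma> e) - p ` e) \<inter> path_image (\<gamma> f) = {}))"

definition planar :: "'a graph \<Rightarrow> bool" where
  "planar G \<longleftrightarrow> (\<exists>p \<gamma>. plane_drawing G p \<gamma>)"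


section \<open>Covers and DP-coloring\<close>

definition edges_between :: "'a graph \<Rightarrow> 'a set \<Rightarrow> 'a set \<Rightarrow> 'a set set" where
  "edges_between H S U = {e \<in> edges H. e \<inter> S \<noteq> {} \<and> e \<inter> U \<noteq> {}}"

definition matching :: "'a set set \<Rightarrow> bool" where
  "matching M \<longleftrightarrow> (\<forall>e\<in>M. \<forall>f\<in>M. e \<noteq> f \<longrightarrow> e \<inter> f = {})"

definition cover :: "'a graph \<Rightarrow> ('a \<Rightarrow> 'b set) \<Rightarrow> 'b graph \<Rightarrow> bool" where
  "cover G L H \<longleftrightarrow> simple_graph H \<and>
     disjoint_family_on L (verts G) \<and> (\<Union>u\<in>verts G. L u) = verts H \<and>
     (\<forall>u\<in>verts G. \<forall>x\<in>L u. \<forall>y\<in>L u. x \<noteq> y \<longrightarrow> {x, y} \<in> edges H) \<and>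
     (\<forall>u v. {u, v} \<in> edges G \<longrightarrow> matching (edges_between H (L u) (L v))) \<and>
     (\<forall>u\<in>verts G. \<forall>v\<in>verts G. u \<noteq> v \<and> {u, v} \<notin> edges G \<longrightarrow>
        edges_between H (L u) (L v) = {})"

definition fold_cover :: "nat \<Rightarrow> 'a graph \<Rightarrow> ('a \<Rightarrow> 'b set) \<Rightarrow> 'b graph \<Rightarrow> bool" where
  "fold_cover m G L H \<longleftrightarrow> cover G L H \<and> (\<forall>u\<in>verts G. card (L u) = m)"

definition cover_coloring :: "'a graph \<Rightarrow> 'b graph \<Rightarrow> 'b set \<Rightarrow> bool" where
  "cover_coloring G H S \<longleftrightarrow> independent_set H S \<and> card S = card (verts G)"

text \<open>
  A definition cannot quantify over types, so the cover graphs below have vertices in \<^typ>\<open>nat\<close>.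
  Cover graphs are finite, so every cover is isomorphic to one of these; see
  \<open>DP_colorable_imp_coloring\<close> and \<open>partial_DP_number_le\<close>.
\<close>

definition DP_colorable :: "'a graph \<Rightarrow> nat \<Rightarrow> bool" where
  "DP_colorable G m \<longleftrightarrow>
     (\<forall>(L :: 'a \<Rightarrow> nat set) H. fold_cover m G L H \<longrightarrow> (\<exists>S. cover_coloring G H S))"

definition DP_chromatic_number :: "'a graph \<Rightarrow> nat" where
  "DP_chromatic_number G = (LEAST m. m \<ge> 1 \<and> DP_colorable G m)"

definition partial_DP_number :: "nat \<Rightarrow> 'a graph \<Rightarrow> nat" where
  "partial_DP_number t G =
     (LEAST k. \<exists>(L :: 'a \<Rightarrow> nat set) H. fold_cover t G L H \<and> k = independence_number H)"

definition partially_DP_nice :: "'a graph \<Rightarrow> bool" where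
  "partially_DP_nice G \<longleftrightarrow> (\<forall>t\<in>{1..DP_chromatic_number G}.
     real (partial_DP_number t G) \<ge> real t * real (card (verts G)) / real (DP_chromatic_number G))"


section \<open>Independence of the vertex type of the cover graph\<close>

definition image_graph :: "('b \<Rightarrow> 'c) \<Rightarrow> 'b graph \<Rightarrow> 'c graph" where
  "image_graph f H = (f ` verts H, (`) f ` edges H)"

lemma image_graph_edge_iff:
  assumes "simple_graph H" "inj_on f (verts H)" "A \<subseteq> verts H"
  shows "f ` A \<in> edges (image_graph f H) \<longleftrightarrow> A \<in> edges H"
proof
  assume "f ` A \<in> edges (image_graph f H)"
  then obtain e where e: "e \<in> edges H" "f ` A = f ` e"
    by (auto simp: image_graph_def)
  then have "A = e"
    using inj_on_image_eq_iff[OF assms(2,3), of e] assms(1) by (simp add: simple_graph_def)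
  then show "A \<in> edges H" using e by simp
qed (simp add: image_graph_def)

lemma simple_graph_image:
  assumes "simple_graph H" "inj_on f (verts H)"
  shows "simple_graph (image_graph f H)"
proof -
  have "f ` e \<subseteq> f ` verts H \<and> card (f ` e) = 2" if "e \<in> edges H" for e
  proof -
    have "e \<subseteq> verts H" "card e = 2" using that assms(1) by (auto simp: simple_graph_def)
    then show ?thesis using card_image[OF inj_on_subset[OF assms(2)], of e] by auto
  qed
  then show ?thesis
    using assms(1) by (simp add: image_graph_def simple_graph_def)
qed

lemma independent_set_image_iff:
  assumes "simple_graph H" "inj_on f (verts H)" "S \<subseteq> verts H"
  shows "independent_set (image_graph f H) (f ` S) \<longleftrightarrow> independent_set H S"
proof -
  have "{f x, f y} \<in> edges (image_graph f H) \<longleftrightarrow> {x, y} \<in> edges H" if "x \<in> S" "y \<in> S" for x y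
    using image_graph_edge_iff[OF assms(1,2), of "{x, y}"] that assms(3) by auto
  moreover have "f ` S \<subseteq> verts (image_graph f H)"
    using assms(3) by (auto simp: image_graph_def)
  ultimately show ?thesis
    using assms(3) by (simp add: independent_set_def)
qed

lemma independent_set_image_obtain:
  assumes "simple_graph H" "inj_on f (verts H)" "independent_set (image_graph f H) T"
  obtains S where "independent_set H S" "T = f ` S" "card T = card S"
proof -
  have "T \<subseteq> f ` verts H"
    using assms(3) by (simp add: independent_set_def image_graph_def)
  then obtain S where S: "S \<subseteq> verts H" "T = f ` S"
    by (meson subset_imageE)
  then show ?thesis
    using that independent_set_image_iff[OF assms(1,2) S(1)] assms(2,3)
    by (metis card_image inj_on_subset)
qed

lemma independence_number_image:
  assumes "simple_graph H" "inj_on f (verts H)"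
  shows "independence_number (image_graph f H) = independence_number H"
proof -
  have "{card T | T. independent_set (image_graph f H) T} = {card S | S. independent_set H S}"
  proof (intro set_eqI iffI)
    fix n assume "n \<in> {card T | T. independent_set (image_graph f H) T}"
    then show "n \<in> {card S | S. independent_set H S}"
      by (auto elim: independent_set_image_obtain[OF assms])
  next
    fix n assume "n \<in> {card S | S. independent_set H S}"
    then obtain S where S: "independent_set H S" "n = card S" by auto
    then have "S \<subseteq> verts H" by (simp add: independent_set_def)
    then have "independent_set (image_graph f H) (f ` S)" "card (f ` S) = card S"
      using independent_set_image_iff[OF assms, of S] S(1)
        card_image[OF inj_on_subset[OF assms(2)], of S] by simp_all
    then show "n \<in> {card T | T. independent_set (image_graph f H) T}"
      using S(2) by (intro CollectI exI[of _ "f ` S"]) simp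
  qed
  then show ?thesis by (simp add: independence_number_def)
qed

lemma edges_between_image:
  assumes "simple_graph H" "inj_on f (verts H)" "A \<subseteq> verts H" "B \<subseteq> verts H"
  shows "edges_between (image_graph f H) (f ` A) (f ` B) = (`) f ` edges_between H A B"
proof -
  have "f ` e \<inter> f ` C = {} \<longleftrightarrow> e \<inter> C = {}" if "e \<in> edges H" "C \<subseteq> verts H" for e C
    using that assms(1,2) inj_on_image_Int[of f "verts H" e C]
    by (auto simp: simple_graph_def)
  then have "f ` e \<inter> f ` A \<noteq> {} \<and> f ` e \<inter> f ` B \<noteq> {} \<longleftrightarrow> e \<inter> A \<noteq> {} \<and> e \<inter> B \<noteq> {}"
    if "e \<in> edges H" for e
    using that assms(3,4) by meson
  then show ?thesis
    by (simp add: edges_between_def image_graph_def Compr_image_eq cong: conj_cong)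
qed

lemma fold_cover_image:
  assumes "simple_graph G" "fold_cover m G L H" "inj_on f (verts H)"
  shows "fold_cover m G (\<lambda>u. f ` L u) (image_graph f H)"
proof -
  note cov = assms(2)[unfolded fold_cover_def cover_def]
  have H: "simple_graph H" using cov by simp
  have dis: "disjoint_family_on L (verts G)" using cov by simp
  have un: "(\<Union>u\<in>verts G. L u) = verts H" using cov by (elim conjE)
  have cl: "\<forall>u\<in>verts G. \<forall>x\<in>L u. \<forall>y\<in>L u. x \<noteq> y \<longrightarrow> {x, y} \<in> edges H"
    using cov by (elim conjE)
  have "\<forall>u v. {u, v} \<in> edges G \<longrightarrow> matching (edges_between H (L u) (L v))"
    using cov by (elim conjE)
  then have ma: "matching (edges_between H (L u) (L v))" if "{u, v} \<in> edges G" for u v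
    using that by simp
  have em: "\<forall>u\<in>verts G. \<forall>v\<in>verts G. u \<noteq> v \<and> {u, v} \<notin> edges G \<longrightarrow>
      edges_between H (L u) (L v) = {}"
    using cov by (elim conjE)
  have ca: "card (L u) = m" if "u \<in> verts G" for u
    using cov that by simp
  have sub: "L u \<subseteq> verts H" if "u \<in> verts G" for u
    using that un by auto
  have EG: "u \<in> verts G \<and> v \<in> verts G" if "{u, v} \<in> edges G" for u v
    using that assms(1) by (auto simp: simple_graph_def)
  have eb: "edges_between (image_graph f H) (f ` L u) (f ` L v) = (`) f ` edges_between H (L u) (L v)"
    if "u \<in> verts G" "v \<in> verts G" for u v
    using edges_between_image[OF H assms(3) sub sub] that by auto
  have "disjoint_family_on (\<lambda>u. f ` L u) (verts G)"
    unfolding disjoint_family_on_def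
  proof (intro ballI impI)
    fix u v assume "u \<in> verts G" "v \<in> verts G" "u \<noteq> v"
    then show "f ` L u \<inter> f ` L v = {}"
      using inj_on_image_Int[OF assms(3) sub sub, of u v] dis by (simp add: disjoint_family_on_def)
  qed
  moreover have "(\<Union>u\<in>verts G. f ` L u) = verts (image_graph f H)"
    by (simp add: image_graph_def image_UN flip: un)
  moreover have "{x, y} \<in> edges (image_graph f H)"
    if u: "u \<in> verts G" and x: "x \<in> f ` L u" and y: "y \<in> f ` L u" and ne: "x \<noteq> y" for u x y
  proof -
    obtain x' y' where "x' \<in> L u" "y' \<in> L u" "x = f x'" "y = f y'" using x y by auto
    moreover from this have "{x', y'} \<in> edges H" using cl u ne by metis
    ultimately show ?thesis by (auto simp: image_graph_def intro!: image_eqI[of _ _ "{x', y'}"])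
  qed
  moreover have "matching (edges_between (image_graph f H) (f ` L u) (f ` L v))"
    if uv: "{u, v} \<in> edges G" for u v
  proof -
    have "f ` e \<inter> f ` e' = {}"
      if "e \<in> edges_between H (L u) (L v)" "e' \<in> edges_between H (L u) (L v)" "e \<noteq> e'" for e e'
    proof -
      have "e \<subseteq> verts H" "e' \<subseteq> verts H"
        using that H by (auto simp: edges_between_def simple_graph_def)
      moreover have "e \<inter> e' = {}"
        using that ma[OF uv] by (auto simp: matching_def)
      ultimately show ?thesis
        using inj_on_image_Int[OF assms(3), of e e'] by simp
    qed
    then have "matching ((`) f ` edges_between H (L u) (L v))"
      unfolding matching_def by blast
    then show ?thesis
      using eb EG[OF uv] by simp
  qed
  moreover have "edges_between (image_graph f H) (f ` L u) (f ` L v) = {}"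
    if "u \<in> verts G" "v \<in> verts G" "u \<noteq> v" "{u, v} \<notin> edges G" for u v
    using eb em that by simp
  moreover have "card (f ` L u) = m" if "u \<in> verts G" for u
    using ca[OF that] sub[OF that] assms(3) by (metis card_image inj_on_subset)
  ultimately show ?thesis
    unfolding fold_cover_def cover_def
    by (intro conjI ballI allI impI simple_graph_image[OF H assms(3)]) simp_all
qed

lemma obtain_nat_embedding:
  assumes "simple_graph (H :: 'b graph)"
  obtains f :: "'b \<Rightarrow> nat" where "inj_on f (verts H)"
  using assms finite_imp_inj_to_nat_seg by (metis simple_graph_def)

lemma DP_colorable_imp_coloring:
  fixes L :: "'a \<Rightarrow> 'b set"
  assumes "simple_graph G" "DP_colorable G m" "fold_cover m G L H"
  shows "\<exists>S. cover_coloring G H S"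
proof -
  have H: "simple_graph H" using assms(3) by (simp add: fold_cover_def cover_def)
  obtain f :: "'b \<Rightarrow> nat" where f: "inj_on f (verts H)" using obtain_nat_embedding[OF H] .
  obtain T where "cover_coloring G (image_graph f H) T"
    using assms(2) fold_cover_image[OF assms(1,3) f] unfolding DP_colorable_def by blast
  then show ?thesis
    using independent_set_image_obtain[OF H f] unfolding cover_coloring_def by metis
qed

lemma partial_DP_number_le:
  fixes L :: "'a \<Rightarrow> 'b set"
  assumes "simple_graph G" "fold_cover t G L H"
  shows "partial_DP_number t G \<le> independence_number H"
proof -
  have H: "simple_graph H" using assms(2) by (simp add: fold_cover_def cover_def)
  obtain f :: "'b \<Rightarrow> nat" where f: "inj_on f (verts H)" using obtain_nat_embedding[OF H] .
  show ?thesis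
    unfolding partial_DP_number_def
    using fold_cover_image[OF assms f] independence_number_image[OF H f]
    by (intro Least_le) metis
qed

end

theory Submission
  imports Defs "Jordan_Normal_Form.Determinant" "HOL-Library.Function_Algebras"
begin

text \<open>
  Let \<open>\<beta>\<close> be the dimension of the cycle space of \<open>G\<close>, \<open>n\<close> the number of vertices and \<open>m\<close> the number
  of edges. A plane drawing has at least \<open>\<beta> + 1\<close> faces, every edge lies on at most two of them and,
  if \<open>\<beta> > 0\<close>, every face is incident with at least five edges. So \<open>5 (\<beta> + 1) \<le> 2 m\<close>, that is
  \<open>3 \<beta> + 7 \<le> 2 n\<close>, for every subgraph with a cycle. Only this sparsity is used afterwards.

  The main point is a feedback vertex set of size at most \<open>(2 \<beta> + n) / 7 \<le> n / 3\<close>. If \<open>G\<close> is subcubic,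
  every vertex \<open>v\<close> defines a skew form of rank at most 2 on the cycle space, namely the determinant
  of the values on two edges at \<open>v\<close>. If a generic combination of these forms has rank \<open>\<rho>\<close>, a trace
  argument yields \<open>\<rho> / 2\<close> vertices whose deletion decreases \<open>\<beta>\<close> by \<open>\<rho>\<close>, hence a feedback vertex set of
  size \<open>\<beta> - \<rho> / 2\<close>. If the generic rank drops under no edge deletion, then any two edges meeting in a
  vertex are proportional as functionals on the radical, so that the radical has dimension at most
  1 when \<open>G\<close> is connected, and the Euler bound gives the claim; otherwise an edge can be deleted.
  Vertices of degree at least 4 are deleted, unless they are cut vertices, where \<open>G\<close> is split.

  Deleting the feedback vertex set leaves a forest, which can be coloured from every 2-fold cover:
  this settles \<open>t = 2\<close>. A greedy argument shows that \<open>G\<close> is 3-degenerate, whence \<open>\<chi>\<^sub>D\<^sub>P \<le> 4\<close>, and becomes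
  2-degenerate after the deletion of at most \<open>m / 7 \<le> 5 n / 21\<close> vertices, which settles \<open>t = 3\<close> in
  case \<open>\<chi>\<^sub>D\<^sub>P = 4\<close>. The case \<open>t = 1\<close> is a pigeonhole argument, and \<open>t = \<chi>\<^sub>D\<^sub>P\<close> is trivial.
\<close>

section \<open>Nonsingular and skew-symmetric matrices\<close>

text \<open>The binding case is \<open>t = 2\<close> with \<open>\<chi>\<^sub>D\<^sub>P = 3\<close>,
  where two thirds of the vertices must survive as a forest; this dictates the constant
  \<open>n / 3\<close>. In a subcubic graph each vertex contributes a pair of functionals on the
  cycle space, and choosing vertices whose deletion lowers \<open>\<beta>\<close> by two apiece is a
  linear matroid parity problem. By a principle of Lovasz the optimum is half the generic rank of
  the associated sum of rank-two skew forms. Passing to the rank replaces a combinatorial selection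
  by linear algebra, and the vertices are recovered from weights of minimal support. Genericity is
  handled with real weights: one moves along a line and avoids finitely many parameters, so
  polynomials in one variable suffice. The coefficients are balanced against the Euler bound
  \<open>3 \<beta> + 7 \<le> 2 n\<close>: its constant 7 pays for the single dimension that the
  radical may have, and a deleted vertex that lowers \<open>\<beta>\<close> by 3 pays for itself
  because \<open>2 \<cdot> 3 + 1 = 7\<close>.\<close>

definition nonsing :: "nat \<Rightarrow> (nat \<Rightarrow> nat \<Rightarrow> real) \<Rightarrow> bool" where
  "nonsing d A \<longleftrightarrow> (\<forall>c. (\<forall>i<d. (\<Sum>j<d. A i j * c j) = 0) \<longrightarrow> (\<forall>j<d. c j = 0))"

text \<open>The trivial-kernel form is what the later arguments produce and consume; the determinant
  enters only where an inverse, a transpose or polynomial dependence on a parameter is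
  wanted.\<close>

lemma nonsing_iff_det:
  "nonsing d A \<longleftrightarrow> Determinant.det (mat d d (\<lambda>(i, j). A i j)) \<noteq> 0"
proof -
  let ?M = "mat d d (\<lambda>(i, j). A i j)"
  have M: "?M \<in> carrier_mat d d" by simp
  have mv: "?M *\<^sub>v v = 0\<^sub>v d \<longleftrightarrow> (\<forall>i<d. (\<Sum>j<d. A i j * vec_index v j) = 0)" if "v \<in> carrier_vec d" for v
    using that by (auto simp: vec_eq_iff scalar_prod_def atLeast0LessThan)
  have "Determinant.det ?M = 0 \<longleftrightarrow> \<not> nonsing d A"
    unfolding det_0_iff_vec_prod_zero_field[OF M]
  proof
    assume "\<exists>v. v \<in> carrier_vec d \<and> v \<noteq> 0\<^sub>v d \<and> ?M *\<^sub>v v = 0\<^sub>v d"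
    then obtain v where v: "v \<in> carrier_vec d" "v \<noteq> 0\<^sub>v d" "?M *\<^sub>v v = 0\<^sub>v d" by blast
    then obtain j where "j < d" "vec_index v j \<noteq> 0" by (auto simp: vec_eq_iff)
    moreover have "\<forall>i<d. (\<Sum>j<d. A i j * vec_index v j) = 0" using mv v by blast
    ultimately show "\<not> nonsing d A" unfolding nonsing_def by blast
  next
    assume "\<not> nonsing d A"
    then obtain c j where c: "\<forall>i<d. (\<Sum>j<d. A i j * c j) = 0" "j < d" "c j \<noteq> 0"
      unfolding nonsing_def by blast
    have "?M *\<^sub>v vec d c = 0\<^sub>v d" using mv[of "vec d c"] c by simp
    moreover have "vec d c \<noteq> 0\<^sub>v d" using c by (auto simp: vec_eq_iff)
    ultimately show "\<exists>v. v \<in> carrier_vec d \<and> v \<noteq> 0\<^sub>v d \<and> ?M *\<^sub>v v = 0\<^sub>v d"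
      by (intro exI[of _ "vec d c"]) simp
  qed
  then show ?thesis by blast
qed

lemma nonsing_inverse:
  assumes "nonsing d A"
  shows "\<exists>K. (\<forall>i<d. \<forall>k<d. (\<Sum>j<d. A i j * K j k) = (if i = k then 1 else 0)) \<and>
    (\<forall>i<d. \<forall>k<d. (\<Sum>j<d. K i j * A j k) = (if i = k then 1 else 0))"
proof -
  let ?M = "mat d d (\<lambda>(i, j). A i j)"
  have M: "?M \<in> carrier_mat d d" by simp
  have "?M \<in> Units (ring_mat TYPE(real) d undefined)"
    using assms det_non_zero_imp_unit[OF M] by (simp add: nonsing_iff_det)
  then obtain N where N: "N \<in> carrier_mat d d" "N * ?M = 1\<^sub>m d" "?M * N = 1\<^sub>m d"
    unfolding Units_def ring_mat_def by auto
  show ?thesis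
  proof (intro exI[of _ "\<lambda>i j. N $$ (i, j)"] conjI allI impI)
    fix i k assume ik: "i < d" "k < d"
    have "(?M * N) $$ (i, k) = (\<Sum>j<d. A i j * N $$ (j, k))"
      using ik N(1) by (simp add: scalar_prod_def atLeast0LessThan)
    then show "(\<Sum>j<d. A i j * N $$ (j, k)) = (if i = k then 1 else 0)"
      using N ik by simp
  next
    fix i k assume ik: "i < d" "k < d"
    have "(N * ?M) $$ (i, k) = (\<Sum>j<d. N $$ (i, j) * A j k)"
      using ik N(1) by (simp add: scalar_prod_def atLeast0LessThan)
    then show "(\<Sum>j<d. N $$ (i, j) * A j k) = (if i = k then 1 else 0)"
      using N ik by simp
  qed
qed

text \<open>The determinant of the pencil is a polynomial in \<open>t\<close> that is nonzero at
  \<open>t = 0\<close>, so it has finitely many roots.\<close>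

lemma finite_singular_pencil:
  assumes "nonsing d A"
  shows "finite {t. \<not> nonsing d (\<lambda>i j. A i j + t * C i j)}"
proof -
  \<comment> \<open>The determinant is taken over the polynomial ring; the Leibniz formula shows
    that it commutes with evaluation at \<open>t\<close>.\<close>
  define p where "p = Determinant.det (mat d d (\<lambda>(i, j). [:A i j, C i j:]))"
  have ev: "poly p t = Determinant.det (mat d d (\<lambda>(i, j). A i j + t * C i j))" for t
    unfolding p_def
    by (subst (1 2) det_def'[of _ d])
      (auto simp: poly_sum poly_prod sign_def permutes_in_image intro!: sum.cong prod.cong)
  have "poly p 0 \<noteq> 0" using assms by (simp add: ev nonsing_iff_det)
  then have "p \<noteq> 0" by auto
  then have "finite {t. poly p t = 0}" by (rule poly_roots_finite)
  then show ?thesis by (simp add: ev nonsing_iff_det)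
qed

text \<open>Reversal of the pencil: for \<open>t \<noteq> 0\<close> the matrix is \<open>t\<close>
  times the one with the roles of \<open>A\<close> and \<open>C\<close> exchanged and parameter
  \<open>inverse t\<close>, so the nonsingular end now sits at infinity.\<close>

lemma finite_singular_pencil':
  assumes "nonsing d C"
  shows "finite {t. \<not> nonsing d (\<lambda>i j. A i j + t * C i j)}"
proof -
  have "{t. \<not> nonsing d (\<lambda>i j. A i j + t * C i j)}
      \<subseteq> insert 0 (inverse ` {t. \<not> nonsing d (\<lambda>i j. C i j + t * A i j)})"
  proof
    fix t assume t: "t \<in> {t. \<not> nonsing d (\<lambda>i j. A i j + t * C i j)}"
    have "nonsing d (\<lambda>i j. A i j + t * C i j)"
      if "nonsing d (\<lambda>i j. C i j + inverse t * A i j)" "t \<noteq> 0"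
    proof -
      have "(\<Sum>j<d. (C i j + inverse t * A i j) * c j) = inverse t * (\<Sum>j<d. (A i j + t * C i j) * c j)"
        for i c
        unfolding sum_distrib_left using that(2) by (intro sum.cong) (auto simp: field_simps)
      then show ?thesis using that unfolding nonsing_def by simp
    qed
    then show "t \<in> insert 0 (inverse ` {t. \<not> nonsing d (\<lambda>i j. C i j + t * A i j)})"
      using t by (cases "t = 0") (auto intro!: image_eqI[of _ _ "inverse t"])
  qed
  then show ?thesis
    using finite_singular_pencil[OF assms, of A] by (meson finite_imageI finite_insert finite_subset)
qed

text \<open>
  Let \<open>K\<close> be the inverse of the skew-symmetric matrix. If \<open>x\<close> has minimal support, then setting
  \<open>x v\<close> to 0 makes the matrix singular, and the rank-two update formula turns this into
  \<open>x v * (c v)\<^sup>T K (b v) = 1\<close>. The trace of the identity is then twice the size of the support.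
\<close>

lemma skew_sum_minimal_support:
  fixes b c :: "'v \<Rightarrow> nat \<Rightarrow> real"
  assumes M: "finite M"
    and ns: "nonsing d (\<lambda>i j. \<Sum>v\<in>M. x v * (b v i * c v j - c v i * b v j))"
  obtains x' N where "N \<subseteq> M" "2 * card N = d" "\<And>v. v \<notin> N \<Longrightarrow> x' v = 0"
    "nonsing d (\<lambda>i j. \<Sum>v\<in>M. x' v * (b v i * c v j - c v i * b v j))"
proof -
  define A where "A x i j = (\<Sum>v\<in>M. x v * (b v i * c v j - c v i * b v j))" for x i j
  \<comment> \<open>Minimality ranges over all weights supported in \<open>M\<close>, not only over
    those obtained by zeroing entries of the given ones.\<close>
  define good where "good n \<longleftrightarrow> (\<exists>x. nonsing d (A x) \<and> (\<forall>v. v \<notin> M \<longrightarrow> x v = 0) \<and> card {v. x v \<noteq> 0} = n)" for n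
  define x0 where "x0 v = (if v \<in> M then x v else 0)" for v
  have "A x0 = A x" by (intro ext) (unfold A_def x0_def, rule sum.cong, auto)
  moreover have "nonsing d (A x)" using ns by (simp add: A_def[abs_def])
  ultimately have "good (card {v. x0 v \<noteq> 0})"
    unfolding good_def by (intro exI[of _ x0]) (simp add: x0_def)
  then have g: "good (Least good)" by (rule LeastI)
  then obtain x where x: "nonsing d (A x)" "\<forall>v. v \<notin> M \<longrightarrow> x v = 0" "card {v. x v \<noteq> 0} = Least good"
    unfolding good_def by blast
  define N where "N = {v. x v \<noteq> 0}"
  have NM: "N \<subseteq> M" using x(2) by (auto simp: N_def)
  have fN: "finite N" using NM M finite_subset by blast
  obtain K where K1: "\<And>i k. i < d \<Longrightarrow> k < d \<Longrightarrow> (\<Sum>j<d. A x i j * K j k) = (if i = k then 1 else 0)"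
    and K2: "\<And>i k. i < d \<Longrightarrow> k < d \<Longrightarrow> (\<Sum>j<d. K i j * A x j k) = (if i = k then 1 else 0)"
    using nonsing_inverse[OF x(1)] by blast
  have skew: "A x i j = - A x j i" for i j
    unfolding A_def sum_negf[symmetric] by (intro sum.cong) (auto simp: algebra_simps)
  define dot where "dot u w = (\<Sum>i<d. u i * w i)" for u w :: "nat \<Rightarrow> real"
  define app where "app B w i = (\<Sum>j<d. B i j * w j)" for B :: "nat \<Rightarrow> nat \<Rightarrow> real" and w i
  have AK: "app (A x) (app K w) i = w i" if "i < d" for w i
  proof -
    have "app (A x) (app K w) i = (\<Sum>j<d. \<Sum>k<d. A x i j * K j k * w k)"
      by (simp add: app_def sum_distrib_left mult.assoc)
    also have "\<dots> = (\<Sum>k<d. (\<Sum>j<d. A x i j * K j k) * w k)"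
      by (subst sum.swap) (simp add: sum_distrib_right)
    also have "\<dots> = (\<Sum>k<d. if i = k then w k else 0)"
      using K1[OF that] by (intro sum.cong) auto
    also have "\<dots> = w i" using that by simp
    finally show ?thesis .
  qed
  have KA: "app K (app (A x) w) i = w i" if "i < d" for w i
  proof -
    have "app K (app (A x) w) i = (\<Sum>j<d. \<Sum>k<d. K i j * A x j k * w k)"
      by (simp add: app_def sum_distrib_left mult.assoc)
    also have "\<dots> = (\<Sum>k<d. (\<Sum>j<d. K i j * A x j k) * w k)"
      by (subst sum.swap) (simp add: sum_distrib_right)
    also have "\<dots> = (\<Sum>k<d. if i = k then w k else 0)"
      using K2[OF that] by (intro sum.cong) auto
    also have "\<dots> = w i" using that by simp
    finally show ?thesis .
  qed
  have dot_skew: "dot u (app (A x) w) = - dot w (app (A x) u)" for u w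
  proof -
    have "dot u (app (A x) w) = (\<Sum>i<d. \<Sum>j<d. u i * A x i j * w j)"
      by (simp add: dot_def app_def sum_distrib_left mult.assoc)
    also have "\<dots> = (\<Sum>j<d. \<Sum>i<d. u i * A x i j * w j)" by (rule sum.swap)
    also have "\<dots> = (\<Sum>j<d. \<Sum>i<d. - (w j * (A x j i * u i)))"
      by (intro sum.cong refl, subst skew) simp
    also have "\<dots> = - dot w (app (A x) u)"
      unfolding dot_def app_def sum_distrib_left sum_negf ..
    finally show ?thesis .
  qed
  have dot_cong: "dot u w = dot u' w'" if "\<And>i. i < d \<Longrightarrow> u i = u' i" "\<And>i. i < d \<Longrightarrow> w i = w' i"
    for u w u' w' using that by (simp add: dot_def)
  have Kskew: "dot u (app K w) = - dot w (app K u)" for u w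
  proof -
    have "dot u (app K w) = dot (app (A x) (app K u)) (app K w)"
      by (rule dot_cong) (simp_all add: AK)
    also have "\<dots> = dot (app K w) (app (A x) (app K u))" by (simp add: dot_def mult.commute)
    also have "\<dots> = - dot (app K u) (app (A x) (app K w))" by (rule dot_skew)
    also have "dot (app K u) (app (A x) (app K w)) = dot (app K u) w"
      by (rule dot_cong) (simp_all add: AK)
    finally show ?thesis by (simp add: dot_def mult.commute)
  qed
  have one: "x v * dot (c v) (app K (b v)) = 1" if v: "v \<in> N" for v
  proof -
    define x' where "x' = x(v := 0)"
    have vM: "v \<in> M" using v NM by auto
    have "{w. x' w \<noteq> 0} = N - {v}" by (auto simp: x'_def N_def)
    then have lt: "card {w. x' w \<noteq> 0} < card N" using card_Diff1_less[OF fN v] by simp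
    have "\<not> nonsing d (A x')"
    proof
      assume "nonsing d (A x')"
      then have "good (card {w. x' w \<noteq> 0})"
        unfolding good_def using x(2) by (intro exI[of _ x']) (simp add: x'_def)
      then have "Least good \<le> card {w. x' w \<noteq> 0}" by (rule Least_le)
      then show False using lt x(3) by (simp add: N_def)
    qed
    then obtain w j where w: "\<And>i. i < d \<Longrightarrow> (\<Sum>j<d. A x' i j * w j) = 0" "j < d" "w j \<noteq> 0"
      unfolding nonsing_def by blast
    have Ax: "A x i j = A x' i j + x v * (b v i * c v j - c v i * b v j)" for i j
      unfolding A_def sum.remove[OF M vM] by (simp add: x'_def)
    \<comment> \<open>On a kernel vector \<open>w\<close> of the smaller sum only the summand of
      \<open>v\<close> survives, so the full matrix maps \<open>w\<close> into the span of
      \<open>b v\<close> and \<open>c v\<close>.\<close>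
    have Axw: "app (A x) w i = x v * (dot (c v) w * b v i - dot (b v) w * c v i)" if "i < d" for i
    proof -
      have "app (A x) w i = (\<Sum>j<d. A x' i j * w j + x v * (b v i * (c v j * w j) - c v i * (b v j * w j)))"
        by (simp add: app_def Ax algebra_simps)
      also have "\<dots> = x v * (b v i * dot (c v) w - c v i * dot (b v) w)"
        using w(1)[OF that]
        by (simp only: sum.distrib sum_subtractf sum_distrib_left[symmetric] dot_def)
      finally show ?thesis by (simp add: algebra_simps)
    qed
    have wK: "w i = x v * (dot (c v) w * app K (b v) i - dot (b v) w * app K (c v) i)" if "i < d" for i
    proof -
      have "w i = app K (app (A x) w) i" using KA[OF that] by simp
      also have "\<dots> = (\<Sum>j<d. K i j * (x v * (dot (c v) w * b v j - dot (b v) w * c v j)))"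
        unfolding app_def[of K] by (intro sum.cong) (simp_all add: Axw)
      also have "\<dots> = (\<Sum>j<d. x v * dot (c v) w * (K i j * b v j) - x v * dot (b v) w * (K i j * c v j))"
        by (simp add: algebra_simps)
      also have "\<dots> = x v * (dot (c v) w * app K (b v) i - dot (b v) w * app K (c v) i)"
        by (simp only: sum_subtractf sum_distrib_left[symmetric] app_def) (simp add: algebra_simps)
      finally show ?thesis .
    qed
    have dw: "dot u w = x v * (dot (c v) w * dot u (app K (b v)) - dot (b v) w * dot u (app K (c v)))" for u
    proof -
      have "dot u w = (\<Sum>i<d. u i * (x v * (dot (c v) w * app K (b v) i - dot (b v) w * app K (c v) i)))"
        unfolding dot_def[of u w] by (intro sum.cong) (simp_all add: wK[symmetric])
      also have "\<dots> = (\<Sum>i<d. x v * dot (c v) w * (u i * app K (b v) i) - x v * dot (b v) w * (u i * app K (c v) i))"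
        by (simp add: algebra_simps)
      also have "\<dots> = x v * (dot (c v) w * dot u (app K (b v)) - dot (b v) w * dot u (app K (c v)))"
        by (simp only: sum_subtractf sum_distrib_left[symmetric] dot_def[of u]) (simp add: algebra_simps)
      finally show ?thesis .
    qed
    \<comment> \<open>Skewness of \<open>K\<close> kills the diagonal pairings and decouples the two
      equations: both read \<open>a = k * a\<close> with the same \<open>k\<close>, and
      \<open>w j \<noteq> 0\<close> makes one of the two values \<open>a\<close> nonzero.\<close>
    have cc: "dot (c v) (app K (c v)) = 0" "dot (b v) (app K (b v)) = 0"
      using Kskew[of "c v" "c v"] Kskew[of "b v" "b v"] by simp_all
    have bc: "dot (b v) (app K (c v)) = - dot (c v) (app K (b v))" by (rule Kskew)
    have e1: "dot (c v) w = x v * dot (c v) (app K (b v)) * dot (c v) w"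
      by (rule trans[OF dw[of "c v"]]) (simp add: cc)
    have e2: "dot (b v) w = x v * dot (c v) (app K (b v)) * dot (b v) w"
      by (rule trans[OF dw[of "b v"]]) (simp add: cc bc)
    have "dot (c v) w \<noteq> 0 \<or> dot (b v) w \<noteq> 0" using wK[OF w(2)] w(3) by auto
    moreover have "k = 1" if "a = k * a" "a \<noteq> 0" for a k :: real
      using that by (metis mult_cancel_right1)
    ultimately show ?thesis using e1 e2 by blast
  qed
  have "real d = (\<Sum>i<d. \<Sum>j<d. A x i j * K j i)" using K1 by simp
  also have "\<dots> = (\<Sum>i<d. \<Sum>j<d. \<Sum>v\<in>M. x v * (b v i * (K j i * c v j) - c v i * (K j i * b v j)))"
    unfolding A_def sum_distrib_right by (intro sum.cong refl) (simp add: algebra_simps)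
  also have "\<dots> = (\<Sum>v\<in>M. \<Sum>i<d. \<Sum>j<d. x v * (b v i * (K j i * c v j) - c v i * (K j i * b v j)))"
  proof -
    have "(\<Sum>j<d. \<Sum>v\<in>M. x v * (b v i * (K j i * c v j) - c v i * (K j i * b v j)))
        = (\<Sum>v\<in>M. \<Sum>j<d. x v * (b v i * (K j i * c v j) - c v i * (K j i * b v j)))" for i
      by (rule sum.swap)
    then show ?thesis by (simp only:) (rule sum.swap)
  qed
  also have "\<dots> = (\<Sum>v\<in>M. x v * (dot (c v) (app K (b v)) - dot (b v) (app K (c v))))"
  proof (intro sum.cong refl)
    fix v
    have s: "(\<Sum>i<d. u i * (\<Sum>j<d. K j i * w j)) = dot w (app K u)" for u w
      unfolding dot_def app_def sum_distrib_left
      by (subst sum.swap) (intro sum.cong refl, simp add: algebra_simps)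
    show "(\<Sum>i<d. \<Sum>j<d. x v * (b v i * (K j i * c v j) - c v i * (K j i * b v j)))
      = x v * (dot (c v) (app K (b v)) - dot (b v) (app K (c v)))"
      by (simp only: sum_distrib_left[symmetric] sum_subtractf s)
  qed
  also have "\<dots> = (\<Sum>v\<in>M. 2 * (x v * dot (c v) (app K (b v))))"
  proof (intro sum.cong refl)
    fix v
    show "x v * (dot (c v) (app K (b v)) - dot (b v) (app K (c v))) = 2 * (x v * dot (c v) (app K (b v)))"
      by (subst Kskew[of "b v"]) (simp add: algebra_simps)
  qed
  also have "\<dots> = (\<Sum>v\<in>N. 2 * (x v * dot (c v) (app K (b v))))"
    by (rule sum.mono_neutral_right[OF M NM]) (auto simp: N_def)
  also have "\<dots> = real (2 * card N)" using one by simp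
  finally have card: "2 * card N = d" by linarith
  have zero: "x v = 0" if "v \<notin> N" for v using that by (simp add: N_def)
  have "nonsing d (\<lambda>i j. \<Sum>v\<in>M. x v * (b v i * c v j - c v i * b v j))"
    using x(1) by (simp add: A_def[abs_def])
  with NM card zero show thesis by (rule that)
qed

section \<open>Cycle spaces\<close>

text \<open>Unlike \<open>simple_graph\<close>, this admits an empty vertex set, so that inductions
  can delete vertices down to nothing.\<close>

definition gr :: "'a set \<Rightarrow> 'a set set \<Rightarrow> bool" where
  "gr V E \<longleftrightarrow> finite V \<and> (\<forall>e\<in>E. e \<subseteq> V \<and> card e = 2)"

definition deg :: "'a set set \<Rightarrow> 'a \<Rightarrow> nat" where
  "deg E v = card {e \<in> E. v \<in> e}"

definition conn :: "'a set set \<Rightarrow> 'a \<Rightarrow> 'a \<Rightarrow> bool" where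
  "conn E u v \<longleftrightarrow> (u, v) \<in> {(a, b). {a, b} \<in> E}\<^sup>*"

text \<open>
  A flow is an antisymmetric function on ordered pairs of vertices, supported on the edges and
  with zero divergence everywhere. This avoids choosing an orientation.
\<close>

definition cyc :: "'a set set \<Rightarrow> ('a \<Rightarrow> 'a \<Rightarrow> real) set" where
  "cyc E = {y. (\<forall>u v. y u v = - y v u) \<and> (\<forall>u v. {u, v} \<notin> E \<longrightarrow> y u v = 0) \<and>
     (\<forall>u. (\<Sum>v\<in>\<Union>E. y u v) = 0)}"

lemma grD:
  assumes "gr V E"
  shows "finite V" "finite E" "\<Union>E \<subseteq> V" "\<And>e. e \<in> E \<Longrightarrow> e \<subseteq> V" "\<And>e. e \<in> E \<Longrightarrow> card e = 2"
    "\<And>u v. {u, v} \<in> E \<Longrightarrow> u \<in> V \<and> v \<in> V \<and> u \<noteq> v"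
proof -
  show V: "finite V" and "\<Union>E \<subseteq> V" and "\<And>e. e \<in> E \<Longrightarrow> e \<subseteq> V" "\<And>e. e \<in> E \<Longrightarrow> card e = 2"
    using assms by (auto simp: gr_def)
  have "E \<subseteq> Pow V" using assms by (auto simp: gr_def)
  then show "finite E" using V by (meson finite_Pow_iff finite_subset)
  show "u \<in> V \<and> v \<in> V \<and> u \<noteq> v" if "{u, v} \<in> E" for u v
    using assms that by (force simp: gr_def)
qed

lemma gr_subset: "gr V E \<Longrightarrow> E' \<subseteq> E \<Longrightarrow> gr V E'"
  by (auto simp: gr_def)

lemma gr_restrict: "gr V E \<Longrightarrow> V' \<subseteq> V \<Longrightarrow> (\<And>e. e \<in> E' \<Longrightarrow> e \<in> E \<and> e \<subseteq> V') \<Longrightarrow> gr V' E'"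
  by (auto simp: gr_def intro: finite_subset)

lemma gr_edge:
  assumes "gr V E" "e \<in> E"
  obtains u v where "e = {u, v}" "u \<noteq> v" "u \<in> V" "v \<in> V"
  using assms by (metis card_2_iff grD(5,6))

lemma cyc_antisym: "y \<in> cyc E \<Longrightarrow> y u v = - y v u"
  unfolding cyc_def by blast

lemma cyc_outside: "y \<in> cyc E \<Longrightarrow> {u, v} \<notin> E \<Longrightarrow> y u v = 0"
  unfolding cyc_def by blast

lemma support_sum_eq:
  assumes "gr V E" "\<And>u v. {u, v} \<notin> E \<Longrightarrow> y u v = (0::real)"
  shows "(\<Sum>v\<in>V. y u v) = (\<Sum>v\<in>\<Union>E. y u v)"
  using grD[OF assms(1)] by (intro sum.mono_neutral_right) (auto intro!: assms(2))

lemma cyc_sum: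
  assumes "gr V E" "y \<in> cyc E"
  shows "(\<Sum>v\<in>V. y u v) = 0"
proof -
  have "(\<Sum>v\<in>\<Union>E. y u v) = 0" using assms(2) unfolding cyc_def by blast
  moreover have "(\<Sum>v\<in>V. y u v) = (\<Sum>v\<in>\<Union>E. y u v)"
    by (rule support_sum_eq[OF assms(1)]) (rule cyc_outside[OF assms(2)])
  ultimately show ?thesis by simp
qed

lemma cycI:
  assumes "gr V E" "\<And>u v. y u v = - y v u" "\<And>u v. {u, v} \<notin> E \<Longrightarrow> y u v = 0"
    "\<And>u. u \<in> V \<Longrightarrow> (\<Sum>v\<in>V. y u v) = 0"
  shows "y \<in> cyc E"
proof -
  have "(\<Sum>v\<in>\<Union>E. y u v) = 0" for u
  proof (cases "u \<in> V")
    case True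
    then show ?thesis using assms(4) support_sum_eq[OF assms(1), of y u] assms(3) by metis
  next
    case False
    then have "y u v = 0" for v using assms(3) grD(6)[OF assms(1)] by metis
    then show ?thesis by simp
  qed
  then show ?thesis unfolding cyc_def using assms(2,3) by blast
qed

lemma cyc_subgraph:
  assumes "gr V E" "E' \<subseteq> E"
  shows "y \<in> cyc E' \<longleftrightarrow> y \<in> cyc E \<and> (\<forall>u v. {u, v} \<notin> E' \<longrightarrow> y u v = 0)"
proof
  have g': "gr V E'" using assms gr_subset by blast
  assume y: "y \<in> cyc E'"
  have "y \<in> cyc E"
    using assms(1)
  proof (rule cycI)
    show "y u v = - y v u" for u v using y by (rule cyc_antisym)
    show "{u, v} \<notin> E \<Longrightarrow> y u v = 0" for u v using cyc_outside[OF y] assms(2) by blast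
    show "(\<Sum>v\<in>V. y u v) = 0" for u using cyc_sum[OF g' y] .
  qed
  then show "y \<in> cyc E \<and> (\<forall>u v. {u, v} \<notin> E' \<longrightarrow> y u v = 0)"
    using cyc_outside[OF y] by blast
next
  have g': "gr V E'" using assms gr_subset by blast
  assume y: "y \<in> cyc E \<and> (\<forall>u v. {u, v} \<notin> E' \<longrightarrow> y u v = 0)"
  show "y \<in> cyc E'"
    using g'
  proof (rule cycI)
    show "y u v = - y v u" for u v using y cyc_antisym[of y E u v] by blast
    show "{u, v} \<notin> E' \<Longrightarrow> y u v = 0" for u v using y by blast
    show "(\<Sum>v\<in>V. y u v) = 0" for u using cyc_sum[OF assms(1)] y by blast
  qed
qed

lemma cyc_mono: "gr V E \<Longrightarrow> E' \<subseteq> E \<Longrightarrow> cyc E' \<subseteq> cyc E"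
  using cyc_subgraph by blast

lemma cyc_lincomb:
  assumes "\<And>i. i \<in> I \<Longrightarrow> f i \<in> cyc E"
  shows "(\<lambda>u v. \<Sum>i\<in>I. a i * f i u v) \<in> cyc E"
proof -
  have "(\<Sum>i\<in>I. a i * f i u v) = - (\<Sum>i\<in>I. a i * f i v u)" for u v
    unfolding sum_negf[symmetric]
    by (intro sum.cong refl) (use cyc_antisym[OF assms, of _ u v] in simp)
  moreover have "(\<Sum>i\<in>I. a i * f i u v) = 0" if "{u, v} \<notin> E" for u v
    using cyc_outside[OF assms that] by (intro sum.neutral) auto
  moreover have "(\<Sum>v\<in>\<Union>E. \<Sum>i\<in>I. a i * f i u v) = 0" for u
  proof -
    have "(\<Sum>v\<in>\<Union>E. \<Sum>i\<in>I. a i * f i u v) = (\<Sum>i\<in>I. a i * (\<Sum>v\<in>\<Union>E. f i u v))"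
      by (subst sum.swap) (simp add: sum_distrib_left)
    also have "\<dots> = 0"
    proof (intro sum.neutral ballI)
      fix i assume "i \<in> I"
      then have "(\<Sum>v\<in>\<Union>E. f i u v) = 0" using assms unfolding cyc_def by blast
      then show "a i * (\<Sum>v\<in>\<Union>E. f i u v) = 0" by simp
    qed
    finally show ?thesis .
  qed
  ultimately show ?thesis unfolding cyc_def by blast
qed

lemma cyc_comb:
  assumes "y \<in> cyc E" "z \<in> cyc E"
  shows "(\<lambda>u v. a * y u v + b * z u v) \<in> cyc E"
  using cyc_lincomb[of "{0, 1 :: nat}" "\<lambda>i. if i = 0 then y else z" E "\<lambda>i. if i = 0 then a else b"] assms
  by simp

section \<open>Dimension of the cycle space\<close>

interpretation fl: vector_space "\<lambda>(c::real) (f::'a \<Rightarrow> 'a \<Rightarrow> real) u v. c * f u v"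
  by unfold_locales (auto simp: fun_eq_iff algebra_simps)

text \<open>This is the cyclomatic number. It depends on the edge set alone, and the cycle spaces of
  all subgraphs are subspaces of one function space, so they can be compared as sets.\<close>

definition beta :: "'a set set \<Rightarrow> nat" where
  "beta E = fl.dim (cyc E)"

lemma sum_fun_apply2: "(\<Sum>i\<in>I. g i) u v = (\<Sum>i\<in>I. g i u (v :: 'b) :: real)"
  by (induction I rule: infinite_finite_induct) auto

lemma beta_le:
  assumes "finite I" "\<And>y. y \<in> cyc E \<Longrightarrow> \<exists>a. \<forall>u v. y u v = (\<Sum>i\<in>I. a i * f i u v)"
  shows "beta E \<le> card I"
proof -
  have "cyc E \<subseteq> fl.span (f ` I)"
  proof
    fix y assume "y \<in> cyc E"
    then obtain a where "\<forall>u v. y u v = (\<Sum>i\<in>I. a i * f i u v)" using assms(2) by blast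
    then have "y = (\<Sum>i\<in>I. (\<lambda>u v. a i * f i u v))" by (auto simp: fun_eq_iff sum_fun_apply2)
    also have "\<dots> \<in> fl.span (f ` I)"
      by (intro fl.span_sum fl.span_scale fl.span_base) auto
    finally show "y \<in> fl.span (f ` I)" .
  qed
  then have "beta E \<le> card (f ` I)"
    unfolding beta_def using assms(1) by (intro fl.dim_le_card) auto
  also have "\<dots> \<le> card I" by (rule card_image_le[OF assms(1)])
  finally show ?thesis .
qed

lemma cyc_finite_span:
  assumes "gr V E"
  obtains T where "finite T" "cyc E \<subseteq> fl.span T"
proof
  let ?el = "\<lambda>(a, b) u v. if u = a \<and> v = b then 1 else (0::real)"
  show "finite (?el ` (V \<times> V))" using grD(1)[OF assms] by simp
  show "cyc E \<subseteq> fl.span (?el ` (V \<times> V))"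
  proof
    fix y assume y: "y \<in> cyc E"
    have "y = (\<Sum>p\<in>V \<times> V. (\<lambda>u v. y (fst p) (snd p) * ?el p u v))"
    proof (intro ext)
      fix u v
      show "y u v = (\<Sum>p\<in>V \<times> V. (\<lambda>u v. y (fst p) (snd p) * ?el p u v)) u v"
      proof (cases "(u, v) \<in> V \<times> V")
        case True
        have "(\<Sum>p\<in>V \<times> V. y (fst p) (snd p) * ?el p u v)
            = (\<Sum>p\<in>V \<times> V. if p = (u, v) then y u v else 0)"
          by (intro sum.cong) (auto split: if_splits)
        then show ?thesis using True grD(1)[OF assms] by (simp add: sum_fun_apply2)
      next
        case False
        then have "y u v = 0" using cyc_outside[OF y] grD(6)[OF assms] by blast
        moreover have "(\<Sum>p\<in>V \<times> V. y (fst p) (snd p) * ?el p u v) = 0"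
          using False by (intro sum.neutral) auto
        ultimately show ?thesis by (simp add: sum_fun_apply2)
      qed
    qed
    also have "\<dots> \<in> fl.span (?el ` (V \<times> V))"
      by (intro fl.span_sum fl.span_scale fl.span_base imageI) 
    finally show "y \<in> fl.span (?el ` (V \<times> V))" .
  qed
qed

lemma cyc_basis_set:
  assumes "gr V E"
  obtains B where "B \<subseteq> cyc E" "finite B" "fl.independent B" "cyc E \<subseteq> fl.span B" "card B = beta E"
proof -
  obtain B where B: "B \<subseteq> cyc E" "fl.independent B" "cyc E \<subseteq> fl.span B" "card B = fl.dim (cyc E)"
    using fl.basis_exists .
  obtain T where T: "finite T" "cyc E \<subseteq> fl.span T" using cyc_finite_span[OF assms] .
  have "finite B" using fl.independent_span_bound[OF T(1) B(2)] B(1) T(2) by blast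
  then show thesis using that B by (simp add: beta_def)
qed

text \<open>Independence is asked of an indexed family rather than of a set, so that families coming
  from different subgraphs can be glued over a disjoint sum of index sets.\<close>

lemma le_beta:
  assumes "gr V E" "finite I" "\<And>i. i \<in> I \<Longrightarrow> f i \<in> cyc E"
    and ind: "\<And>a i. (\<And>u v. (\<Sum>i\<in>I. a i * f i u v) = 0) \<Longrightarrow> i \<in> I \<Longrightarrow> a i = 0"
  shows "card I \<le> beta E"
proof -
  obtain B where "B \<subseteq> cyc E" and B1: "finite B" and "fl.independent B"
    and B2: "cyc E \<subseteq> fl.span B" and B3: "card B = beta E"
    using cyc_basis_set[OF assms(1)] .
  note B = B1 B2 B3
  have inj: "inj_on f I"
  proof (rule inj_onI, rule ccontr)
    fix i j assume ij: "i \<in> I" "j \<in> I" "f i = f j" "i \<noteq> j"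
    \<comment> \<open>A repeated member of the family would give the nontrivial relation with
      coefficients 1 and -1.\<close>
    define a where "a k = (if k = i then 1 else if k = j then -1 else (0::real))" for k
    have "(\<Sum>k\<in>I. a k * f k u v) = (\<Sum>k\<in>{i, j}. a k * f k u v)" for u v
      using ij assms(2) by (intro sum.mono_neutral_right) (auto simp: a_def)
    then have "(\<Sum>k\<in>I. a k * f k u v) = 0" for u v using ij by (simp add: a_def)
    then have "a i = 0" using ind ij(1) by blast
    then show False by (simp add: a_def)
  qed
  have "fl.independent (f ` I)"
  proof (rule fl.independent_if_scalars_zero)
    show "finite (f ` I)" using assms(2) by simp
    fix g x assume s: "(\<Sum>x\<in>f ` I. (\<lambda>u v. g x * x u v)) = 0" and x: "x \<in> f ` I"
    have "(\<Sum>i\<in>I. g (f i) * f i u v) = 0" for u v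
    proof -
      have "(\<Sum>i\<in>I. g (f i) * f i u v) = (\<Sum>x\<in>f ` I. (\<lambda>u v. g x * x u v)) u v"
        by (simp add: sum_fun_apply2 sum.reindex[OF inj])
      then show ?thesis by (simp add: s)
    qed
    then show "g x = 0" using ind[of "\<lambda>i. g (f i)"] x by blast
  qed
  moreover have "f ` I \<subseteq> fl.span B" using assms(3) B(2) by blast
  ultimately have "card (f ` I) \<le> card B" using fl.independent_span_bound[OF B(1)] by blast
  then show ?thesis using B(3) by (simp add: card_image[OF inj])
qed

lemma cyc_basis:
  assumes "gr V E"
  shows "\<exists>f. (\<forall>i<beta E. f i \<in> cyc E) \<and>
    (\<forall>a. (\<forall>u v. (\<Sum>i<beta E. a i * f i u v) = 0) \<longrightarrow> (\<forall>i<beta E. a i = 0)) \<and>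
    (\<forall>y\<in>cyc E. \<exists>a. \<forall>u v. y u v = (\<Sum>i<beta E. a i * f i u v))"
proof -
  obtain B where B: "B \<subseteq> cyc E" "finite B" "fl.independent B" "cyc E \<subseteq> fl.span B" "card B = beta E"
    using cyc_basis_set[OF assms] .
  obtain f where f: "bij_betw f {..<beta E} B"
    using ex_bij_betw_nat_finite[OF B(2)] B(5) by (auto simp: atLeast0LessThan)
  show ?thesis
  proof (intro exI[of _ f] conjI allI impI ballI)
    show "f i \<in> cyc E" if "i < beta E" for i using that f B(1) by (auto simp: bij_betw_def)
  next
    fix a i assume a: "\<forall>u v. (\<Sum>i<beta E. a i * f i u v) = 0" and i: "i < beta E"
    let ?g = "the_inv_into {..<beta E} f"
    have inj: "inj_on f {..<beta E}" and im: "f ` {..<beta E} = B" using f by (auto simp: bij_betw_def)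
    have "(\<Sum>x\<in>B. (\<lambda>u v. a (?g x) * x u v)) u v = (\<Sum>i<beta E. a i * f i u v)" for u v
      unfolding im[symmetric] sum.reindex[OF inj] sum_fun_apply2
      by (intro sum.cong) (simp_all add: the_inv_into_f_f[OF inj])
    then have "(\<Sum>x\<in>B. (\<lambda>u v. a (?g x) * x u v)) = 0" using a by (simp add: fun_eq_iff)
    then have "a (?g (f i)) = 0" using fl.independentD[OF B(3,2) subset_refl, of "a \<circ> ?g" "f i"] i im by auto
    then show "a i = 0" using the_inv_into_f_f[OF inj] i by simp
  next
    fix y assume "y \<in> cyc E"
    then have "y \<in> fl.span B" using B(4) by blast
    then obtain c where c: "y = (\<Sum>x\<in>B. (\<lambda>u v. c x * x u v))"
      unfolding fl.span_finite[OF B(2)] by blast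
    show "\<exists>a. \<forall>u v. y u v = (\<Sum>i<beta E. a i * f i u v)"
    proof (intro exI[of _ "\<lambda>i. c (f i)"] allI)
      show "y u v = (\<Sum>i<beta E. c (f i) * f i u v)" for u v
        unfolding c sum_fun_apply2 by (rule sum.reindex_bij_betw[OF f, symmetric])
    qed
  qed
qed

lemma beta_eq_0_iff:
  assumes "gr V E"
  shows "beta E = 0 \<longleftrightarrow> (\<forall>y\<in>cyc E. \<forall>u v. y u v = 0)"
proof
  assume "beta E = 0"
  obtain f where "\<And>i. i < beta E \<Longrightarrow> f i \<in> cyc E"
    "\<And>a i. (\<And>u v. (\<Sum>i<beta E. a i * f i u v) = 0) \<Longrightarrow> i < beta E \<Longrightarrow> a i = 0"
    and f: "\<And>y. y \<in> cyc E \<Longrightarrow> \<exists>a. \<forall>u v. y u v = (\<Sum>i<beta E. a i * f i u v)"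
    using cyc_basis[OF assms] by blast
  show "\<forall>y\<in>cyc E. \<forall>u v. y u v = 0"
    using f \<open>beta E = 0\<close> by fastforce
next
  assume "\<forall>y\<in>cyc E. \<forall>u v. y u v = 0"
  then show "beta E = 0" using beta_le[of "{}" E] by simp
qed

lemma beta_empty [simp]: "beta {} = 0"
proof -
  have "y u v = 0" if "y \<in> cyc {}" for y :: "'a \<Rightarrow> 'a \<Rightarrow> real" and u v
    using cyc_outside[OF that] by simp
  then show ?thesis using beta_le[of "{}" "{} :: 'a set set"] by simp
qed

text \<open>At every pair of vertices one of the two partial combinations vanishes, because the edge
  sets are disjoint; so a vanishing total splits into two vanishing combinations.\<close>

lemma beta_superadditive:
  assumes "gr V E" "E1 \<subseteq> E" "E2 \<subseteq> E" "E1 \<inter> E2 = {}"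
  shows "beta E1 + beta E2 \<le> beta E"
proof -
  have g: "gr V E1" "gr V E2" using assms gr_subset by blast+
  obtain f1 where f1: "\<And>i. i < beta E1 \<Longrightarrow> f1 i \<in> cyc E1"
    "\<And>a i. (\<And>u v. (\<Sum>i<beta E1. a i * f1 i u v) = 0) \<Longrightarrow> i < beta E1 \<Longrightarrow> a i = 0"
    "\<And>y. y \<in> cyc E1 \<Longrightarrow> \<exists>a. \<forall>u v. y u v = (\<Sum>i<beta E1. a i * f1 i u v)"
    using cyc_basis[OF g(1)] by blast
  obtain f2 where f2: "\<And>i. i < beta E2 \<Longrightarrow> f2 i \<in> cyc E2"
    "\<And>a i. (\<And>u v. (\<Sum>i<beta E2. a i * f2 i u v) = 0) \<Longrightarrow> i < beta E2 \<Longrightarrow> a i = 0"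
    "\<And>y. y \<in> cyc E2 \<Longrightarrow> \<exists>a. \<forall>u v. y u v = (\<Sum>i<beta E2. a i * f2 i u v)"
    using cyc_basis[OF g(2)] by blast
  have "card ({..<beta E1} <+> {..<beta E2}) \<le> beta E"
  proof (rule le_beta[OF assms(1), where f = "case_sum f1 f2"])
    show "case_sum f1 f2 i \<in> cyc E" if "i \<in> {..<beta E1} <+> {..<beta E2}" for i
      using that f1(1) f2(1) cyc_mono[OF assms(1,2)] cyc_mono[OF assms(1,3)] by auto
  next
    fix a i assume s: "\<And>u v. (\<Sum>i\<in>{..<beta E1} <+> {..<beta E2}. a i * case_sum f1 f2 i u v) = 0"
      and i: "i \<in> {..<beta E1} <+> {..<beta E2}"
    have s': "(\<Sum>i<beta E1. a (Inl i) * f1 i u v) + (\<Sum>i<beta E2. a (Inr i) * f2 i u v) = 0" for u v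
      using s[of u v] by (simp add: sum.Plus)
    have z1: "(\<Sum>i<beta E1. a (Inl i) * f1 i u v) = 0" if "{u, v} \<notin> E1" for u v
      using cyc_outside[OF f1(1) that] by (intro sum.neutral) auto
    have z2: "(\<Sum>i<beta E2. a (Inr i) * f2 i u v) = 0" if "{u, v} \<notin> E2" for u v
      using cyc_outside[OF f2(1) that] by (intro sum.neutral) auto
    have "(\<Sum>i<beta E1. a (Inl i) * f1 i u v) = 0" "(\<Sum>i<beta E2. a (Inr i) * f2 i u v) = 0" for u v
    proof -
      have "{u, v} \<notin> E1 \<or> {u, v} \<notin> E2" using assms(4) by blast
      then show "(\<Sum>i<beta E1. a (Inl i) * f1 i u v) = 0" "(\<Sum>i<beta E2. a (Inr i) * f2 i u v) = 0"
        using s'[of u v] z1[of u v] z2[of u v] by linarith+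
    qed
    then show "a i = 0"
      using i f1(2)[of "\<lambda>i. a (Inl i)"] f2(2)[of "\<lambda>i. a (Inr i)"] by auto
  qed simp
  then show ?thesis by (simp add: card_Plus)
qed

lemma beta_mono: "gr V E \<Longrightarrow> E' \<subseteq> E \<Longrightarrow> beta E' \<le> beta E"
  using beta_superadditive[of V E E' "{}"] by simp

text \<open>A vertex meets edges of only one part, so cutting a flow down to one part keeps its
  divergence zero.\<close>

lemma beta_disjoint_union:
  assumes "gr V (E1 \<union> E2)" "\<Union>E1 \<inter> \<Union>E2 = {}"
  shows "beta (E1 \<union> E2) \<le> beta E1 + beta E2"
proof -
  have g: "gr V E1" "gr V E2" using gr_subset[OF assms(1)] by blast+
  obtain f1 where f1: "\<And>i. i < beta E1 \<Longrightarrow> f1 i \<in> cyc E1"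
    "\<And>a i. (\<And>u v. (\<Sum>i<beta E1. a i * f1 i u v) = 0) \<Longrightarrow> i < beta E1 \<Longrightarrow> a i = 0"
    "\<And>y. y \<in> cyc E1 \<Longrightarrow> \<exists>a. \<forall>u v. y u v = (\<Sum>i<beta E1. a i * f1 i u v)"
    using cyc_basis[OF g(1)] by blast
  obtain f2 where f2: "\<And>i. i < beta E2 \<Longrightarrow> f2 i \<in> cyc E2"
    "\<And>a i. (\<And>u v. (\<Sum>i<beta E2. a i * f2 i u v) = 0) \<Longrightarrow> i < beta E2 \<Longrightarrow> a i = 0"
    "\<And>y. y \<in> cyc E2 \<Longrightarrow> \<exists>a. \<forall>u v. y u v = (\<Sum>i<beta E2. a i * f2 i u v)"
    using cyc_basis[OF g(2)] by blast
  have restrict: "(\<lambda>u v. if {u, v} \<in> F then y u v else 0) \<in> cyc F"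
    if y: "y \<in> cyc (E1 \<union> E2)" and F: "F \<subseteq> E1 \<union> E2" "gr V F"
      and dis: "\<Union>F \<inter> \<Union>(E1 \<union> E2 - F) = {}" for y F
    using F(2)
  proof (rule cycI)
    show "(if {u, v} \<in> F then y u v else 0) = - (if {v, u} \<in> F then y v u else 0)" for u v
      using cyc_antisym[OF y, of u v] by (simp add: insert_commute)
    fix u
    show "(\<Sum>v\<in>V. if {u, v} \<in> F then y u v else 0) = 0"
    proof (cases "u \<in> \<Union>F")
      case True
      have "(if {u, v} \<in> F then y u v else 0) = y u v" for v
      proof -
        have "{u, v} \<notin> E1 \<union> E2 - F" using True dis by blast
        then show ?thesis using cyc_outside[OF y, of u v] by auto
      qed
      then show ?thesis using cyc_sum[OF assms(1) y] by simp
    next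
      case False
      then have "{u, v} \<notin> F" for v by auto
      then show ?thesis by simp
    qed
  qed simp
  have ne: "e \<noteq> {}" if "e \<in> E1 \<union> E2" for e using grD(5)[OF assms(1) that] by auto
  have "beta (E1 \<union> E2) \<le> card ({..<beta E1} <+> {..<beta E2})"
  proof (rule beta_le[where f = "case_sum f1 f2"])
    fix y assume y: "y \<in> cyc (E1 \<union> E2)"
    have dj: "E1 \<inter> E2 = {}" using assms(2) ne by blast
    have m1: "(\<lambda>u v. if {u, v} \<in> E1 then y u v else 0) \<in> cyc E1"
      using assms(2) by (intro restrict y g) auto
    obtain a1 where a1: "\<forall>u v. (if {u, v} \<in> E1 then y u v else 0) = (\<Sum>i<beta E1. a1 i * f1 i u v)"
      using f1(3)[OF m1] by (rule exE)
    have m2: "(\<lambda>u v. if {u, v} \<in> E2 then y u v else 0) \<in> cyc E2"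
      using assms(2) by (intro restrict y g) auto
    obtain a2 where a2: "\<forall>u v. (if {u, v} \<in> E2 then y u v else 0) = (\<Sum>i<beta E2. a2 i * f2 i u v)"
      using f2(3)[OF m2] by (rule exE)
    have "y u v = (\<Sum>i\<in>{..<beta E1} <+> {..<beta E2}. case_sum a1 a2 i * case_sum f1 f2 i u v)" for u v
    proof -
      have "y u v = (if {u, v} \<in> E1 then y u v else 0) + (if {u, v} \<in> E2 then y u v else 0)"
        using cyc_outside[OF y, of u v] dj by auto
      also have "\<dots> = (\<Sum>i<beta E1. a1 i * f1 i u v) + (\<Sum>i<beta E2. a2 i * f2 i u v)"
        using a1[rule_format, of u v] a2[rule_format, of u v] by linarith
      finally show ?thesis by (simp add: sum.Plus)
    qed
    then show "\<exists>a. \<forall>u v. y u v = (\<Sum>i\<in>{..<beta E1} <+> {..<beta E2}. a i * case_sum f1 f2 i u v)"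
      by blast
  qed simp
  then show ?thesis by (simp add: card_Plus)
qed

section \<open>Connectivity, bridges and deletion of edges\<close>

lemma conn_refl [simp]: "conn E u u"
  by (simp add: conn_def)

lemma conn_edge: "{u, v} \<in> E \<Longrightarrow> conn E u v"
  by (auto simp: conn_def)

lemma conn_trans: "conn E u v \<Longrightarrow> conn E v w \<Longrightarrow> conn E u w"
  by (auto simp: conn_def)

lemma conn_sym: "conn E u v \<Longrightarrow> conn E v u"
  unfolding conn_def
  by (rule symD[OF sym_rtrancl]) (auto simp: sym_def insert_commute)

lemma conn_mono: "conn E u v \<Longrightarrow> E \<subseteq> E' \<Longrightarrow> conn E' u v"
  unfolding conn_def by (rule set_mp[OF rtrancl_mono]) auto

text \<open>Each step of the walk adds one unit along its edge and thereby moves the sink from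
  \<open>v\<close> to \<open>w\<close>. Edges that are used repeatedly just accumulate, so walks
  with repetitions cause no trouble.\<close>

lemma conn_path_flow:
  assumes "gr V E" "conn E u v" "u \<in> V"
  shows "v \<in> V \<and> (\<exists>y. (\<forall>a b. y a b = - y b a) \<and> (\<forall>a b. {a, b} \<notin> E \<longrightarrow> y a b = (0::real)) \<and>
    (\<forall>w. (\<Sum>z\<in>V. y w z) = (if w = u then 1 else 0) - (if w = v then 1 else 0)))"
  using assms(2) unfolding conn_def
proof (induction rule: rtrancl_induct)
  case base
  then show ?case using assms(3) by (intro conjI exI[of _ "\<lambda>_ _. 0"]) auto
next
  case (step v w)
  then have vw: "{v, w} \<in> E" by simp
  then have V: "v \<in> V" "w \<in> V" "v \<noteq> w" using grD(6)[OF assms(1)] by blast+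
  obtain y where ya: "\<forall>a b. y a b = - y b a" "\<forall>a b. {a, b} \<notin> E \<longrightarrow> y a b = (0::real)"
    "\<forall>w. (\<Sum>z\<in>V. y w z) = (if w = u then 1 else 0) - (if w = v then 1 else 0)"
    using step.IH by (elim conjE exE) (rule that)
  note y = ya[rule_format]
  define y' where "y' a b = y a b + (if a = v \<and> b = w then 1 else 0) - (if b = v \<and> a = w then 1 else 0)" for a b
  have A1: "y' a b = - y' b a" for a b unfolding y'_def using y(1)[of a b] by linarith
  have A2: "y' a b = 0" if "{a, b} \<notin> E" for a b
  proof -
    have "{w, v} \<in> E" by (subst insert_commute) (rule vw)
    then have "\<not> (a = v \<and> b = w)" "\<not> (b = v \<and> a = w)" using that vw by blast+
    then have "(if a = v \<and> b = w then 1 else 0) = (0::real)" "(if b = v \<and> a = w then 1 else 0) = (0::real)"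
      by (simp_all only: if_False)
    then show ?thesis unfolding y'_def using y(2)[OF that] by linarith
  qed
  have A3: "(\<Sum>z\<in>V. y' x z) = (if x = u then 1 else 0) - (if x = w then 1 else 0)" for x
  proof -
    have "(\<Sum>z\<in>V. (if x = v \<and> z = w then 1 else 0 :: real)) = (if x = v then 1 else 0)"
      "(\<Sum>z\<in>V. (if z = v \<and> x = w then 1 else 0 :: real)) = (if x = w then 1 else 0)"
      using V grD(1)[OF assms(1)] by (cases "x = v"; cases "x = w"; simp)+
    moreover have "(\<Sum>z\<in>V. y' x z) = (\<Sum>z\<in>V. y x z)
        + (\<Sum>z\<in>V. if x = v \<and> z = w then 1 else 0) - (\<Sum>z\<in>V. if z = v \<and> x = w then 1 else 0)"
      by (simp only: y'_def sum.distrib sum_subtractf)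
    ultimately show ?thesis using y(3)[of x] by linarith
  qed
  show ?case by (intro conjI exI[of _ y'] allI impI V(2) A1 A2 A3)
qed

text \<open>A unit flow from \<open>v\<close> back to \<open>u\<close> that avoids the edge is
  closed up by one unit on the edge itself.\<close>

lemma nonbridge_flow:
  assumes g: "gr V E" and e: "{u, v} \<in> E" and c: "conn (E - {{u, v}}) u v"
  obtains y where "y \<in> cyc E" "y u v = 1"
proof -
  have V: "u \<in> V" "v \<in> V" "u \<noteq> v" using grD(6)[OF g e] by blast+
  have g': "gr V (E - {{u, v}})" using gr_subset[OF g] by blast
  obtain y where ya: "\<forall>a b. y a b = - y b a" "\<forall>a b. {a, b} \<notin> E - {{u, v}} \<longrightarrow> y a b = (0::real)"
    "\<forall>w. (\<Sum>z\<in>V. y w z) = (if w = v then 1 else 0) - (if w = u then 1 else 0)"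
    using conn_path_flow[OF g' conn_sym[OF c] V(2)] by (elim conjE exE) (rule that)
  note y = ya[rule_format]
  define y' where "y' a b = y a b + (if a = u \<and> b = v then 1 else 0) - (if b = u \<and> a = v then 1 else 0)" for a b
  have "y' \<in> cyc E"
    using g
  proof (rule cycI)
    show "y' a b = - y' b a" for a b unfolding y'_def using y(1)[of a b] by linarith
    show "y' a b = 0" if "{a, b} \<notin> E" for a b
    proof -
      have "{v, u} \<in> E" by (subst insert_commute) (rule e)
      then have "\<not> (a = u \<and> b = v)" "\<not> (b = u \<and> a = v)" using that e by blast+
      then have "(if a = u \<and> b = v then 1 else 0) = (0::real)" "(if b = u \<and> a = v then 1 else 0) = (0::real)"
        by (simp_all only: if_False)
      then show ?thesis unfolding y'_def using y(2)[of a b] that by force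
    qed
    show "(\<Sum>z\<in>V. y' x z) = 0" for x
    proof -
      have "(\<Sum>z\<in>V. (if z = u \<and> x = v then 1 else 0 :: real)) = (if x = v then 1 else 0)"
        "(\<Sum>z\<in>V. (if x = u \<and> z = v then 1 else 0 :: real)) = (if x = u then 1 else 0)"
        using V grD(1)[OF g] by (cases "x = v"; cases "x = u"; simp)+
      moreover have "(\<Sum>z\<in>V. y' x z) = (\<Sum>z\<in>V. y x z)
          + (\<Sum>z\<in>V. if x = u \<and> z = v then 1 else 0) - (\<Sum>z\<in>V. if z = u \<and> x = v then 1 else 0)"
        by (simp only: y'_def sum.distrib sum_subtractf)
      ultimately show ?thesis using y(3)[of x] by linarith
    qed
  qed
  moreover have "y' u v = 1" using y(2)[of u v] V by (simp add: y'_def)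
  ultimately show thesis by (rule that)
qed

text \<open>Summing the divergences over \<open>A\<close> leaves only the pairs that leave
  \<open>A\<close>; those inside cancel by antisymmetry.\<close>

lemma cyc_cut:
  assumes "gr V E" "y \<in> cyc E" "A \<subseteq> V"
  shows "(\<Sum>a\<in>A. \<Sum>b\<in>V - A. y a b) = 0"
proof -
  have fV: "finite V" "finite A" using grD(1)[OF assms(1)] assms(3) finite_subset by blast+
  have "(\<Sum>a\<in>A. \<Sum>b\<in>A. y a b) = (\<Sum>b\<in>A. \<Sum>a\<in>A. y a b)" by (rule sum.swap)
  also have "\<dots> = (\<Sum>b\<in>A. \<Sum>a\<in>A. - y b a)"
    by (intro sum.cong refl cyc_antisym[OF assms(2)])
  finally have "(\<Sum>a\<in>A. \<Sum>b\<in>A. y a b) = 0" by (simp add: sum_negf)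
  moreover have "(\<Sum>b\<in>V - A. y a b) + (\<Sum>b\<in>A. y a b) = 0" for a
    using sum.subset_diff[OF assms(3) fV(1), of "y a"] cyc_sum[OF assms(1,2), of a] by linarith
  then have "(\<Sum>a\<in>A. (\<Sum>b\<in>V - A. y a b) + (\<Sum>b\<in>A. y a b)) = 0" by (simp only: sum.neutral_const)
  ultimately show ?thesis unfolding sum.distrib by linarith
qed

text \<open>Let \<open>A\<close> be the side of \<open>u\<close> once the edge is gone. No other
  edge leaves \<open>A\<close>, so the net flow out of \<open>A\<close>, which is 0, is the value on
  the bridge.\<close>

lemma bridge_flow_zero:
  assumes g: "gr V E" and e: "{u, v} \<in> E" and c: "\<not> conn (E - {{u, v}}) u v" and y: "y \<in> cyc E"
  shows "y u v = 0"
proof -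
  define A where "A = {w \<in> V. conn (E - {{u, v}}) u w}"
  have V: "u \<in> V" "v \<in> V" "u \<noteq> v" using grD(6)[OF g e] by blast+
  have fin: "finite A" "finite (V - A)" using grD(1)[OF g] by (auto simp: A_def)
  have z: "y a b = 0" if "a \<in> A" "b \<in> V - A" "(a, b) \<noteq> (u, v)" for a b
  proof (rule cyc_outside[OF y], rule notI)
    assume ab: "{a, b} \<in> E"
    show False
    proof (cases "{a, b} = {u, v}")
      case True
      then have "a = v" using that(3) by (auto simp: doubleton_eq_iff)
      then show False using that(1) c by (simp add: A_def)
    next
      case False
      then have "conn (E - {{u, v}}) a b" using ab by (intro conn_edge) auto
      then show False using that(1,2) conn_trans[of "E - {{u, v}}" u a b] by (simp add: A_def)
    qed
  qed
  have "0 = (\<Sum>p\<in>A \<times> (V - A). y (fst p) (snd p))"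
    using cyc_cut[OF g y, of A] by (simp add: sum.cartesian_product A_def case_prod_beta)
  also have "\<dots> = (\<Sum>p\<in>{(u, v)}. y (fst p) (snd p))"
  proof (rule sum.mono_neutral_right)
    show "finite (A \<times> (V - A))" using fin by simp
    show "{(u, v)} \<subseteq> A \<times> (V - A)" using V c by (simp add: A_def)
    show "\<forall>i\<in>A \<times> (V - A) - {(u, v)}. y (fst i) (snd i) = 0"
    proof
      fix i assume "i \<in> A \<times> (V - A) - {(u, v)}"
      then show "y (fst i) (snd i) = 0" using z[of "fst i" "snd i"] by auto
    qed
  qed
  finally show ?thesis by simp
qed

lemma cyc_delete_eq:
  assumes g: "gr V E" and z: "\<And>y. y \<in> cyc E \<Longrightarrow> y u v = 0"
  shows "cyc (E - {{u, v}}) = cyc E"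
proof -
  have "y \<in> cyc (E - {{u, v}})" if y: "y \<in> cyc E" for y
  proof -
    have "y a b = 0" if "{a, b} \<notin> E - {{u, v}}" for a b
      using that cyc_outside[OF y, of a b] z[OF y] cyc_antisym[OF y, of v u]
      by (auto simp: doubleton_eq_iff)
    then show ?thesis using y cyc_subgraph[OF g, of "E - {{u, v}}"] by blast
  qed
  then show ?thesis using cyc_mono[OF g, of "E - {{u, v}}"] by blast
qed

text \<open>Subtracting a multiple of one flow \<open>y0\<close> that is nonzero on the edge brings
  every flow into the smaller graph, so one extra generator suffices.\<close>

lemma beta_delete_le:
  assumes g: "gr V E"
  shows "beta E \<le> beta (E - {{u, v}}) + 1"
proof (cases "\<exists>y\<in>cyc E. y u v \<noteq> 0")
  case False
  then have "cyc (E - {{u, v}}) = cyc E" using cyc_delete_eq[OF g] by blast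
  then show ?thesis by (simp add: beta_def)
next
  case True
  then obtain y0 where y0: "y0 \<in> cyc E" "y0 u v \<noteq> 0" by blast
  let ?F = "E - {{u, v}}"
  have g': "gr V ?F" using gr_subset[OF g] by blast
  obtain f where f: "\<And>i. i < beta ?F \<Longrightarrow> f i \<in> cyc ?F"
    "\<And>a i. (\<And>u v. (\<Sum>i<beta ?F. a i * f i u v) = 0) \<Longrightarrow> i < beta ?F \<Longrightarrow> a i = 0"
    "\<And>y. y \<in> cyc ?F \<Longrightarrow> \<exists>a. \<forall>u v. y u v = (\<Sum>i<beta ?F. a i * f i u v)"
    using cyc_basis[OF g'] by blast
  have "beta E \<le> card {..<Suc (beta ?F)}"
  proof (rule beta_le[where f = "\<lambda>i. if i < beta ?F then f i else y0"])
    fix y assume y: "y \<in> cyc E"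
    define t where "t = y u v / y0 u v"
    have "(\<lambda>a b. 1 * y a b + (- t) * y0 a b) \<in> cyc E" by (rule cyc_comb[OF y y0(1)])
    moreover have "1 * y a b + (- t) * y0 a b = 0" if "{a, b} \<notin> ?F" for a b
      using that cyc_outside[OF y, of a b] cyc_outside[OF y0(1), of a b] y0(2)
        cyc_antisym[OF y, of v u] cyc_antisym[OF y0(1), of v u]
      by (auto simp: doubleton_eq_iff t_def)
    ultimately have m: "(\<lambda>a b. 1 * y a b + (- t) * y0 a b) \<in> cyc ?F"
      using cyc_subgraph[OF g, of ?F] by blast
    obtain a where a: "\<forall>u v. 1 * y u v + (- t) * y0 u v = (\<Sum>i<beta ?F. a i * f i u v)"
      using f(3)[OF m] by (rule exE)
    show "\<exists>a. \<forall>p q. y p q = (\<Sum>i<Suc (beta ?F). a i * (if i < beta ?F then f i else y0) p q)"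
    proof (intro exI[of _ "\<lambda>i. if i < beta ?F then a i else t"] allI)
      fix p q
      have "(\<Sum>i<beta ?F. (if i < beta ?F then a i else t) * (if i < beta ?F then f i else y0) p q)
          = (\<Sum>i<beta ?F. a i * f i p q)"
        by (intro sum.cong) auto
      then show "y p q = (\<Sum>i<Suc (beta ?F).
          (if i < beta ?F then a i else t) * (if i < beta ?F then f i else y0) p q)"
        using a[rule_format, of p q] by simp
    qed
  qed simp
  then show ?thesis by simp
qed

text \<open>All flows of the smaller graph vanish on the deleted edge and \<open>y0\<close> does
  not, so \<open>y0\<close> is independent of them.\<close>

lemma beta_delete_nonbridge:
  assumes g: "gr V E" and y0: "y0 \<in> cyc E" "y0 u v \<noteq> 0"
  shows "beta (E - {{u, v}}) + 1 \<le> beta E"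
proof -
  let ?F = "E - {{u, v}}"
  have g': "gr V ?F" using gr_subset[OF g] by blast
  obtain f where f: "\<And>i. i < beta ?F \<Longrightarrow> f i \<in> cyc ?F"
    "\<And>a i. (\<And>u v. (\<Sum>i<beta ?F. a i * f i u v) = 0) \<Longrightarrow> i < beta ?F \<Longrightarrow> a i = 0"
    "\<And>y. y \<in> cyc ?F \<Longrightarrow> \<exists>a. \<forall>u v. y u v = (\<Sum>i<beta ?F. a i * f i u v)"
    using cyc_basis[OF g'] by blast
  have "card {..<Suc (beta ?F)} \<le> beta E"
  proof (rule le_beta[OF g, where f = "\<lambda>i. if i < beta ?F then f i else y0"])
    show "(if i < beta ?F then f i else y0) \<in> cyc E" for i
      using f(1) y0(1) cyc_mono[OF g, of ?F] by auto
    fix a i assume s: "\<And>p q. (\<Sum>i<Suc (beta ?F). a i * (if i < beta ?F then f i else y0) p q) = 0"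
      and i: "i \<in> {..<Suc (beta ?F)}"
    have s': "(\<Sum>i<beta ?F. a i * f i p q) + a (beta ?F) * y0 p q = 0" for p q
    proof -
      have "(\<Sum>i<beta ?F. a i * (if i < beta ?F then f i else y0) p q) = (\<Sum>i<beta ?F. a i * f i p q)"
        by (intro sum.cong) auto
      then show ?thesis using s[of p q] by simp
    qed
    have "(\<Sum>i<beta ?F. a i * f i u v) = 0"
      using cyc_outside[OF f(1), of _ u v] by (intro sum.neutral) auto
    then have "a (beta ?F) = 0" using s'[of u v] y0(2) by simp
    then show "a i = 0" using s' f(2)[of a] i by (cases "i = beta ?F") auto
  qed simp
  then show ?thesis by simp
qed

text \<open>Deleting a nonbridge lowers the edge count by one and \<open>beta\<close> by at least
  one. At a bridge, \<open>V\<close> is split into the side \<open>A\<close> and the rest: of the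
  two \<open>+ 1\<close> of the parts, one pays for the bridge and the other is the
  \<open>+ 1\<close> of the whole.\<close>

lemma card_edges_le:
  assumes "gr V E" "V \<noteq> {}"
  shows "card E + 1 \<le> beta E + card V"
  using assms
proof (induction "card E" arbitrary: V E rule: less_induct)
  case less
  note g = less.prems(1)
  have fin: "finite V" "finite E" using grD[OF g] by blast+
  show ?case
  proof (cases "E = {}")
    case True
    then show ?thesis using less.prems fin by (simp add: Suc_leI card_gt_0_iff)
  next
    case False
    then obtain e where e: "e \<in> E" by blast
    obtain u v where uv: "e = {u, v}" "u \<noteq> v" "u \<in> V" "v \<in> V" using gr_edge[OF g e] .
    have c1: "card E = Suc (card (E - {e}))" using e fin by (metis card_Suc_Diff1)
    show ?thesis
    proof (cases "conn (E - {e}) u v")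
      case True
      have "gr V (E - {e})" using gr_subset[OF g] by blast
      then have "card (E - {e}) + 1 \<le> beta (E - {e}) + card V"
        using less.hyps[of "E - {e}" V] c1 less.prems(2) by simp
      moreover obtain y where "y \<in> cyc E" "y u v = 1" using nonbridge_flow[OF g] e uv True by metis
      then have "beta (E - {e}) + 1 \<le> beta E" using beta_delete_nonbridge[OF g, of y u v] uv by simp
      ultimately show ?thesis using c1 by simp
    next
      case False
      define A where "A = {w \<in> V. conn (E - {e}) u w}"
      define EA where "EA = {f \<in> E - {e}. f \<subseteq> A}"
      define EB where "EB = {f \<in> E - {e}. f \<subseteq> V - A}"
      have AV: "A \<subseteq> V" "u \<in> A" "v \<in> V - A" using False uv by (auto simp: A_def)
      have un: "E - {e} = EA \<union> EB"
      proof -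
        have "f \<in> EA \<union> EB" if f: "f \<in> E - {e}" for f
        proof -
          obtain a b where ab: "f = {a, b}" "a \<in> V" "b \<in> V" using gr_edge[OF g] f by (metis DiffD1)
          have "conn (E - {e}) a b" using f ab(1) by (intro conn_edge) simp
          then have "conn (E - {e}) u a \<longleftrightarrow> conn (E - {e}) u b"
            using conn_trans conn_sym by metis
          then have "a \<in> A \<longleftrightarrow> b \<in> A" using ab by (simp add: A_def)
          then show ?thesis using f ab by (auto simp: EA_def EB_def)
        qed
        then show ?thesis by (auto simp: EA_def EB_def)
      qed
      have dj: "EA \<inter> EB = {}"
      proof -
        have False if f: "f \<in> EA" "f \<in> EB" for f
        proof -
          have "f = {}" using f unfolding EA_def EB_def by blast
          moreover have "card f = 2" using f grD(5)[OF g] unfolding EA_def by blast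
          ultimately show False by simp
        qed
        then show ?thesis by blast
      qed
      have gA: "gr A EA" and gB: "gr (V - A) EB"
        using g AV by (auto simp: EA_def EB_def intro: gr_restrict)
      have cc: "card (E - {e}) = card EA + card EB"
        using card_Un_disjoint[of EA EB] dj fin un by (metis finite_Diff finite_Un)
      have "card EA + 1 \<le> beta EA + card A" "card EB + 1 \<le> beta EB + card (V - A)"
        using less.hyps[OF _ gA] less.hyps[OF _ gB] c1 cc AV by auto
      moreover have "beta EA + beta EB \<le> beta E"
        using dj by (intro beta_superadditive[OF g]) (auto simp: EA_def EB_def)
      moreover have "card V = card A + card (V - A)"
        using AV fin by (metis card_Diff_subset card_mono finite_subset le_add_diff_inverse)
      ultimately show ?thesis using c1 cc by linarith
    qed
  qed
qed

lemma sum_deg: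
  assumes "gr V E"
  shows "(\<Sum>v\<in>V. deg E v) = 2 * card E"
proof -
  have "(\<Sum>v\<in>V. deg E v) = (\<Sum>v\<in>V. \<Sum>e\<in>E. if v \<in> e then 1 else 0)"
    using grD(2)[OF assms] by (simp add: deg_def sum.If_cases Int_def)
  also have "\<dots> = (\<Sum>e\<in>E. \<Sum>v\<in>V. if v \<in> e then 1 else 0)" by (rule sum.swap)
  also have "\<dots> = (\<Sum>e\<in>E. 2)"
  proof (intro sum.cong refl)
    fix e assume e: "e \<in> E"
    have "V \<inter> {v. v \<in> e} = e" using grD(4)[OF assms e] by auto
    then show "(\<Sum>v\<in>V. if v \<in> e then 1 else 0) = (2::nat)"
      using grD(1)[OF assms] grD(5)[OF assms e] by (simp add: sum.If_cases)
  qed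
  finally show ?thesis by simp
qed

lemma forest_low_degree:
  assumes "gr V E" "beta E = 0" "V \<noteq> {}"
  shows "\<exists>v\<in>V. deg E v \<le> 1"
proof (rule ccontr)
  assume "\<not> ?thesis"
  then have "(\<Sum>v\<in>V. 2) \<le> (\<Sum>v\<in>V. deg E v)" by (intro sum_mono) force
  then have "card V \<le> card E" using sum_deg[OF assms(1)] by simp
  then show False using card_edges_le[OF assms(1,3)] assms(2) by simp
qed

section \<open>A skew form on the cycle space of a subcubic graph\<close>

lemma nonsing_transpose:
  assumes "nonsing d (\<lambda>i j. A j i)"
  shows "nonsing d A"
proof -
  have "mat d d (\<lambda>(i, j). A j i) = transpose_mat (mat d d (\<lambda>(i, j). A i j))"
    by (rule eq_matI) auto
  then show ?thesis
    using assms det_transpose[of "mat d d (\<lambda>(i, j). A i j)" d] unfolding nonsing_iff_det by simp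
qed

text \<open>
  In a subcubic graph \<open>n1 v\<close> and \<open>n2 v\<close> are two of the at most three neighbours of \<open>v\<close> (or arbitrary,
  if there are fewer); a flow is determined at \<open>v\<close> by its values towards them.
\<close>

definition slots :: "'a set set \<Rightarrow> ('a \<Rightarrow> 'a) \<Rightarrow> ('a \<Rightarrow> 'a) \<Rightarrow> bool" where
  "slots E n1 n2 \<longleftrightarrow> (\<forall>v. \<exists>n3. \<forall>u. {v, u} \<in> E \<longrightarrow> u = n1 v \<or> u = n2 v \<or> u = n3)"

text \<open>At most one neighbour of \<open>v\<close> lies outside the two slots, so conservation at
  \<open>v\<close> reduces to a single term, which must vanish.\<close>

lemma slots_vanish:
  assumes g: "gr V E" and s: "slots E n1 n2" and y: "y \<in> cyc E" "y v (n1 v) = 0" "y v (n2 v) = 0"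
  shows "y v u = 0"
proof (rule ccontr)
  assume nz: "y v u \<noteq> 0"
  obtain n3 where n3: "\<And>u. {v, u} \<in> E \<Longrightarrow> u = n1 v \<or> u = n2 v \<or> u = n3"
    using s unfolding slots_def by blast
  have "{v, u} \<in> E" using nz cyc_outside[OF y(1)] by blast
  then have u: "u \<in> V" using grD(6)[OF g] by blast
  have "u = n3" using n3[OF \<open>{v, u} \<in> E\<close>] nz y(2,3) by metis
  have z: "y v w = 0" if "w \<noteq> u" for w
    using n3[of w] y(2,3) cyc_outside[OF y(1), of v w] that \<open>u = n3\<close> by metis
  have "(\<Sum>w\<in>V. y v w) = (\<Sum>w\<in>{u}. y v w)"
    using u grD(1)[OF g] z by (intro sum.mono_neutral_right) auto
  then show False using cyc_sum[OF g y(1), of v] nz by simp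
qed

lemma deg_eq_card_nbrs: "deg E v = card {u. {v, u} \<in> E \<and> u \<noteq> v}" if c2: "\<And>e. e \<in> E \<Longrightarrow> card e = 2"
proof -
  have "bij_betw (\<lambda>u. {v, u}) {u. {v, u} \<in> E \<and> u \<noteq> v} {e \<in> E. v \<in> e}"
  proof (rule bij_betw_imageI)
    show "inj_on (\<lambda>u. {v, u}) {u. {v, u} \<in> E \<and> u \<noteq> v}" by (auto simp: inj_on_def doubleton_eq_iff)
    show "(\<lambda>u. {v, u}) ` {u. {v, u} \<in> E \<and> u \<noteq> v} = {e \<in> E. v \<in> e}"
    proof (intro equalityI subsetI)
      fix e assume e: "e \<in> {e \<in> E. v \<in> e}"
      then obtain a b where "e = {a, b}" "a \<noteq> b" using c2[of e] unfolding card_2_iff by blast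
      then obtain u where "e = {v, u}" "u \<noteq> v" using e by auto
      then show "e \<in> (\<lambda>u. {v, u}) ` {u. {v, u} \<in> E \<and> u \<noteq> v}" using e by blast
    qed auto
  qed
  then show ?thesis unfolding deg_def by (rule bij_betw_same_card[symmetric])
qed

lemma slots_exist:
  assumes g: "gr V E" and d: "\<And>v. v \<in> V \<Longrightarrow> deg E v \<le> 3"
  shows "\<exists>n1 n2. slots E n1 n2"
proof -
  have "\<exists>a b c. \<forall>u. {v, u} \<in> E \<longrightarrow> u = a \<or> u = b \<or> u = c" for v
  proof (cases "v \<in> V")
    case False
    then show ?thesis using grD(6)[OF g] by blast
  next
    case True
    let ?N = "{u. {v, u} \<in> E \<and> u \<noteq> v}"
    have "?N \<subseteq> V" using grD(6)[OF g] by blast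
    then have fin: "finite ?N" using grD(1)[OF g] finite_subset by blast
    have "card ?N \<le> 3" using d[OF True] deg_eq_card_nbrs[OF grD(5)[OF g]] by simp
    moreover obtain l where l: "set l = ?N" "distinct l" using finite_distinct_list[OF fin] by blast
    ultimately have "length l \<le> 3" using distinct_card[OF l(2)] by simp
    then have "\<exists>a b c. set l \<subseteq> {a, b, c}"
    proof -
      have "set l \<subseteq> {l ! 0, l ! 1, l ! 2}"
      proof
        fix u assume "u \<in> set l"
        then obtain i where "i < length l" "u = l ! i" by (metis in_set_conv_nth)
        moreover from this \<open>length l \<le> 3\<close> have "i = 0 \<or> i = 1 \<or> i = 2" by linarith
        ultimately show "u \<in> {l ! 0, l ! 1, l ! 2}" by blast
      qed
      then show ?thesis by blast
    qed
    then show ?thesis using l(1) grD(6)[OF g] by blast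
  qed
  then show ?thesis unfolding slots_def by metis
qed

text \<open>At a vertex with three neighbours, conservation makes the third value minus the sum of
  the other two, so another choice of slots changes this determinant only in sign.\<close>

definition om :: "('a \<Rightarrow> 'a) \<Rightarrow> ('a \<Rightarrow> 'a) \<Rightarrow> 'a \<Rightarrow> ('a \<Rightarrow> 'a \<Rightarrow> real) \<Rightarrow> ('a \<Rightarrow> 'a \<Rightarrow> real) \<Rightarrow> real" where
  "om n1 n2 v y z = y v (n1 v) * z v (n2 v) - y v (n2 v) * z v (n1 v)"

text \<open>The condition is made hereditary because the inductions pass to subgraphs on fewer
  vertices. The guard \<open>1 \<le> beta E'\<close> excludes forests, which violate the inequality
  on few vertices; the 5-cycle attains equality.\<close>

definition sparse5 :: "'a set \<Rightarrow> 'a set set \<Rightarrow> bool" where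
  "sparse5 V E \<longleftrightarrow> gr V E \<and> (\<forall>V' E'. V' \<subseteq> V \<longrightarrow> E' \<subseteq> E \<longrightarrow> \<Union>E' \<subseteq> V' \<longrightarrow> 1 \<le> beta E' \<longrightarrow>
     3 * beta E' + 7 \<le> 2 * card V')"

lemma sparse5_mono:
  assumes "sparse5 V E" "V' \<subseteq> V" "E' \<subseteq> E" "\<Union>E' \<subseteq> V'"
  shows "sparse5 V' E'"
proof -
  have "gr V' E'" using assms unfolding sparse5_def by (intro gr_restrict[of V E V' E']) auto
  moreover have "3 * beta F + 7 \<le> 2 * card U"
    if "U \<subseteq> V'" "F \<subseteq> E'" "\<Union>F \<subseteq> U" "1 \<le> beta F" for U F
    using assms(1) that subset_trans[OF that(1) assms(2)] subset_trans[OF that(2) assms(3)]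
    unfolding sparse5_def by blast
  ultimately show ?thesis unfolding sparse5_def by blast
qed

text \<open>Slots are fixed once for the initial graph. Flows of a subgraph vanish on the missing
  edges, so the same forms serve every subgraph met in the induction.\<close>

locale slot_form =
  fixes V0 :: "'a set" and E0 :: "'a set set" and n1 n2 :: "'a \<Rightarrow> 'a"
  assumes g0: "gr V0 E0" and slots0: "slots E0 n1 n2"
begin

section \<open>Weighted sums of the vertex forms and their rank\<close>

definition B :: "('a \<Rightarrow> real) \<Rightarrow> ('a \<Rightarrow> 'a \<Rightarrow> real) \<Rightarrow> ('a \<Rightarrow> 'a \<Rightarrow> real) \<Rightarrow> real" where
  "B x y z = (\<Sum>v\<in>V0. x v * om n1 n2 v y z)"

lemma B_skew: "B x y z = - B x z y"
  unfolding B_def sum_negf[symmetric] by (intro sum.cong refl) (simp add: om_def algebra_simps)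

lemma B_self: "B x y y = 0"
  using B_skew[of x y y] by simp

lemma B_comb: "B x y (\<lambda>u v. a * f u v + b * g u v) = a * B x y f + b * B x y g"
  unfolding B_def sum_distrib_left sum.distrib[symmetric]
  by (intro sum.cong refl) (simp add: om_def algebra_simps)

lemma B_comb_left: "B x (\<lambda>u v. a * f u v + b * g u v) y = a * B x f y + b * B x g y"
proof -
  have "B x (\<lambda>u v. a * f u v + b * g u v) y = - (a * B x y f + b * B x y g)"
    by (subst B_skew) (simp only: B_comb)
  then show ?thesis using B_skew[of x f y] B_skew[of x g y] by (simp add: algebra_simps)
qed

lemma B_zero: "B x y (\<lambda>u v. 0) = 0"
  by (simp add: B_def om_def)

lemma B_lin:
  assumes "finite I"
  shows "B x y (\<lambda>u v. \<Sum>i\<in>I. a i * f i u v) = (\<Sum>i\<in>I. a i * B x y (f i))"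
  using assms
proof (induction I)
  case empty
  then show ?case by (simp add: B_zero)
next
  case (insert j I)
  have "B x y (\<lambda>u v. \<Sum>i\<in>insert j I. a i * f i u v)
      = B x y (\<lambda>u v. a j * f j u v + 1 * (\<Sum>i\<in>I. a i * f i u v))"
    using insert.hyps by simp
  also have "\<dots> = a j * B x y (f j) + 1 * B x y (\<lambda>u v. \<Sum>i\<in>I. a i * f i u v)"
    by (rule B_comb)
  finally show ?case using insert by simp
qed

lemma B_lin_left:
  assumes "finite I"
  shows "B x (\<lambda>u v. \<Sum>i\<in>I. a i * f i u v) y = (\<Sum>i\<in>I. a i * B x (f i) y)"
proof -
  have "B x (\<lambda>u v. \<Sum>i\<in>I. a i * f i u v) y = - (\<Sum>i\<in>I. a i * B x y (f i))"
    by (subst B_skew) (simp only: B_lin[OF assms])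
  also have "\<dots> = (\<Sum>i\<in>I. a i * - B x y (f i))" by (simp add: sum_negf)
  also have "\<dots> = (\<Sum>i\<in>I. a i * B x (f i) y)"
    by (intro sum.cong refl arg_cong2[where f = "(*)"]) (simp only: B_skew[symmetric])
  finally show ?thesis .
qed

lemma B_param: "B (\<lambda>v. x v + t * x' v) y z = B x y z + t * B x' y z"
  unfolding B_def sum_distrib_left sum.distrib[symmetric]
  by (intro sum.cong refl) (simp add: algebra_simps)

text \<open>\<open>rho E\<close> is the largest rank of a form \<open>B x\<close> on the cycle space of \<open>E\<close>.\<close>

definition good :: "'a set set \<Rightarrow> nat \<Rightarrow> bool" where
  "good E d \<longleftrightarrow> (\<exists>x us. (\<forall>i<d. us i \<in> cyc E) \<and> nonsing d (\<lambda>i j. B x (us i) (us j)))"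

definition rho :: "'a set set \<Rightarrow> nat" where
  "rho E = (GREATEST d. good E d)"

text \<open>Pairing the combination with each \<open>us j\<close> applies the Gram matrix to its
  coefficients. Only orthogonality to the \<open>us j\<close> is asked of the combination, so this
  yields independence modulo flows that the form annihilates.\<close>

lemma nonsing_independent:
  assumes "nonsing d (\<lambda>i j. B x (us i) (us j))" "\<And>j. j < d \<Longrightarrow> B x (us j) (\<lambda>u v. \<Sum>i<d. a i * us i u v) = 0"
    and "i < d"
  shows "a i = 0"
proof -
  have "(\<Sum>i<d. B x (us j) (us i) * a i) = 0" if "j < d" for j
    using assms(2)[OF that] by (simp add: B_lin mult.commute)
  then show ?thesis using assms(1,3) unfolding nonsing_def by blast
qed

lemma good_le_beta:
  assumes g: "gr V E" and "good E d"
  shows "d \<le> beta E"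
proof -
  obtain x us where us: "\<forall>i<d. us i \<in> cyc E" "nonsing d (\<lambda>i j. B x (us i) (us j))"
    using assms(2) unfolding good_def by (elim exE conjE) (rule that)
  have "card {..<d} \<le> beta E"
  proof (rule le_beta[OF g, where f = us])
    fix a i assume a: "\<And>u v. (\<Sum>i<d. a i * us i u v) = 0" and i: "i \<in> {..<d}"
    have "(\<lambda>u v. \<Sum>i<d. a i * us i u v) = (\<lambda>u v. 0)" by (intro ext) (rule a)
    then show "a i = 0" using nonsing_independent[OF us(2), of a i] i B_zero by simp
  qed (use us in auto)
  then show ?thesis by simp
qed

lemma good_0: "good E 0"
  unfolding good_def nonsing_def by simp

lemma good_rho: "gr V E \<Longrightarrow> good E (rho E)"
  unfolding rho_def using good_0 good_le_beta by (intro GreatestI_nat[of "good E" 0 "beta E"]) auto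

lemma good_le_rho: "gr V E \<Longrightarrow> good E d \<Longrightarrow> d \<le> rho E"
  unfolding rho_def using good_le_beta by (intro Greatest_le_nat[of "good E" d "beta E"]) auto

lemma good_mono: "gr V E \<Longrightarrow> E' \<subseteq> E \<Longrightarrow> good E' d \<Longrightarrow> good E d"
  unfolding good_def using cyc_mono by blast

lemma rho_mono: "gr V E \<Longrightarrow> E' \<subseteq> E \<Longrightarrow> rho E' \<le> rho E"
  using good_le_rho good_mono good_rho gr_subset by metis

text \<open>The support of the weights is shrunk to a set \<open>N\<close> with
  \<open>2 * card N = d\<close>. Flows avoiding \<open>N\<close> are then orthogonal to everything,
  while the \<open>us i\<close> keep a nonsingular Gram matrix; hence the two families are jointly
  independent.\<close>

lemma good_killing_set:
  assumes g: "gr V E" and "good E d"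
  obtains N where "N \<subseteq> V0" "2 * card N = d" "beta {e \<in> E. e \<inter> N = {}} + d \<le> beta E"
proof -
  obtain x us where us: "\<forall>i<d. us i \<in> cyc E" "nonsing d (\<lambda>i j. B x (us i) (us j))"
    using assms(2) unfolding good_def by (elim exE conjE) (rule that)
  define b where "b v i = us i v (n1 v)" for v i
  define c where "c v i = us i v (n2 v)" for v i
  have Bx: "B x (us i) (us j) = (\<Sum>v\<in>V0. x v * (b v i * c v j - c v i * b v j))" for x i j
    by (simp add: B_def om_def b_def c_def)
  obtain x' N where N: "N \<subseteq> V0" "2 * card N = d" and x'0: "\<And>v. v \<notin> N \<Longrightarrow> x' v = 0"
    and ns: "nonsing d (\<lambda>i j. \<Sum>v\<in>V0. x' v * (b v i * c v j - c v i * b v j))"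
    using skew_sum_minimal_support[OF grD(1)[OF g0] us(2)[unfolded Bx]] by blast
  have ns': "nonsing d (\<lambda>i j. B x' (us i) (us j))" unfolding Bx by (rule ns)
  define F where "F = {e \<in> E. e \<inter> N = {}}"
  have F: "F \<subseteq> E" "gr V F" using gr_subset[OF g] by (auto simp: F_def)
  obtain f where f: "\<And>i. i < beta F \<Longrightarrow> f i \<in> cyc F"
    "\<And>a i. (\<And>u v. (\<Sum>i<beta F. a i * f i u v) = 0) \<Longrightarrow> i < beta F \<Longrightarrow> a i = 0"
    using cyc_basis[OF F(2)] by blast
  have fN: "f i v u = 0" if "i < beta F" "v \<in> N" for i v u
    using that cyc_outside[OF f(1)] by (simp add: F_def)
  have Bf: "B x' y (f i) = 0" if "i < beta F" for y i
    unfolding B_def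
  proof (intro sum.neutral ballI)
    fix v
    show "x' v * om n1 n2 v y (f i) = 0"
      using x'0[of v] fN[OF that, of v] by (cases "v \<in> N") (simp_all add: om_def)
  qed
  have "card ({..<d} <+> {..<beta F}) \<le> beta E"
  proof (rule le_beta[OF g, where f = "case_sum us f"])
    show "case_sum us f i \<in> cyc E" if "i \<in> {..<d} <+> {..<beta F}" for i
      using that us(1) f(1) cyc_mono[OF g F(1)] by auto
  next
    fix a i assume s: "\<And>u v. (\<Sum>i\<in>{..<d} <+> {..<beta F}. a i * case_sum us f i u v) = 0"
      and i: "i \<in> {..<d} <+> {..<beta F}"
    have s': "(\<Sum>i<d. a (Inl i) * us i u v) + (\<Sum>i<beta F. a (Inr i) * f i u v) = 0" for u v
      using s[of u v] by (simp add: sum.Plus)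
    have e: "(\<lambda>u v. \<Sum>i<d. a (Inl i) * us i u v) = (\<lambda>u v. \<Sum>i<beta F. (- a (Inr i)) * f i u v)"
    proof (intro ext)
      fix u v
      show "(\<Sum>i<d. a (Inl i) * us i u v) = (\<Sum>i<beta F. (- a (Inr i)) * f i u v)"
        using s'[of u v] by (simp add: sum_negf)
    qed
    have "B x' (us j) (\<lambda>u v. \<Sum>i<d. a (Inl i) * us i u v) = 0" for j
      unfolding e by (subst B_lin) (auto intro!: sum.neutral simp: Bf)
    then have a1: "a (Inl i) = 0" if "i < d" for i
      using nonsing_independent[OF ns', of "\<lambda>i. a (Inl i)" i] that by blast
    have "(\<Sum>i<beta F. a (Inr i) * f i u v) = 0" for u v
    proof -
      have "(\<Sum>i<d. a (Inl i) * us i u v) = 0" using a1 by (intro sum.neutral) auto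
      then show ?thesis using s'[of u v] by simp
    qed
    then have "a (Inr i) = 0" if "i < beta F" for i
      using f(2)[of "\<lambda>i. a (Inr i)" i] that by blast
    then show "a i = 0" using a1 i by auto
  qed simp
  then have "beta F + d \<le> beta E" by (simp add: card_Plus)
  then show thesis using that N unfolding F_def by blast
qed

text \<open>The rank is twice the size of a vertex set. Consequently a rank that drops at all drops
  by at least 2, which \<open>subcubic_bound\<close> exploits when it deletes an edge.\<close>

lemma even_rho: "gr V E \<Longrightarrow> even (rho E)"
  using good_killing_set[OF _ good_rho] by (metis dvd_triv_left)

text \<open>The enlarged Gram matrix is block diagonal, and its new block has zero diagonal and
  off-diagonal entries \<open>B x y z\<close> and \<open>- B x y z\<close>.\<close>

lemma good_extend:
  assumes us: "\<And>i. i < d \<Longrightarrow> us i \<in> cyc E" and y: "y \<in> cyc E" and z: "z \<in> cyc E"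
    and ns: "nonsing d (\<lambda>i j. B x (us i) (us j))"
    and o: "\<And>i. i < d \<Longrightarrow> B x (us i) y = 0" "\<And>i. i < d \<Longrightarrow> B x (us i) z = 0"
    and nz: "B x y z \<noteq> 0"
  shows "good E (d + 2)"
proof -
  define ws where "ws i = (if i < d then us i else if i = d then y else z)" for i
  have ws: "\<And>i. i < d \<Longrightarrow> ws i = us i" "ws d = y" "ws (Suc d) = z" by (auto simp: ws_def)
  have "nonsing (Suc (Suc d)) (\<lambda>i j. B x (ws i) (ws j))"
    unfolding nonsing_def
  proof (intro allI impI)
    fix c j assume c: "\<forall>i<Suc (Suc d). (\<Sum>j<Suc (Suc d). B x (ws i) (ws j) * c j) = 0"
      and j: "j < Suc (Suc d)"
    have row: "(\<Sum>j<d. B x (ws i) (us j) * c j) + B x (ws i) y * c d + B x (ws i) z * c (Suc d) = 0"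
      if "i < Suc (Suc d)" for i
      using c that ws by simp
    have "(\<Sum>j<d. B x (us i) (us j) * c j) = 0" if "i < d" for i
      using row[of i] that o ws by simp
    then have c0: "c j = 0" if "j < d" for j using ns that unfolding nonsing_def by blast
    have row': "B x (ws i) y * c d + B x (ws i) z * c (Suc d) = 0" if "i < Suc (Suc d)" for i
      using row[OF that] c0 by simp
    have "c (Suc d) = 0" using row'[of d] nz by (simp add: ws B_self)
    moreover have "c d = 0" using row'[of "Suc d"] nz B_skew[of x z y] by (simp add: ws B_self)
    ultimately show "c j = 0" using c0 j less_Suc_eq by metis
  qed
  moreover have "ws i \<in> cyc E" for i using us y z by (simp add: ws_def)
  ultimately show ?thesis unfolding good_def by (intro exI[of _ x] exI[of _ ws]) simp
qed

text \<open>The weights are glued along \<open>A\<close>. At every vertex one of the two families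
  vanishes, so the joint Gram matrix is block diagonal.\<close>

lemma good_union:
  assumes g: "gr V E" and sub: "EA \<subseteq> E" "EB \<subseteq> E" and dis: "\<Union>EA \<subseteq> A" "\<Union>EB \<inter> A = {}"
    and ga: "good EA d1" and gb: "good EB d2"
  shows "good E (d1 + d2)"
proof -
  obtain x1 u1 where u1: "\<forall>i<d1. u1 i \<in> cyc EA" "nonsing d1 (\<lambda>i j. B x1 (u1 i) (u1 j))"
    using ga unfolding good_def by (elim exE conjE) (rule that)
  obtain x2 u2 where u2: "\<forall>i<d2. u2 i \<in> cyc EB" "nonsing d2 (\<lambda>i j. B x2 (u2 i) (u2 j))"
    using gb unfolding good_def by (elim exE conjE) (rule that)
  define x where "x v = (if v \<in> A then x1 v else x2 v)" for v
  define us where "us i = (if i < d1 then u1 i else u2 (i - d1))" for i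
  have za: "u1 i v w = 0" if "i < d1" "v \<notin> A" for i v w
    using that u1(1) cyc_outside[of "u1 i" EA v w] dis(1) by blast
  have zb: "u2 i v w = 0" if "i < d2" "v \<in> A" for i v w
    using that u2(1) cyc_outside[of "u2 i" EB v w] dis(2) by blast
  have B1: "B x (u1 i) (u1 j) = B x1 (u1 i) (u1 j)" if "i < d1" "j < d1" for i j
    unfolding B_def
  proof (intro sum.cong refl)
    fix v
    show "x v * om n1 n2 v (u1 i) (u1 j) = x1 v * om n1 n2 v (u1 i) (u1 j)"
      using za[OF that(1), of v] by (cases "v \<in> A") (simp_all add: x_def om_def)
  qed
  have B2: "B x (u2 i) (u2 j) = B x2 (u2 i) (u2 j)" if "i < d2" "j < d2" for i j
    unfolding B_def
  proof (intro sum.cong refl)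
    fix v
    show "x v * om n1 n2 v (u2 i) (u2 j) = x2 v * om n1 n2 v (u2 i) (u2 j)"
      using zb[OF that(1), of v] by (cases "v \<in> A") (simp_all add: x_def om_def)
  qed
  have B12: "B x (u1 i) (u2 j) = 0" if "i < d1" "j < d2" for i j
    unfolding B_def
  proof (intro sum.neutral ballI)
    fix v
    show "x v * om n1 n2 v (u1 i) (u2 j) = 0"
      using za[OF that(1), of v] zb[OF that(2), of v] by (cases "v \<in> A") (simp_all add: om_def)
  qed
  have "nonsing (d1 + d2) (\<lambda>i j. B x (us i) (us j))"
    unfolding nonsing_def
  proof (intro allI impI)
    fix c j assume c: "\<forall>i<d1 + d2. (\<Sum>j<d1 + d2. B x (us i) (us j) * c j) = 0" and j: "j < d1 + d2"
    have split: "(\<Sum>j<d1 + d2. g j) = (\<Sum>j<d1. g j) + (\<Sum>j<d2. g (d1 + j))" for g :: "nat \<Rightarrow> real"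
      by (induction d2) simp_all
    have s: "(\<Sum>j<d1. B x (us i) (u1 j) * c j) + (\<Sum>j<d2. B x (us i) (u2 j) * c (d1 + j)) = 0"
      if "i < d1 + d2" for i
    proof -
      have "(\<Sum>j<d1. B x (us i) (us j) * c j) = (\<Sum>j<d1. B x (us i) (u1 j) * c j)"
        by (intro sum.cong) (auto simp: us_def)
      moreover have "(\<Sum>j<d2. B x (us i) (us (d1 + j)) * c (d1 + j)) = (\<Sum>j<d2. B x (us i) (u2 j) * c (d1 + j))"
        by (intro sum.cong) (auto simp: us_def)
      ultimately show ?thesis using c that split[of "\<lambda>j. B x (us i) (us j) * c j"] by simp
    qed
    have "(\<Sum>j<d1. B x1 (u1 i) (u1 j) * c j) = 0" if i: "i < d1" for i
    proof -
      have "(\<Sum>j<d2. B x (us i) (u2 j) * c (d1 + j)) = 0"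
        using i B12 by (intro sum.neutral) (auto simp: us_def)
      moreover have "(\<Sum>j<d1. B x (us i) (u1 j) * c j) = (\<Sum>j<d1. B x1 (u1 i) (u1 j) * c j)"
        using i B1 by (intro sum.cong) (auto simp: us_def)
      ultimately show ?thesis using s[of i] i by simp
    qed
    then have c1: "c j = 0" if "j < d1" for j using u1(2) that unfolding nonsing_def by blast
    have "(\<Sum>j<d2. B x2 (u2 i) (u2 j) * c (d1 + j)) = 0" if i: "i < d2" for i
    proof -
      have "(\<Sum>j<d1. B x (us (d1 + i)) (u1 j) * c j) = 0"
        using c1 by (intro sum.neutral) auto
      moreover have "(\<Sum>j<d2. B x (us (d1 + i)) (u2 j) * c (d1 + j)) = (\<Sum>j<d2. B x2 (u2 i) (u2 j) * c (d1 + j))"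
        using i B2 by (intro sum.cong) (auto simp: us_def)
      ultimately show ?thesis using s[of "d1 + i"] i by simp
    qed
    then have "c (d1 + j) = 0" if "j < d2" for j
      using u2(2) that unfolding nonsing_def by (elim allE[of _ "\<lambda>j. c (d1 + j)"]) blast
    then show "c j = 0" using c1 j by (cases "j < d1") (auto dest!: meta_spec[of _ "j - d1"])
  qed
  moreover have "us i \<in> cyc E" if "i < d1 + d2" for i
    using that u1(1) u2(1) cyc_mono[OF g sub(1)] cyc_mono[OF g sub(2)] by (auto simp: us_def)
  ultimately show ?thesis unfolding good_def by (intro exI[of _ x] exI[of _ us]) simp
qed

text \<open>The induction moves along the line \<open>x + t * xs e\<close>. For the old indices the
  pencil is nonsingular at \<open>t = 0\<close>; for the new one the coefficient of \<open>t\<close>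
  is nonsingular. Either way only finitely many \<open>t\<close> are bad.\<close>

lemma generic_parameter:
  assumes "finite I" "\<And>e. e \<in> I \<Longrightarrow> nonsing d (\<lambda>i j. B (xs e) (us e i) (us e j))"
  shows "\<exists>x. \<forall>e\<in>I. nonsing d (\<lambda>i j. B x (us e i) (us e j))"
  using assms
proof (induction I)
  case (insert e I)
  then obtain x where x: "\<And>e. e \<in> I \<Longrightarrow> nonsing d (\<lambda>i j. B x (us e i) (us e j))" by auto
  define bad where "bad f = {t. \<not> nonsing d (\<lambda>i j. B x (us f i) (us f j) + t * B (xs e) (us f i) (us f j))}" for f
  have "finite (bad f)" if "f \<in> insert e I" for f
  proof (cases "f \<in> I")
    case True
    then show ?thesis unfolding bad_def by (intro finite_singular_pencil x)
  next
    case False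
    then have "f = e" using that by simp
    then show ?thesis unfolding bad_def using insert.prems by (intro finite_singular_pencil') simp
  qed
  then have "finite (\<Union>f\<in>insert e I. bad f)" using insert.hyps by blast
  then obtain t where t: "t \<notin> (\<Union>f\<in>insert e I. bad f)" using ex_new_if_finite[OF infinite_UNIV_char_0] by blast
  have "nonsing d (\<lambda>i j. B (\<lambda>v. x v + t * xs e v) (us f i) (us f j))" if "f \<in> insert e I" for f
    using t that unfolding B_param bad_def by blast
  then show ?case by blast
qed simp

text \<open>
  Choose one \<open>x\<close> attaining rank \<open>d\<close> on all the cycle spaces of \<open>E - {e}\<close>. Then no edge vanishes
  identically on the radical \<open>R\<close>. If \<open>om w y z\<close> were nonzero for some \<open>y, z\<close> in \<open>R\<close>, then increasing \<open>x w\<close>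
  would increase the rank. So edges at a common vertex are proportional on \<open>R\<close>, and a flow in \<open>R\<close>
  that vanishes on one edge vanishes everywhere.
\<close>

lemma radical_dimension:
  assumes g: "gr V E" and VV: "V \<subseteq> V0" and EE: "E \<subseteq> E0"
    and nosplit: "\<And>A. A \<subseteq> V \<Longrightarrow> A \<noteq> {} \<Longrightarrow> (\<And>e. e \<in> E \<Longrightarrow> e \<subseteq> A \<or> e \<subseteq> V - A) \<Longrightarrow> A = V"
    and nobridge: "\<And>u v. {u, v} \<in> E \<Longrightarrow> \<exists>y\<in>cyc E. y u v \<noteq> 0"
    and crit: "\<And>e. e \<in> E \<Longrightarrow> good (E - {e}) d"
    and top: "\<not> good E (d + 2)" and E: "E \<noteq> {}"
  shows "beta E \<le> d + 1"
proof -
  have sl: "slots E n1 n2" using slots0 EE unfolding slots_def by blast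
  have "\<forall>e\<in>E. \<exists>xu. (\<forall>i<d. snd xu i \<in> cyc (E - {e})) \<and> nonsing d (\<lambda>i j. B (fst xu) (snd xu i) (snd xu j))"
    using crit unfolding good_def by simp
  then obtain xu where xu: "\<forall>e\<in>E. (\<forall>i<d. snd (xu e) i \<in> cyc (E - {e}))
      \<and> nonsing d (\<lambda>i j. B (fst (xu e)) (snd (xu e) i) (snd (xu e) j))"
    unfolding bchoice_iff by (rule exE)
  define W where "W e = snd (xu e)" for e
  have W: "W e i \<in> cyc (E - {e})" if "e \<in> E" "i < d" for e i using xu that unfolding W_def by blast
  have "\<exists>x. \<forall>e\<in>E. nonsing d (\<lambda>i j. B x (W e i) (W e j))"
    using xu unfolding W_def by (intro generic_parameter[of _ _ "\<lambda>e. fst (xu e)"] grD(2)[OF g]) blast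
  then obtain x where x: "\<And>e. e \<in> E \<Longrightarrow> nonsing d (\<lambda>i j. B x (W e i) (W e j))" by blast
  obtain e0 where e0: "e0 \<in> E" using E by blast
  obtain u0 v0 where uv0: "e0 = {u0, v0}" using gr_edge[OF g e0] by blast
  define us where "us = W e0"
  define A where "A i j = B x (us i) (us j)" for i j
  have us: "us i \<in> cyc E" if "i < d" for i
    using W[OF e0 that] cyc_mono[OF g, of "E - {e0}"] unfolding us_def by blast
  have nsA: "nonsing d A" using x[OF e0] unfolding A_def us_def .
  obtain K where K: "\<And>i k. i < d \<Longrightarrow> k < d \<Longrightarrow> (\<Sum>j<d. A i j * K j k) = (if i = k then 1 else 0)"
    using nonsing_inverse[OF nsA] by blast
  \<comment> \<open>By definition \<open>R\<close> is only the orthogonal complement of the chosen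
    \<open>us\<close>. The facts \<open>decomp\<close>, \<open>RR\<close> and \<open>RZ\<close> show
    that it complements their span and, rank \<open>d + 2\<close> being excluded, that it is the
    radical of the form.\<close>
  define R where "R = {y \<in> cyc E. \<forall>i<d. B x (us i) y = 0}"
  have Rcyc: "y \<in> cyc E" if "y \<in> R" for y using that by (simp add: R_def)
  have R_comb: "(\<lambda>u v. a * y u v + b * z u v) \<in> R" if "y \<in> R" "z \<in> R" for y z a b
    using that cyc_comb[of y E z a b] by (simp add: R_def B_comb)
  have decomp: "\<exists>a r. r \<in> R \<and> y = (\<lambda>u v. (\<Sum>i<d. a i * us i u v) + r u v)" if y: "y \<in> cyc E" for y
  proof -
    \<comment> \<open>These are the coefficients of the orthogonal projection onto the span of the
      \<open>us\<close>, obtained from the inverse Gram matrix.\<close>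
    define a where "a i = (\<Sum>j<d. K i j * B x (us j) y)" for i
    define s where "s u v = (\<Sum>i<d. a i * us i u v)" for u v
    define r where "r = (\<lambda>u v. 1 * y u v + (- 1) * s u v)"
    have s: "s \<in> cyc E" unfolding s_def by (intro cyc_lincomb) (use us in auto)
    have Bs: "B x (us k) s = B x (us k) y" if k: "k < d" for k
    proof -
      have "B x (us k) s = (\<Sum>i<d. a i * A k i)" unfolding s_def A_def by (rule B_lin) simp
      also have "\<dots> = (\<Sum>i<d. \<Sum>j<d. A k i * K i j * B x (us j) y)"
        unfolding a_def sum_distrib_right by (intro sum.cong refl) (simp add: algebra_simps)
      also have "\<dots> = (\<Sum>j<d. \<Sum>i<d. A k i * K i j * B x (us j) y)" by (rule sum.swap)
      also have "\<dots> = (\<Sum>j<d. (\<Sum>i<d. A k i * K i j) * B x (us j) y)" by (simp only: sum_distrib_right)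
      also have "\<dots> = (\<Sum>j<d. if k = j then B x (us j) y else 0)"
        using K[OF k] by (intro sum.cong) auto
      also have "\<dots> = B x (us k) y" using k by simp
      finally show ?thesis .
    qed
    have "r \<in> cyc E" unfolding r_def by (rule cyc_comb[OF y s])
    moreover have "B x (us k) r = 0" if "k < d" for k
      unfolding r_def B_comb using Bs[OF that] by simp
    ultimately have "r \<in> R" by (simp add: R_def)
    moreover have "y = (\<lambda>u v. (\<Sum>i<d. a i * us i u v) + r u v)"
      by (intro ext) (simp add: r_def s_def)
    ultimately show ?thesis by blast
  qed
  have RR: "B x y z = 0" if "y \<in> R" "z \<in> R" for y z
  proof (rule ccontr)
    assume nz: "B x y z \<noteq> 0"
    have "good E (d + 2)"
    proof (rule good_extend[OF us _ _ _ _ _ nz])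
      show "nonsing d (\<lambda>i j. B x (us i) (us j))" using nsA unfolding A_def .
    qed (use that in \<open>auto simp: R_def\<close>)
    then show False using top by simp
  qed
  have RZ: "B x z y = 0" if z: "z \<in> cyc E" and y: "y \<in> R" for y z
  proof -
    obtain a r where r: "r \<in> R" "z = (\<lambda>u v. (\<Sum>i<d. a i * us i u v) + r u v)"
      using decomp[OF z] by blast
    have "z = (\<lambda>u v. 1 * (\<Sum>i<d. a i * us i u v) + 1 * r u v)" using r(2) by simp
    then have "B x z y = 1 * B x (\<lambda>u v. \<Sum>i<d. a i * us i u v) y + 1 * B x r y"
      using B_comb_left[of x 1 "\<lambda>u v. \<Sum>i<d. a i * us i u v" 1 r y] by simp
    also have "B x (\<lambda>u v. \<Sum>i<d. a i * us i u v) y = 0"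
      by (subst B_lin_left) (use y in \<open>auto simp: R_def\<close>)
    finally show ?thesis using RR[OF r(1) y] by simp
  qed
  have ZR: "B x y z = 0" if "z \<in> cyc E" "y \<in> R" for y z
    using RZ[OF that] B_skew[of x y z] by simp
  have edge_nz: "\<exists>r\<in>R. r u v \<noteq> 0" if e: "{u, v} \<in> E" for u v
  proof (rule ccontr)
    assume "\<not> ?thesis"
    then have Rz: "r u v = 0" if "r \<in> R" for r using that by blast
    \<comment> \<open>The flows \<open>W {u, v}\<close> vanish on \<open>{u, v}\<close>, and modulo
      \<open>R\<close> a matrix \<open>C\<close> expresses them in the \<open>us\<close>. Their Gram
      matrix is \<open>C\<close> times \<open>A\<close> times the transpose of \<open>C\<close>; it
      is nonsingular, hence so is \<open>C\<close>. If \<open>R\<close> vanished on the edge too,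
      \<open>C\<close> would annihilate the values \<open>us j u v\<close>, and every flow would
      vanish there.\<close>
    define w where "w = W {u, v}"
    have wc: "w i \<in> cyc (E - {{u, v}})" if "i < d" for i using W[OF e that] unfolding w_def .
    have wE: "w i \<in> cyc E" if "i < d" for i using wc[OF that] cyc_mono[OF g, of "E - {{u, v}}"] by blast
    have "\<forall>i. \<exists>ar. i < d \<longrightarrow> snd ar \<in> R \<and> w i = (\<lambda>u v. (\<Sum>j<d. fst ar j * us j u v) + snd ar u v)"
    proof
      fix i
      show "\<exists>ar. i < d \<longrightarrow> snd ar \<in> R \<and> w i = (\<lambda>u v. (\<Sum>j<d. fst ar j * us j u v) + snd ar u v)"
      proof (cases "i < d")
        case True
        then obtain a r where "r \<in> R" "w i = (\<lambda>u v. (\<Sum>j<d. a j * us j u v) + r u v)"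
          using decomp[OF wE] by blast
        then show ?thesis by (intro exI[of _ "(a, r)"]) simp
      qed simp
    qed
    then obtain ar where ar: "\<And>i. i < d \<Longrightarrow> snd (ar i) \<in> R
        \<and> w i = (\<lambda>u v. (\<Sum>j<d. fst (ar i) j * us j u v) + snd (ar i) u v)"
      unfolding choice_iff by blast
    define C where "C i j = fst (ar i) j" for i j
    have rR: "snd (ar i) \<in> R" and wi: "w i = (\<lambda>u v. 1 * (\<Sum>j<d. C i j * us j u v) + 1 * snd (ar i) u v)"
      if "i < d" for i using ar[OF that] by (simp_all add: C_def)
    have Cs: "(\<Sum>j<d. C i j * us j u v) = 0" if i: "i < d" for i
    proof -
      have "w i u v = 0" using cyc_outside[OF wc[OF i], of u v] by simp
      then show ?thesis using wi[OF i] Rz[OF rR[OF i]] by (auto dest: fun_cong)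
    qed
    have G: "B x (w i) (w k) = (\<Sum>l<d. C k l * (\<Sum>j<d. C i j * A j l))" if i: "i < d" and k: "k < d" for i k
    proof -
      have sc: "(\<lambda>u v. \<Sum>j<d. C i j * us j u v) \<in> cyc E" for i
        by (intro cyc_lincomb) (use us in auto)
      have "B x (w i) (w k) = B x (w i) (\<lambda>u v. \<Sum>j<d. C k j * us j u v)"
        by (subst wi[OF k], subst B_comb) (use RZ[OF wE[OF i] rR[OF k]] in simp)
      also have "\<dots> = B x (\<lambda>u v. \<Sum>j<d. C i j * us j u v) (\<lambda>u v. \<Sum>j<d. C k j * us j u v)"
        by (subst wi[OF i], subst B_comb_left) (use ZR[OF sc rR[OF i]] in simp)
      also have "\<dots> = (\<Sum>l<d. C k l * B x (\<lambda>u v. \<Sum>j<d. C i j * us j u v) (us l))"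
        by (rule B_lin) simp
      also have "\<dots> = (\<Sum>l<d. C k l * (\<Sum>j<d. C i j * A j l))"
        unfolding A_def by (intro sum.cong refl arg_cong2[where f = "(*)"] B_lin_left) simp
      finally show ?thesis .
    qed
    have nsG: "nonsing d (\<lambda>i k. B x (w i) (w k))" using x[OF e] unfolding w_def .
    have "nonsing d C"
    proof (rule nonsing_transpose, unfold nonsing_def, intro allI impI)
      fix t j assume t: "\<forall>i<d. (\<Sum>k<d. C k i * t k) = 0" and j: "j < d"
      have "(\<Sum>k<d. B x (w i) (w k) * t k) = 0" if i: "i < d" for i
      proof -
        have "(\<Sum>k<d. B x (w i) (w k) * t k) = (\<Sum>k<d. \<Sum>l<d. (\<Sum>j<d. C i j * A j l) * (C k l * t k))"
          unfolding sum_distrib_left[symmetric] using G[OF i]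
          by (intro sum.cong refl) (simp add: sum_distrib_right sum_distrib_left algebra_simps)
        also have "\<dots> = (\<Sum>l<d. \<Sum>k<d. (\<Sum>j<d. C i j * A j l) * (C k l * t k))" by (rule sum.swap)
        also have "\<dots> = (\<Sum>l<d. (\<Sum>j<d. C i j * A j l) * (\<Sum>k<d. C k l * t k))"
          by (simp only: sum_distrib_left)
        also have "\<dots> = 0" using t by (intro sum.neutral) auto
        finally show ?thesis .
      qed
      then show "t j = 0" using nsG j unfolding nonsing_def by blast
    qed
    then have usz: "us j u v = 0" if "j < d" for j
      using Cs that unfolding nonsing_def by (elim allE[of _ "\<lambda>j. us j u v"]) blast
    have "y u v = 0" if y: "y \<in> cyc E" for y
    proof -
      obtain a r where r: "r \<in> R" "y = (\<lambda>u v. (\<Sum>i<d. a i * us i u v) + r u v)"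
        using decomp[OF y] by blast
      have "(\<Sum>i<d. a i * us i u v) = 0" using usz by (intro sum.neutral) auto
      then show ?thesis using r(2) Rz[OF r(1)] by simp
    qed
    then show False using nobridge[OF e] by blast
  qed
  have om0: "om n1 n2 w y z = 0" if y: "y \<in> R" and z: "z \<in> R" and w: "w \<in> V0" for w y z
  proof (rule ccontr)
    assume nz: "om n1 n2 w y z \<noteq> 0"
    define D where "D = om n1 n2 w y z"
    have D: "D = y w (n1 w) * z w (n2 w) - y w (n2 w) * z w (n1 w)" "D \<noteq> 0"
      using nz by (simp_all add: D_def om_def)
    \<comment> \<open>Cramer's rule: \<open>yz i\<close> is the combination of \<open>y\<close> and
      \<open>z\<close> that agrees with \<open>us i\<close> at both slots of \<open>w\<close>. Hence
      \<open>ws i\<close> is invisible to \<open>om\<close> at \<open>w\<close>: raising the weight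
      of \<open>w\<close> by 1 keeps the Gram matrix of the \<open>ws\<close> equal to
      \<open>A\<close> and makes the pairing of \<open>y\<close> and \<open>z\<close>
      nonzero.\<close>
    define al where "al i = (us i w (n1 w) * z w (n2 w) - us i w (n2 w) * z w (n1 w)) / D" for i
    define be where "be i = (us i w (n2 w) * y w (n1 w) - us i w (n1 w) * y w (n2 w)) / D" for i
    define yz where "yz i = (\<lambda>u v. al i * y u v + be i * z u v)" for i
    define ws where "ws i = (\<lambda>u v. 1 * us i u v + (- 1) * yz i u v)" for i
    have yzR: "yz i \<in> R" for i unfolding yz_def by (rule R_comb[OF y z])
    have wsE: "ws i \<in> cyc E" if "i < d" for i
      unfolding ws_def by (rule cyc_comb[OF us[OF that] Rcyc[OF yzR]])
    have w1: "ws i w (n1 w) = 0" for i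
    proof -
      have "D * (al i * y w (n1 w) + be i * z w (n1 w)) = D * us i w (n1 w)"
        using D(2) unfolding al_def be_def by (simp add: field_simps) (simp add: D(1) algebra_simps)
      then show ?thesis using D(2) by (simp add: ws_def yz_def)
    qed
    have w2: "ws i w (n2 w) = 0" for i
    proof -
      have "D * (al i * y w (n2 w) + be i * z w (n2 w)) = D * us i w (n2 w)"
        using D(2) unfolding al_def be_def by (simp add: field_simps) (simp add: D(1) algebra_simps)
      then show ?thesis using D(2) by (simp add: ws_def yz_def)
    qed
    define x' where "x' = (\<lambda>v. x v + 1 * of_bool (v = w))"
    have Bw: "B (\<lambda>v. of_bool (v = w)) p q = om n1 n2 w p q" for p q
      unfolding B_def using w grD(1)[OF g0] by (simp add: of_bool_def if_distrib[where f = "\<lambda>t. t * _"] cong: if_cong)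
    have Bx': "B x' p q = B x p q + om n1 n2 w p q" for p q
      unfolding x'_def B_param Bw by simp
    have omw: "om n1 n2 w (ws i) q = 0" for i q using w1 w2 by (simp add: om_def)
    have Bws: "B x (ws i) (ws j) = A i j" if i: "i < d" and j: "j < d" for i j
    proof -
      have "B x (ws i) (ws j) = 1 * B x (ws i) (us j) + (- 1) * B x (ws i) (yz j)"
        unfolding ws_def[of j] by (rule B_comb)
      also have "B x (ws i) (yz j) = 0" by (rule RZ[OF wsE[OF i] yzR])
      also have "B x (ws i) (us j) = 1 * B x (us i) (us j) + (- 1) * B x (yz i) (us j)"
        unfolding ws_def by (rule B_comb_left)
      also have "B x (yz i) (us j) = 0" by (rule ZR[OF us[OF j] yzR])
      finally show ?thesis by (simp add: A_def)
    qed
    have "good E (d + 2)"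
    proof (rule good_extend[of d ws E y z x'])
      have "nonsing d (\<lambda>i j. B x' (ws i) (ws j)) \<longleftrightarrow> nonsing d A"
        unfolding nonsing_def Bx' omw using Bws by simp
      then show "nonsing d (\<lambda>i j. B x' (ws i) (ws j))" using nsA by blast
      show "B x' (ws i) y = 0" if "i < d" for i unfolding Bx' omw using RZ[OF wsE[OF that] y] by simp
      show "B x' (ws i) z = 0" if "i < d" for i unfolding Bx' omw using RZ[OF wsE[OF that] z] by simp
      show "B x' y z \<noteq> 0" unfolding Bx' using RR[OF y z] nz by simp
    qed (use wsE Rcyc y z in auto)
    then show False using top by simp
  qed
  have vertex: "y w b = 0" if y: "y \<in> R" and wa: "{w, a} \<in> E" and ya: "y w a = 0" for y w a b
  proof -
    obtain z where z: "z \<in> R" "z w a \<noteq> 0" using edge_nz[OF wa] by blast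
    have w: "w \<in> V0" using grD(6)[OF g wa] VV by blast
    have cross: "y w (n1 w) * z w (n2 w) = y w (n2 w) * z w (n1 w)"
      using om0[OF y z(1) w] by (simp add: om_def)
    have vanish: "c * y w a + c' * z w a = 0"
      if "c * y w (n1 w) + c' * z w (n1 w) = 0" "c * y w (n2 w) + c' * z w (n2 w) = 0" for c c'
      using slots_vanish[OF g sl cyc_comb[OF Rcyc[OF y] Rcyc[OF z(1)], of c c'] that] .
    \<comment> \<open>The combination of \<open>y\<close> and \<open>z\<close> that cancels at the
      first slot cancels at the second by \<open>cross\<close>, so it vanishes at \<open>w\<close>
      altogether; towards \<open>a\<close> only its \<open>z\<close> term is left.\<close>
    have "z w (n1 w) * y w a + (- y w (n1 w)) * z w a = 0"
      using cross by (intro vanish) (simp_all add: algebra_simps)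
    then have y1: "y w (n1 w) = 0" using ya z(2) by simp
    have "z w (n2 w) * y w a + (- y w (n2 w)) * z w a = 0"
      using cross by (intro vanish) (simp_all add: algebra_simps)
    then have y2: "y w (n2 w) = 0" using ya z(2) by simp
    show ?thesis by (rule slots_vanish[OF g sl Rcyc[OF y] y1 y2])
  qed
  have zero: "y u v = 0" if y: "y \<in> R" and y0: "y u0 v0 = 0" for y u v
  proof (rule ccontr)
    assume nz: "y u v \<noteq> 0"
    \<comment> \<open>By \<open>vertex\<close>, a flow in \<open>R\<close> that is nonzero on one
      edge at a vertex is nonzero on all edges there, so the vertices that it touches are closed
      under adjacency.\<close>
    define S where "S = {a \<in> V. \<exists>b. y a b \<noteq> 0}"
    have SE: "y a b \<noteq> 0" if "a \<in> S" "{a, b} \<in> E" for a b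
      using vertex[OF y that(2)] that(1) by (auto simp: S_def)
    have SS: "b \<in> S" if "a \<in> S" "{a, b} \<in> E" for a b
    proof -
      have "y b a \<noteq> 0" using SE[OF that] cyc_antisym[OF Rcyc[OF y], of a b] by linarith
      then show ?thesis using grD(6)[OF g that(2)] by (auto simp: S_def)
    qed
    have "{u, v} \<in> E" using nz cyc_outside[OF Rcyc[OF y]] by blast
    then have "u \<in> S" using nz grD(6)[OF g] by (auto simp: S_def)
    moreover have "e \<subseteq> S \<or> e \<subseteq> V - S" if e: "e \<in> E" for e
    proof -
      obtain a b where ab: "e = {a, b}" "a \<in> V" "b \<in> V" using gr_edge[OF g e] by blast
      have "{b, a} \<in> E" "{a, b} \<in> E" using e ab(1) by (auto simp: insert_commute)
      then show ?thesis using SS ab by blast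
    qed
    ultimately have "S = V" by (intro nosplit) (auto simp: S_def)
    moreover have "u0 \<in> V" using grD(4)[OF g e0] uv0 by blast
    ultimately show False using SE[of u0 v0] e0 uv0 y0 by blast
  qed
  obtain r0 where r0: "r0 \<in> R" "r0 u0 v0 \<noteq> 0" using edge_nz e0 uv0 by blast
  have "beta E \<le> card {..<Suc d}"
  proof (rule beta_le[where f = "\<lambda>i. if i < d then us i else r0"])
    fix y assume "y \<in> cyc E"
    then obtain a r where r: "r \<in> R" "y = (\<lambda>u v. (\<Sum>i<d. a i * us i u v) + r u v)"
      using decomp by blast
    define t where "t = r u0 v0 / r0 u0 v0"
    have "1 * r u v + (- t) * r0 u v = 0" for u v
      using zero[OF R_comb[OF r(1) r0(1)], of 1 "- t" u v] r0(2) by (simp add: t_def)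
    then have rt: "r u v = t * r0 u v" for u v by (metis add.right_neutral add_eq_0_iff mult_1 mult_minus_left add.inverse_inverse)
    show "\<exists>a. \<forall>p q. y p q = (\<Sum>i<Suc d. a i * (if i < d then us i else r0) p q)"
    proof (intro exI[of _ "\<lambda>i. if i < d then a i else t"] allI)
      fix p q
      have "(\<Sum>i<d. (if i < d then a i else t) * (if i < d then us i else r0) p q) = (\<Sum>i<d. a i * us i p q)"
        by (intro sum.cong) auto
      then show "y p q = (\<Sum>i<Suc d. (if i < d then a i else t) * (if i < d then us i else r0) p q)"
        using r(2) rt[of p q] by simp
    qed
  qed simp
  then show ?thesis by simp
qed

text \<open>Over a separation \<open>beta\<close> is subadditive and \<open>rho\<close>
  superadditive, and a bridge leaves the cycle space unchanged. Deleting an edge that lowers the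
  rank decreases the left side by at most 10 and the right side by at least 14. Otherwise
  \<open>beta E \<le> rho E + 1\<close>, and adding 7 times this to
  \<open>3 * beta E + 7 \<le> 2 * card V\<close> makes the constants cancel exactly.\<close>

theorem subcubic_bound:
  assumes "sparse5 V E" "V \<subseteq> V0" "E \<subseteq> E0"
  shows "10 * beta E \<le> 7 * rho E + 2 * card V"
  using assms
proof (induction "card V + card E" arbitrary: V E rule: less_induct)
  case less
  have g: "gr V E" using less.prems(1) by (simp add: sparse5_def)
  have fin: "finite V" "finite E" using grD[OF g] by blast+
  consider (zero) "beta E = 0"
    | (split) A where "A \<subseteq> V" "A \<noteq> {}" "A \<noteq> V" "\<And>e. e \<in> E \<Longrightarrow> e \<subseteq> A \<or> e \<subseteq> V - A"
    | (bridge) u v where "{u, v} \<in> E" "\<And>y. y \<in> cyc E \<Longrightarrow> y u v = 0"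
    | (crit) e where "e \<in> E" "rho (E - {e}) \<noteq> rho E"
    | (last) "beta E \<noteq> 0" "\<And>A. A \<subseteq> V \<Longrightarrow> A \<noteq> {} \<Longrightarrow> (\<And>e. e \<in> E \<Longrightarrow> e \<subseteq> A \<or> e \<subseteq> V - A) \<Longrightarrow> A = V"
      "\<And>u v. {u, v} \<in> E \<Longrightarrow> \<exists>y\<in>cyc E. y u v \<noteq> 0" "\<And>e. e \<in> E \<Longrightarrow> rho (E - {e}) = rho E"
    by metis
  then show ?case
  proof cases
    case zero
    then show ?thesis by simp
  next
    case split
    define EA where "EA = {e \<in> E. e \<subseteq> A}"
    define EB where "EB = {e \<in> E. e \<subseteq> V - A}"
    have E: "E = EA \<union> EB" using split(4) by (auto simp: EA_def EB_def)
    have dA: "\<Union>EA \<subseteq> A" "\<Union>EB \<inter> A = {}" by (auto simp: EA_def EB_def)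
    have cV: "card V = card A + card (V - A)"
      using split(1) fin by (metis card_Diff_subset card_mono finite_subset le_add_diff_inverse)
    have pos: "0 < card A" "0 < card (V - A)"
      using split fin by (auto simp: card_gt_0_iff intro: finite_subset)
    have cE: "card EA \<le> card E" "card EB \<le> card E"
      using fin by (auto simp: EA_def EB_def intro: card_mono)
    have "10 * beta EA \<le> 7 * rho EA + 2 * card A"
    proof (rule less.hyps)
      show "card A + card EA < card V + card E" using cV pos cE by linarith
      show "sparse5 A EA" using split(1) dA by (intro sparse5_mono[OF less.prems(1)]) (auto simp: EA_def)
    qed (use split(1) less.prems in \<open>auto simp: EA_def\<close>)
    moreover have "10 * beta EB \<le> 7 * rho EB + 2 * card (V - A)"
    proof (rule less.hyps)
      show "card (V - A) + card EB < card V + card E" using cV pos cE by linarith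
      show "sparse5 (V - A) EB" by (intro sparse5_mono[OF less.prems(1)]) (auto simp: EB_def)
    qed (use less.prems in \<open>auto simp: EB_def\<close>)
    moreover have "beta E \<le> beta EA + beta EB"
      unfolding E using g dA E by (intro beta_disjoint_union[of V]) auto
    moreover have "rho EA + rho EB \<le> rho E"
    proof (rule good_le_rho[OF g good_union[OF g _ _ dA]])
      show "good EA (rho EA)" "good EB (rho EB)"
        using good_rho gr_subset[OF g] E by (metis sup_ge1, metis sup_ge2)
    qed (use E in auto)
    ultimately show ?thesis using cV by linarith
  next
    case bridge
    have eq: "cyc (E - {{u, v}}) = cyc E" using cyc_delete_eq[OF g] bridge(2) by blast
    have "10 * beta (E - {{u, v}}) \<le> 7 * rho (E - {{u, v}}) + 2 * card V"
    proof (rule less.hyps)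
      show "card V + card (E - {{u, v}}) < card V + card E"
        using card_Diff1_less[OF fin(2) bridge(1)] by simp
      show "sparse5 V (E - {{u, v}})" using grD(3)[OF g] by (intro sparse5_mono[OF less.prems(1)]) auto
    qed (use less.prems in auto)
    moreover have "beta (E - {{u, v}}) = beta E" by (simp add: beta_def eq)
    moreover have "rho (E - {{u, v}}) = rho E" by (simp add: rho_def good_def eq)
    ultimately show ?thesis by simp
  next
    case crit
    obtain u v where uv: "e = {u, v}" using gr_edge[OF g crit(1)] by blast
    have g': "gr V (E - {e})" using gr_subset[OF g] by blast
    have "rho (E - {e}) < rho E" using crit(2) rho_mono[OF g, of "E - {e}"] by auto
    moreover have "even (rho (E - {e}))" "even (rho E)" using even_rho g g' by blast+
    moreover have "a + 2 \<le> b" if "a < b" "even a" "even b" for a b :: nat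
      using that by (elim evenE) simp
    ultimately have r2: "rho (E - {e}) + 2 \<le> rho E" by blast
    have "10 * beta (E - {e}) \<le> 7 * rho (E - {e}) + 2 * card V"
    proof (rule less.hyps)
      show "card V + card (E - {e}) < card V + card E"
        using card_Diff1_less[OF fin(2) crit(1)] by simp
      show "sparse5 V (E - {e})" using grD(3)[OF g] by (intro sparse5_mono[OF less.prems(1)]) auto
    qed (use less.prems in auto)
    moreover have "beta E \<le> beta (E - {e}) + 1" unfolding uv by (rule beta_delete_le[OF g])
    ultimately show ?thesis using r2 by linarith
  next
    case last
    have "E \<noteq> {}" using last(1) by auto
    moreover have "good (E - {e}) (rho E)" if "e \<in> E" for e
      using good_rho[OF gr_subset[OF g], of "E - {e}"] last(4)[OF that] by auto
    moreover have "\<not> good E (rho E + 2)" using good_le_rho[OF g, of "rho E + 2"] by auto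
    ultimately have "beta E \<le> rho E + 1"
      using last by (intro radical_dimension[OF g less.prems(2,3)]) auto
    moreover have "3 * beta E + 7 \<le> 2 * card V"
      using less.prems(1) grD(3)[OF g] last(1) unfolding sparse5_def by auto
    ultimately show ?thesis by linarith
  qed
qed

end

section \<open>Feedback vertex sets and degenerate induced subgraphs\<close>

definition del :: "'a set set \<Rightarrow> 'a set \<Rightarrow> 'a set set" where
  "del E S = {e \<in> E. e \<inter> S = {}}"

lemma del_subset: "del E S \<subseteq> E"
  by (auto simp: del_def)

lemma del_del: "del (del E S) T = del E (S \<union> T)"
  by (auto simp: del_def)

lemma gr_del: "gr V E \<Longrightarrow> gr V (del E S)"
  using gr_subset del_subset by blast

text \<open>As long as a nonzero flow exists, an end of an edge that carries it is deleted, and each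
  deletion lowers \<open>beta\<close>.\<close>

lemma beta_hitting_set:
  assumes "gr V E"
  shows "\<exists>S\<subseteq>V. finite S \<and> card S \<le> beta E \<and> beta (del E S) = 0"
  using assms
proof (induction "beta E" arbitrary: E rule: less_induct)
  case less
  note g = less.prems
  show ?case
  proof (cases "beta E = 0")
    case True
    have "del E {} = E" by (auto simp: del_def)
    then show ?thesis using True by (intro exI[of _ "{}"]) simp
  next
    case False
    then have "\<exists>y\<in>cyc E. \<exists>u v. y u v \<noteq> 0" unfolding beta_eq_0_iff[OF g] by simp
    then obtain y u v where y: "y \<in> cyc E" "y u v \<noteq> 0" by (elim bexE exE) (rule that)
    have uv: "{u, v} \<in> E" using y(2) cyc_outside[OF y(1), of u v] by blast
    have "del E {u} \<subseteq> E - {{u, v}}" by (auto simp: del_def)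
    then have "beta (del E {u}) \<le> beta (E - {{u, v}})"
      using gr_subset[OF g, of "E - {{u, v}}"] by (intro beta_mono) auto
    then have lt: "beta (del E {u}) < beta E" using beta_delete_nonbridge[OF g y] by linarith
    obtain S where S: "S \<subseteq> V" "finite S" "card S \<le> beta (del E {u})" "beta (del (del E {u}) S) = 0"
      using less.hyps[OF lt gr_del[OF g]] by blast
    have "card (insert u S) \<le> beta E" using S(2,3) lt by (auto simp: card_insert_if)
    moreover have "beta (del E (insert u S)) = 0" using S(4) by (simp add: del_del)
    moreover have "insert u S \<subseteq> V" using S(1) grD(6)[OF g uv] by blast
    ultimately show ?thesis using S(2) by blast
  qed
qed

text \<open>The set found by \<open>good_killing_set\<close> and a hitting set for the rest have
  together at most \<open>rho E / 2 + (beta E - rho E)\<close> vertices. The bound on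
  \<open>10 * beta E\<close> from \<open>subcubic_bound\<close> eliminates
  \<open>rho E\<close>.\<close>

lemma subcubic_feedback:
  assumes s: "sparse5 V E" and d: "\<And>v. v \<in> V \<Longrightarrow> deg E v \<le> 3"
  shows "\<exists>S\<subseteq>V. 7 * card S \<le> 2 * beta E + card V \<and> beta (del E S) = 0"
proof -
  have g: "gr V E" using s by (simp add: sparse5_def)
  obtain n1 n2 where "slots E n1 n2" using slots_exist[OF g d] by blast
  then interpret slot_form V E n1 n2 using g by unfold_locales
  have main: "10 * beta E \<le> 7 * rho E + 2 * card V" using subcubic_bound[OF s] by blast
  obtain N where N: "N \<subseteq> V" "2 * card N = rho E" "beta {e \<in> E. e \<inter> N = {}} + rho E \<le> beta E"
    using good_killing_set[OF g good_rho[OF g]] .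
  obtain T where T: "T \<subseteq> V" "finite T" "card T \<le> beta (del E N)" "beta (del (del E N) T) = 0"
    using beta_hitting_set[OF gr_del[OF g]] by blast
  have "card (N \<union> T) \<le> card N + card T" by (rule card_Un_le)
  moreover have "beta (del E N) + rho E \<le> beta E" using N(3) by (simp add: del_def)
  ultimately have "7 * card (N \<union> T) \<le> 2 * beta E + card V" using N(2) T(3) main by linarith
  moreover have "beta (del E (N \<union> T)) = 0" using T(4) by (simp add: del_del)
  ultimately show ?thesis using N(1) T(1) by blast
qed

text \<open>A vertex other than \<open>c\<close> has all of its edges in \<open>F\<close> or none,
  so the divergence stays zero there. It is then zero at \<open>c\<close> as well, since the
  divergences of an antisymmetric function add up to zero.\<close>

lemma cyc_restrict_block:
  assumes g: "gr V E" and F: "F \<subseteq> E" and y: "y \<in> cyc E"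
    and cut: "\<And>e f. e \<in> F \<Longrightarrow> f \<in> E - F \<Longrightarrow> e \<inter> f \<subseteq> {c}"
  shows "(\<lambda>u w. if {u, w} \<in> F then y u w else 0) \<in> cyc F"
proof -
  define z where "z u w = (if {u, w} \<in> F then y u w else 0)" for u w
  have gF: "gr V F" using gr_subset[OF g F] .
  have anti: "z u w = - z w u" for u w
    using cyc_antisym[OF y, of u w] by (simp add: z_def insert_commute)
  have other: "(\<Sum>w\<in>V. z u w) = 0" if "u \<noteq> c" for u
  proof (cases "u \<in> \<Union>F")
    case True
    have "z u w = y u w" for w
    proof (cases "{u, w} \<in> E - F")
      case True
      then show ?thesis using cut[of _ "{u, w}"] \<open>u \<in> \<Union>F\<close> that by blast
    next
      case False
      then show ?thesis using cyc_outside[OF y, of u w] by (auto simp: z_def)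
    qed
    then show ?thesis using cyc_sum[OF g y] by simp
  next
    case False
    then have "{u, w} \<notin> F" for w by blast
    then show ?thesis by (simp add: z_def)
  qed
  have "(\<Sum>u\<in>V. \<Sum>w\<in>V. z u w) = 0"
  proof -
    have "(\<Sum>u\<in>V. \<Sum>w\<in>V. z u w) = (\<Sum>w\<in>V. \<Sum>u\<in>V. z u w)" by (rule sum.swap)
    also have "\<dots> = (\<Sum>w\<in>V. \<Sum>u\<in>V. - z w u)" by (intro sum.cong refl anti)
    also have "\<dots> = - (\<Sum>w\<in>V. \<Sum>u\<in>V. z w u)" by (simp only: sum_negf)
    finally show ?thesis by linarith
  qed
  moreover have "(\<Sum>u\<in>V. \<Sum>w\<in>V. z u w) = (\<Sum>u\<in>V. if u = c then (\<Sum>w\<in>V. z c w) else 0)"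
    using other by (intro sum.cong) auto
  ultimately have atc: "(\<Sum>w\<in>V. z c w) = 0" if "c \<in> V" using that grD(1)[OF g] by simp
  have "z \<in> cyc F"
    using gF
  proof (rule cycI)
    show "z u v = - z v u" for u v by (rule anti)
    show "{u, v} \<notin> F \<Longrightarrow> z u v = 0" for u v by (simp add: z_def)
    show "(\<Sum>v\<in>V. z u v) = 0" if "u \<in> V" for u using other atc that by (cases "u = c") auto
  qed
  then show ?thesis unfolding z_def[abs_def] .
qed

lemma beta_zero_blocks:
  assumes g: "gr V (E1 \<union> E2)" and cut: "\<And>e f. e \<in> E1 \<Longrightarrow> f \<in> E2 \<Longrightarrow> e \<inter> f \<subseteq> {c}"
    and z: "beta E1 = 0" "beta E2 = 0"
  shows "beta (E1 \<union> E2) = 0"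
proof -
  have g1: "gr V E1" "gr V E2" using gr_subset[OF g] by blast+
  have ne: "\<not> e \<subseteq> {c}" if "e \<in> E1 \<union> E2" for e
  proof
    assume "e \<subseteq> {c}"
    then have "card e \<le> card {c}" by (intro card_mono) auto
    then show False using grD(5)[OF g that] by simp
  qed
  have c1: "e \<inter> f \<subseteq> {c}" if "e \<in> E1" "f \<in> E1 \<union> E2 - E1" for e f
    using cut[of e f] that by blast
  have c2: "e \<inter> f \<subseteq> {c}" if "e \<in> E2" "f \<in> E1 \<union> E2 - E2" for e f
    using cut[of f e] that by blast
  have Z1: "\<forall>y\<in>cyc E1. \<forall>u v. y u v = 0" and Z2: "\<forall>y\<in>cyc E2. \<forall>u v. y u v = 0"
    using beta_eq_0_iff[OF g1(1)] beta_eq_0_iff[OF g1(2)] z by simp_all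
  have "y u w = 0" if y: "y \<in> cyc (E1 \<union> E2)" for y u w
  proof -
    have m1: "(\<lambda>u w. if {u, w} \<in> E1 then y u w else 0) \<in> cyc E1"
      by (rule cyc_restrict_block[OF g Un_upper1 y]) (rule c1)
    have v1: "\<forall>u w. (if {u, w} \<in> E1 then y u w else 0) = 0"
      using bspec[OF Z1 m1] .
    have m2: "(\<lambda>u w. if {u, w} \<in> E2 then y u w else 0) \<in> cyc E2"
      by (rule cyc_restrict_block[OF g Un_upper2 y]) (rule c2)
    have v2: "\<forall>u w. (if {u, w} \<in> E2 then y u w else 0) = 0"
      using bspec[OF Z2 m2] .
    show ?thesis using cyc_outside[OF y, of u w] v1[rule_format, of u w] v2[rule_format, of u w]
      by (auto split: if_splits)
  qed
  then show ?thesis using beta_eq_0_iff[OF g] by blast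
qed

text \<open>The hypothesis \<open>noncut\<close> says that deleting \<open>v\<close> leaves a
  connected graph. So each of three neighbours of \<open>v\<close> lies on a cycle through
  \<open>v\<close> and a fixed fourth one. The resulting flows are unit vectors on three edges at
  \<open>v\<close>, where all flows of \<open>del E {v}\<close> vanish.\<close>

lemma beta_del_vertex:
  assumes g: "gr V E" and d: "4 \<le> deg E v" and v: "v \<in> V"
    and noncut: "\<And>A. A \<subseteq> V - {v} \<Longrightarrow> A \<noteq> {} \<Longrightarrow> (\<And>e. e \<in> del E {v} \<Longrightarrow> e \<subseteq> A \<or> e \<subseteq> V - {v} - A) \<Longrightarrow> A = V - {v}"
  shows "beta (del E {v}) + 3 \<le> beta E"
proof -
  let ?D = "del E {v}"
  have gD: "gr V ?D" using gr_del[OF g] .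
  have "4 \<le> card {u. {v, u} \<in> E \<and> u \<noteq> v}" using d deg_eq_card_nbrs[OF grD(5)[OF g]] by simp
  from obtain_subset_with_card_n[OF this]
  obtain T where T: "T \<subseteq> {u. {v, u} \<in> E \<and> u \<noteq> v}" "card T = 4" "finite T" .
  obtain h where h: "bij_betw h {0..<4::nat} T" using ex_bij_betw_nat_finite[OF T(3)] T(2) by auto
  have hE: "{v, h i} \<in> E" "h i \<noteq> v" "h i \<in> V" if "i < 4" for i
  proof -
    have "h i \<in> T" using h that by (auto simp: bij_betw_def)
    then show "{v, h i} \<in> E" "h i \<noteq> v" "h i \<in> V" using T(1) grD(6)[OF g, of v "h i"] by auto
  qed
  have hinj: "h i \<noteq> h j" if "i < 4" "j < 4" "i \<noteq> j" for i j
    using h that by (auto simp: bij_betw_def inj_on_def)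
  define A where "A = {w \<in> V - {v}. conn ?D (h 0) w}"
  have "A = V - {v}"
  proof (rule noncut)
    show "A \<noteq> {}" using hE[of 0] by (auto simp: A_def)
    fix e assume e: "e \<in> ?D"
    obtain a b where ab: "e = {a, b}" "a \<in> V" "b \<in> V" using gr_edge[OF gD e] by blast
    have "conn ?D a b" using e ab(1) by (intro conn_edge) simp
    then have "conn ?D (h 0) a \<longleftrightarrow> conn ?D (h 0) b" using conn_trans conn_sym by metis
    moreover have "a \<noteq> v" "b \<noteq> v" using e ab(1) by (auto simp: del_def)
    ultimately show "e \<subseteq> A \<or> e \<subseteq> V - {v} - A" using ab by (auto simp: A_def)
  qed (auto simp: A_def)
  then have conn: "conn ?D (h 0) (h i)" if "i < 4" for i using hE[OF that] by (auto simp: A_def)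
  have "\<forall>i\<in>{1,2,3::nat}. \<exists>y. y \<in> cyc E \<and> y v (h i) = 1 \<and> (\<forall>j\<in>{1,2,3}. j \<noteq> i \<longrightarrow> y v (h j) = 0)"
  proof
    fix i assume i: "i \<in> {1,2,3::nat}"
    \<comment> \<open>Only two edges at \<open>v\<close> are kept, so a flow through
      \<open>{v, h i}\<close> must return through \<open>{v, h 0}\<close> and is zero on the other
      edges at \<open>v\<close>.\<close>
    let ?F = "insert {v, h 0} (insert {v, h i} ?D)"
    have i4: "i < 4" "i \<noteq> 0" using i by auto
    have FE: "?F \<subseteq> E" using hE(1)[of 0] hE(1)[OF i4(1)] del_subset[of E "{v}"] by auto
    have gF: "gr V ?F" using gr_subset[OF g FE] .
    have "conn (?F - {{v, h i}}) v (h 0)"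
      using hinj[of 0 i] i4 by (intro conn_edge) (auto simp: doubleton_eq_iff)
    moreover have "conn (?F - {{v, h i}}) (h 0) (h i)"
      by (rule conn_mono[OF conn[OF i4(1)]]) (auto simp: del_def)
    ultimately have c: "conn (?F - {{v, h i}}) v (h i)" by (rule conn_trans)
    have m: "{v, h i} \<in> ?F" by simp
    obtain y where y: "y \<in> cyc ?F" "y v (h i) = 1" using nonbridge_flow[OF gF m c] .
    have "y v (h j) = 0" if j: "j \<in> {1,2,3}" "j \<noteq> i" for j
    proof -
      have "j < 4" "j \<noteq> 0" using j by auto
      then have "{v, h j} \<notin> ?F"
        using hinj[of j i] hinj[of j 0] j(2) i4 by (auto simp: doubleton_eq_iff del_def)
      then show ?thesis using cyc_outside[OF y(1)] by blast
    qed
    then show "\<exists>y. y \<in> cyc E \<and> y v (h i) = 1 \<and> (\<forall>j\<in>{1,2,3}. j \<noteq> i \<longrightarrow> y v (h j) = 0)"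
      using y cyc_mono[OF g FE] by blast
  qed
  then obtain y where Y: "\<forall>i\<in>{1,2,3::nat}. y i \<in> cyc E \<and> y i v (h i) = 1
      \<and> (\<forall>j\<in>{1,2,3}. j \<noteq> i \<longrightarrow> y i v (h j) = 0)"
    unfolding bchoice_iff by (rule exE)
  have y: "\<And>i. i \<in> {1,2,3::nat} \<Longrightarrow> y i \<in> cyc E"
    "\<And>i. i \<in> {1,2,3::nat} \<Longrightarrow> y i v (h i) = 1"
    "\<And>i j. i \<in> {1,2,3::nat} \<Longrightarrow> j \<in> {1,2,3} \<Longrightarrow> j \<noteq> i \<Longrightarrow> y i v (h j) = 0"
    using Y by blast+
  obtain f where f: "\<And>i. i < beta ?D \<Longrightarrow> f i \<in> cyc ?D"
    "\<And>a i. (\<And>u v. (\<Sum>i<beta ?D. a i * f i u v) = 0) \<Longrightarrow> i < beta ?D \<Longrightarrow> a i = 0"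
    using cyc_basis[OF gD] by blast
  have "card ({..<beta ?D} <+> {1,2,3::nat}) \<le> beta E"
  proof (rule le_beta[OF g, where f = "case_sum f y"])
    show "case_sum f y i \<in> cyc E" if "i \<in> {..<beta ?D} <+> {1,2,3::nat}" for i
      using that f(1) y(1) cyc_mono[OF g del_subset[of E "{v}"]] by auto
  next
    fix a i assume s: "\<And>u w. (\<Sum>i\<in>{..<beta ?D} <+> {1,2,3::nat}. a i * case_sum f y i u w) = 0"
      and i: "i \<in> {..<beta ?D} <+> {1,2,3::nat}"
    have s': "(\<Sum>i<beta ?D. a (Inl i) * f i u w) + (\<Sum>i\<in>{1,2,3::nat}. a (Inr i) * y i u w) = 0" for u w
      using s[of u w] by (simp add: sum.Plus)
    have a2: "a (Inr j) = 0" if j: "j \<in> {1,2,3::nat}" for j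
    proof -
      have "{v, h j} \<notin> ?D" by (simp add: del_def)
      then have "(\<Sum>i<beta ?D. a (Inl i) * f i v (h j)) = 0"
        using cyc_outside[OF f(1)] by (intro sum.neutral) auto
      moreover have "(\<Sum>i\<in>{1,2,3::nat}. a (Inr i) * y i v (h j)) = (\<Sum>i\<in>{j}. a (Inr i) * y i v (h j))"
        using j y(3) by (intro sum.mono_neutral_right) auto
      ultimately show ?thesis using s'[of v "h j"] y(2)[OF j] by simp
    qed
    have "(\<Sum>i<beta ?D. a (Inl i) * f i u w) = 0" for u w
    proof -
      have "(\<Sum>i\<in>{1,2,3::nat}. a (Inr i) * y i u w) = 0" using a2 by (intro sum.neutral) auto
      then show ?thesis using s'[of u w] by simp
    qed
    then have "a (Inl i) = 0" if "i < beta ?D" for i using f(2)[of "\<lambda>i. a (Inl i)" i] that by blast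
    then show "a i = 0" using a2 i by auto
  qed simp
  then show ?thesis by (simp add: card_Plus)
qed

text \<open>A noncut vertex of degree at least 4 lowers \<open>2 * beta E + card V\<close> by at
  least \<open>2 * 3 + 1 = 7\<close> and so pays for itself. A cut vertex is counted on both sides,
  so the two bounds can add up to one more than allowed; divisibility by 7 makes up for
  this.\<close>

theorem feedback_bound:
  assumes "sparse5 V E"
  shows "\<exists>S\<subseteq>V. 7 * card S \<le> 2 * beta E + card V \<and> beta (del E S) = 0"
  using assms
proof (induction "card V" arbitrary: V E rule: less_induct)
  case less
  note sp = less.prems
  have g: "gr V E" using sp by (simp add: sparse5_def)
  have fin: "finite V" "finite E" using grD[OF g] by blast+
  show ?case
  proof (cases "\<forall>v\<in>V. deg E v \<le> 3")
    case True
    then show ?thesis using subcubic_feedback[OF sp] by blast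
  next
    case False
    then obtain v where v: "v \<in> V" "4 \<le> deg E v" by force
    show ?thesis
    proof (cases "\<exists>A. A \<subseteq> V - {v} \<and> A \<noteq> {} \<and> (\<forall>e\<in>del E {v}. e \<subseteq> A \<or> e \<subseteq> V - {v} - A) \<and> A \<noteq> V - {v}")
      case False
      have b: "beta (del E {v}) + 3 \<le> beta E"
        by (rule beta_del_vertex[OF g v(2,1)]) (use False in blast)
      have "sparse5 (V - {v}) (del E {v})"
        by (rule sparse5_mono[OF sp]) (use grD(4)[OF g] in \<open>auto simp: del_def\<close>)
      then obtain S where S: "S \<subseteq> V - {v}" "7 * card S \<le> 2 * beta (del E {v}) + card (V - {v})"
        "beta (del (del E {v}) S) = 0"
        using less.hyps[of "V - {v}" "del E {v}"] card_Diff1_less[OF fin(1) v(1)] by blast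
      have fS: "finite S" using S(1) fin(1) finite_subset by blast
      have "v \<notin> S" using S(1) by blast
      then have "card (insert v S) = Suc (card S)" using fS by simp
      moreover have "card V = Suc (card (V - {v}))" using card_Suc_Diff1[OF fin(1) v(1)] by simp
      ultimately have "7 * card (insert v S) \<le> 2 * beta E + card V" using S(2) b by linarith
      moreover have "beta (del E (insert v S)) = 0" using S(3) by (simp add: del_del)
      ultimately show ?thesis using S(1) v(1) by blast
    next
      case True
      then obtain A where A: "A \<subseteq> V - {v}" "A \<noteq> {}" "\<And>e. e \<in> del E {v} \<Longrightarrow> e \<subseteq> A \<or> e \<subseteq> V - {v} - A"
        "A \<noteq> V - {v}" by blast
      define B where "B = V - {v} - A"
      have B: "B \<subseteq> V - {v}" "B \<noteq> {}" "A \<inter> B = {}" "A \<union> B = V - {v}" using A by (auto simp: B_def)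
      define E1 where "E1 = {e \<in> E. e \<inter> B = {}}"
      define E2 where "E2 = {e \<in> E. e \<inter> B \<noteq> {}}"
      have E1: "\<Union>E1 \<subseteq> insert v A" "E1 \<subseteq> E" using grD(3)[OF g] by (auto simp: E1_def B_def)
      have E2: "\<Union>E2 \<subseteq> insert v B" "E2 \<subseteq> E"
      proof -
        have "e \<subseteq> insert v B" if e: "e \<in> E2" for e
        proof (cases "v \<in> e")
          case True
          have "e \<in> E" using e by (simp add: E2_def)
          then obtain a b where ab: "e = {a, b}" "a \<noteq> b" using gr_edge[OF g] by metis
          then show ?thesis using True e B(1) by (auto simp: E2_def)
        next
          case False
          then have "e \<in> del E {v}" using e by (simp add: E2_def del_def)
          then show ?thesis using A(3)[of e] e by (auto simp: E2_def B_def)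
        qed
        then show "\<Union>E2 \<subseteq> insert v B" "E2 \<subseteq> E" by (auto simp: E2_def)
      qed
      have EE: "E = E1 \<union> E2" "E1 \<inter> E2 = {}" by (auto simp: E1_def E2_def)
      have cutv: "e \<inter> f \<subseteq> {v}" if "e \<in> E1" "f \<in> E2" for e f
        using that E1(1) E2(1) B(3) by blast
      have fAB: "finite A" "finite B" "v \<notin> A" "v \<notin> B" using A(1) B(1) fin(1) finite_subset by blast+
      have cAB: "0 < card A" "0 < card B" "card V = card A + card B + 1"
      proof -
        show "0 < card A" "0 < card B" using fAB A(2) B(2) by (auto simp: card_gt_0_iff)
        have "card (V - {v}) = card A + card B" using B(3,4) card_Un_disjoint[OF fAB(1,2)] by simp
        then show "card V = card A + card B + 1" using card_Suc_Diff1[OF fin(1) v(1)] by simp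
      qed
      have cI: "card (insert v A) = card A + 1" "card (insert v B) = card B + 1" using fAB by auto
      obtain S1 where S1: "S1 \<subseteq> insert v A" "7 * card S1 \<le> 2 * beta E1 + card (insert v A)" "beta (del E1 S1) = 0"
      proof -
        have "sparse5 (insert v A) E1" using E1 A(1) v(1) by (intro sparse5_mono[OF sp]) auto
        moreover have "card (insert v A) < card V" using cAB cI by linarith
        ultimately show thesis using less.hyps[of "insert v A" E1] that by blast
      qed
      obtain S2 where S2: "S2 \<subseteq> insert v B" "7 * card S2 \<le> 2 * beta E2 + card (insert v B)" "beta (del E2 S2) = 0"
      proof -
        have "sparse5 (insert v B) E2" using E2 B(1) v(1) by (intro sparse5_mono[OF sp]) auto
        moreover have "card (insert v B) < card V" using cAB cI by linarith
        ultimately show thesis using less.hyps[of "insert v B" E2] that by blast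
      qed
      obtain SA where SA: "SA \<subseteq> A" "7 * card SA \<le> 2 * beta (del E1 {v}) + card A" "beta (del (del E1 {v}) SA) = 0"
      proof -
        have "sparse5 A (del E1 {v})"
          using E1 A(1) by (intro sparse5_mono[OF sp]) (auto simp: del_def)
        moreover have "card A < card V" using cAB by linarith
        ultimately show thesis using less.hyps[of A "del E1 {v}"] that by blast
      qed
      obtain SB where SB: "SB \<subseteq> B" "7 * card SB \<le> 2 * beta (del E2 {v}) + card B" "beta (del (del E2 {v}) SB) = 0"
      proof -
        have "sparse5 B (del E2 {v})"
          using E2 B(1) by (intro sparse5_mono[OF sp]) (auto simp: del_def)
        moreover have "card B < card V" using cAB by linarith
        ultimately show thesis using less.hyps[of B "del E2 {v}"] that by blast
      qed
      have bA: "beta (del E1 {v}) \<le> beta E1" "beta (del E2 {v}) \<le> beta E2"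
        using beta_mono[OF gr_subset[OF g E1(2)] del_subset] beta_mono[OF gr_subset[OF g E2(2)] del_subset] by blast+
      have bb: "beta E1 + beta E2 \<le> beta E" using beta_superadditive[OF g E1(2) E2(2) EE(2)] .
      consider "7 * (card S1 + card S2) \<le> 2 * beta E + card V"
        | "7 * (1 + card SA + card SB) \<le> 2 * beta E + card V"
      proof -
        \<comment> \<open>if both sides are tight modulo 7, deleting the cut vertex saves a vertex on each of them\<close>
        have ar: "7 * (p + q) \<le> a + b - 1 \<or> 7 * (1 + r + s) \<le> a + b - 1"
          if "7 * p \<le> a" "7 * q \<le> b" "7 * r \<le> a - 1" "7 * s \<le> b - 1" "0 < a" "0 < b" for p q r s a b :: nat
        proof (cases "7 * p < a \<or> 7 * q < b")
          case True
          then show ?thesis using that(1,2) by auto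
        next
          case False
          then have eq: "7 * p = a" "7 * q = b" using that(1,2) by simp_all
          have "7 * r < 7 * p" "7 * s < 7 * q" unfolding eq using that(3-6) by linarith+
          then have "r < p" "s < q" by simp_all
          then have "1 + r + s < p + q" by linarith
          then have "7 * (1 + r + s) < 7 * (p + q)" by simp
          also have "7 * (p + q) = a + b" using eq by simp
          finally show ?thesis by linarith
        qed
        have "7 * card SA \<le> (2 * beta E1 + card (insert v A)) - 1" "7 * card SB \<le> (2 * beta E2 + card (insert v B)) - 1"
          using SA(2) SB(2) bA cI by linarith+
        then have "7 * (card S1 + card S2) \<le> (2 * beta E1 + card (insert v A)) + (2 * beta E2 + card (insert v B)) - 1
          \<or> 7 * (1 + card SA + card SB) \<le> (2 * beta E1 + card (insert v A)) + (2 * beta E2 + card (insert v B)) - 1"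
          using cI by (intro ar S1(2) S2(2)) auto
        then show thesis using that cI cAB bb by linarith
      qed
      then show ?thesis
      proof cases
        case 1
        have "card (S1 \<union> S2) \<le> card S1 + card S2" by (rule card_Un_le)
        then have "7 * card (S1 \<union> S2) \<le> 2 * beta E + card V"
          by (rule order_trans[OF mult_le_mono2 1])
        moreover have "beta (del E (S1 \<union> S2)) = 0"
        proof -
          have eq: "del E (S1 \<union> S2) = del E1 (S1 \<union> S2) \<union> del E2 (S1 \<union> S2)"
            unfolding EE(1) by (auto simp: del_def)
          have "beta (del E1 (S1 \<union> S2)) \<le> beta (del E1 S1)"
            by (rule beta_mono[OF gr_del[OF gr_subset[OF g E1(2)]]]) (auto simp: del_def)
          moreover have "beta (del E2 (S1 \<union> S2)) \<le> beta (del E2 S2)"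
            by (rule beta_mono[OF gr_del[OF gr_subset[OF g E2(2)]]]) (auto simp: del_def)
          moreover have gg: "gr V (del E1 (S1 \<union> S2) \<union> del E2 (S1 \<union> S2))"
            unfolding eq[symmetric] by (rule gr_del[OF g])
          ultimately show ?thesis
            unfolding eq using S1(3) S2(3) cutv del_subset by (intro beta_zero_blocks[OF gg, of v]) (blast | simp)+
        qed
        moreover have "S1 \<union> S2 \<subseteq> V" using S1(1) S2(1) A(1) B(1) v(1) by blast
        ultimately show ?thesis by blast
      next
        case 2
        have "card (insert v (SA \<union> SB)) \<le> 1 + card SA + card SB"
          using card_insert_le_m1[of "1 + card SA + card SB" "SA \<union> SB" v] card_Un_le[of SA SB] by simp
        then have "7 * card (insert v (SA \<union> SB)) \<le> 2 * beta E + card V"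
          by (rule order_trans[OF mult_le_mono2 2])
        moreover have "beta (del E (insert v (SA \<union> SB))) = 0"
        proof -
          let ?S = "insert v (SA \<union> SB)"
          have eq: "del E ?S = del E1 ?S \<union> del E2 ?S"
            unfolding EE(1) by (auto simp: del_def)
          have "beta (del E1 ?S) \<le> beta (del (del E1 {v}) SA)"
            by (rule beta_mono[OF gr_del[OF gr_del[OF gr_subset[OF g E1(2)]]]]) (auto simp: del_def)
          moreover have "beta (del E2 ?S) \<le> beta (del (del E2 {v}) SB)"
            by (rule beta_mono[OF gr_del[OF gr_del[OF gr_subset[OF g E2(2)]]]]) (auto simp: del_def)
          moreover have gg: "gr V (del E1 ?S \<union> del E2 ?S)"
            unfolding eq[symmetric] by (rule gr_del[OF g])
          ultimately show ?thesis
            unfolding eq using SA(3) SB(3) cutv del_subset by (intro beta_zero_blocks[OF gg, of v]) (blast | simp)+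
        qed
        moreover have "insert v (SA \<union> SB) \<subseteq> V" using SA(1) SB(1) A(1) B(1) v(1) by blast
        ultimately show ?thesis by blast
      qed
    qed
  qed
qed

section \<open>Degenerate induced subgraphs\<close>

definition degen :: "nat \<Rightarrow> 'a set \<Rightarrow> 'a set set \<Rightarrow> bool" where
  "degen k W E \<longleftrightarrow> (\<forall>U\<subseteq>W. U \<noteq> {} \<longrightarrow> (\<exists>v\<in>U. card {e \<in> E. e \<subseteq> U \<and> v \<in> e} \<le> k))"

lemma deg_induced: "deg {e \<in> E. e \<subseteq> U} v = card {e \<in> E. e \<subseteq> U \<and> v \<in> e}"
  unfolding deg_def by (rule arg_cong[where f = card]) auto

lemma sparse5_beta:
  assumes "sparse5 V E"
  shows "3 * beta E \<le> 2 * card V"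
proof (cases "beta E = 0")
  case False
  have "\<Union>E \<subseteq> V" using assms grD(3) by (auto simp: sparse5_def)
  then have "3 * beta E + 7 \<le> 2 * card V" using assms False unfolding sparse5_def by auto
  then show ?thesis by linarith
qed simp

text \<open>This is three times \<open>card_edges_le\<close>, with \<open>3 * beta E\<close>
  replaced by \<open>2 * card V\<close>.\<close>

lemma sparse5_edges:
  assumes "sparse5 V E" "V \<noteq> {}"
  shows "3 * card E + 3 \<le> 5 * card V"
  using sparse5_beta[OF assms(1)] card_edges_le[of V E] assms unfolding sparse5_def by fastforce

lemma sparse5_induced:
  assumes "sparse5 V E" "U \<subseteq> V"
  shows "sparse5 U {e \<in> E. e \<subseteq> U}"
  using assms by (intro sparse5_mono[OF assms]) auto

text \<open>Since \<open>3 * beta E \<le> 2 * card V\<close>, the bound of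
  \<open>feedback_bound\<close> becomes \<open>21 * card S \<le> 7 * card V\<close>.\<close>

lemma feedback_forest:
  assumes s: "sparse5 V E"
  shows "\<exists>S\<subseteq>V. 3 * card S \<le> card V \<and> degen 1 (V - S) E"
proof -
  have g: "gr V E" using s by (simp add: sparse5_def)
  obtain S where S: "S \<subseteq> V" "7 * card S \<le> 2 * beta E + card V" "beta (del E S) = 0"
    using feedback_bound[OF s] by blast
  have "3 * card S \<le> card V" using S(2) sparse5_beta[OF s] by linarith
  moreover have "degen 1 (V - S) E"
    unfolding degen_def
  proof (intro allI impI)
    fix U assume U: "U \<subseteq> V - S" "U \<noteq> {}"
    let ?F = "{e \<in> E. e \<subseteq> U}"
    have "?F \<subseteq> del E S" using U(1) by (auto simp: del_def)
    then have "beta ?F = 0" using beta_mono[OF gr_del[OF g], of ?F S] S(3) by simp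
    moreover have "gr U ?F" using U(1) by (intro gr_restrict[OF g]) auto
    ultimately show "\<exists>v\<in>U. card {e \<in> E. e \<subseteq> U \<and> v \<in> e} \<le> 1"
      using forest_low_degree[of U ?F] U(2) unfolding deg_induced by blast
  qed
  ultimately show ?thesis using S(1) by blast
qed

text \<open>Minimum degree 4 would force at least twice as many edges as vertices, but sparsity
  allows fewer than 5/3 as many.\<close>

lemma degen_3:
  assumes s: "sparse5 V E"
  shows "degen 3 V E"
  unfolding degen_def
proof (intro allI impI)
  fix U assume U: "U \<subseteq> V" "U \<noteq> {}"
  let ?F = "{e \<in> E. e \<subseteq> U}"
  have sU: "sparse5 U ?F" by (rule sparse5_induced[OF s U(1)])
  then have gU: "gr U ?F" by (simp add: sparse5_def)
  show "\<exists>v\<in>U. card {e \<in> E. e \<subseteq> U \<and> v \<in> e} \<le> 3"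
  proof (rule ccontr)
    assume "\<not> ?thesis"
    then have "(\<Sum>v\<in>U. 4) \<le> (\<Sum>v\<in>U. deg ?F v)" unfolding deg_induced by (intro sum_mono) force
    then have "4 * card U \<le> 2 * card ?F" using sum_deg[OF gU] by simp
    then show False using sparse5_edges[OF sU U(2)] by linarith
  qed
qed

text \<open>A triangle has \<open>beta\<close> at least 1 on three vertices, and
  \<open>3 + 7 \<le> 6\<close> fails. In \<open>degen_2\<close> this keeps two neighbours of the
  centre of a star nonadjacent.\<close>

lemma sparse5_triangle_free:
  assumes s: "sparse5 V E" and e: "{a, b} \<in> E" "{a, c} \<in> E" and ne: "b \<noteq> c"
  shows "{b, c} \<notin> E"
proof
  assume bc: "{b, c} \<in> E"
  have g: "gr V E" using s by (simp add: sparse5_def)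
  have d: "a \<noteq> b" "a \<noteq> c" "{a, b, c} \<subseteq> V" using grD(6)[OF g e(1)] grD(6)[OF g e(2)] by auto
  let ?F = "{{a, b}, {a, c}, {b, c}}"
  have F: "?F \<subseteq> E" "\<Union>?F \<subseteq> {a, b, c}" using e bc by auto
  have "card ?F = 3" using d ne by (auto simp: doubleton_eq_iff card_insert_if)
  moreover have "card {a, b, c} = 3" using d ne by simp
  moreover have "gr {a, b, c} ?F" using d F by (intro gr_restrict[OF g]) auto
  ultimately have "1 \<le> beta ?F" using card_edges_le[of "{a, b, c}" ?F] by simp
  then have "3 * beta ?F + 7 \<le> 2 * card {a, b, c}" using s F d unfolding sparse5_def by blast
  then show False using \<open>card {a, b, c} = 3\<close> \<open>1 \<le> beta ?F\<close> by linarith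
qed

text \<open>
  If every vertex has degree at least 3 and no vertex as in the conclusion exists, then counting
  the edges from vertices of degree 3 gives at least twice as many vertices of degree 4 as of
  degree 3, so the average degree is at least \<open>11/3\<close>.
\<close>

lemma heavy_star_exists:
  assumes s: "sparse5 V E" and ne: "V \<noteq> {}" and d3: "\<And>v. v \<in> V \<Longrightarrow> 3 \<le> deg E v"
  shows "\<exists>v\<in>V. \<exists>T. T \<subseteq> {u \<in> V. deg E u = 3 \<and> {v, u} \<in> E} \<and> (card T = 2 \<or> card T = 1 \<and> 5 \<le> deg E v)"
proof (rule ccontr)
  assume no: "\<not> ?thesis"
  have g: "gr V E" using s by (simp add: sparse5_def)
  have fin: "finite V" "finite E" using grD[OF g] by blast+
  define V3 where "V3 = {u \<in> V. deg E u = 3}"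
  define V4 where "V4 = {u \<in> V. deg E u = 4}"
  define V5 where "V5 = {u \<in> V. 5 \<le> deg E u}"
  have fV: "finite V3" "finite V4" "finite V5" using fin by (auto simp: V3_def V4_def V5_def)
  have un: "V = V3 \<union> V4 \<union> V5" using d3 by (force simp: V3_def V4_def V5_def)
  have dj: "V3 \<inter> V4 = {}" "(V3 \<union> V4) \<inter> V5 = {}" by (auto simp: V3_def V4_def V5_def)
  have sumV: "(\<Sum>v\<in>V. f v) = (\<Sum>v\<in>V3. f v) + (\<Sum>v\<in>V4. f v) + (\<Sum>v\<in>V5. f v)" for f :: "'a \<Rightarrow> nat"
    unfolding un using fV dj by (simp add: sum.union_disjoint)
  define t where "t v = card {u \<in> V3. {v, u} \<in> E}" for v
  have tsub: "{u \<in> V3. {v, u} \<in> E} = {u \<in> V. deg E u = 3 \<and> {v, u} \<in> E}" for v by (auto simp: V3_def)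
  have t1: "t v \<le> 1" if v: "v \<in> V" for v
  proof (rule ccontr)
    assume "\<not> t v \<le> 1"
    then have "2 \<le> card {u \<in> V3. {v, u} \<in> E}" by (simp add: t_def)
    from obtain_subset_with_card_n[OF this]
    obtain T where "T \<subseteq> {u \<in> V3. {v, u} \<in> E}" "card T = 2" "finite T" .
    then show False using no v unfolding tsub by (elim notE) (intro bexI exI conjI disjI1)
  qed
  have t0: "t v = 0" if v: "v \<in> V5" for v
  proof (rule ccontr)
    assume "t v \<noteq> 0"
    then have "1 \<le> card {u \<in> V3. {v, u} \<in> E}" by (simp add: t_def)
    from obtain_subset_with_card_n[OF this]
    obtain T where "T \<subseteq> {u \<in> V3. {v, u} \<in> E}" "card T = 1" "finite T" .
    moreover have "v \<in> V" "5 \<le> deg E v" using v by (auto simp: V5_def)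
    ultimately show False using no unfolding tsub by (elim notE) (intro bexI exI conjI disjI2)
  qed
  have "(\<Sum>v\<in>V. t v) = (\<Sum>v\<in>V. \<Sum>u\<in>V3. if {v, u} \<in> E then 1 else 0)"
    using fV by (simp add: t_def sum.If_cases Int_def)
  also have "\<dots> = (\<Sum>u\<in>V3. \<Sum>v\<in>V. if {v, u} \<in> E then 1 else 0)" by (rule sum.swap)
  also have "\<dots> = (\<Sum>u\<in>V3. 3)"
  proof (intro sum.cong refl)
    fix u assume u: "u \<in> V3"
    have "(\<Sum>v\<in>V. if {v, u} \<in> E then 1 else (0::nat)) = card {v \<in> V. {v, u} \<in> E}"
      using fin by (simp add: sum.If_cases Int_def)
    also have "{v \<in> V. {v, u} \<in> E} = {v. {u, v} \<in> E \<and> v \<noteq> u}"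
      using grD(6)[OF g] by (auto simp: insert_commute)
    also have "card \<dots> = deg E u" by (rule deg_eq_card_nbrs[OF grD(5)[OF g], symmetric])
    finally show "(\<Sum>v\<in>V. if {v, u} \<in> E then 1 else (0::nat)) = 3" using u by (simp add: V3_def)
  qed
  finally have "3 * card V3 = (\<Sum>v\<in>V. t v)" by simp
  also have "\<dots> \<le> card V3 + card V4"
  proof -
    have "(\<Sum>v\<in>V3. t v) \<le> (\<Sum>v\<in>V3. 1)" "(\<Sum>v\<in>V4. t v) \<le> (\<Sum>v\<in>V4. 1)"
      using t1 un by (intro sum_mono; auto)+
    moreover have "(\<Sum>v\<in>V5. t v) = 0" using t0 by (intro sum.neutral) auto
    ultimately show ?thesis by (simp add: sumV)
  qed
  finally have n4: "2 * card V3 \<le> card V4" by linarith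
  have "(\<Sum>v\<in>V3. deg E v) = 3 * card V3" "(\<Sum>v\<in>V4. deg E v) = 4 * card V4"
    by (simp_all add: V3_def V4_def)
  moreover have "(\<Sum>v\<in>V5. 5) \<le> (\<Sum>v\<in>V5. deg E v)" by (intro sum_mono) (simp add: V5_def)
  ultimately have "3 * card V3 + 4 * card V4 + 5 * card V5 \<le> 2 * card E"
    using sum_deg[OF g] sumV[of "deg E"] by simp
  moreover have "card V = card V3 + card V4 + card V5" using sumV[of "\<lambda>_. 1"] by simp
  ultimately show False using n4 sparse5_edges[OF s ne] by linarith
qed

lemma card_star_edges:
  assumes g: "gr V E" and ne: "a \<noteq> b"
  shows "card ({e \<in> E. a \<in> e} \<inter> {e \<in> E. b \<in> e}) \<le> (if {a, b} \<in> E then 1 else 0)"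
proof -
  have "{e \<in> E. a \<in> e} \<inter> {e \<in> E. b \<in> e} \<subseteq> {e \<in> E. e = {a, b}}"
  proof
    fix e assume e: "e \<in> {e \<in> E. a \<in> e} \<inter> {e \<in> E. b \<in> e}"
    then obtain u v where "e = {u, v}" using gr_edge[OF g, of e] by blast
    then show "e \<in> {e \<in> E. e = {a, b}}" using e ne by auto
  qed
  also have "\<dots> = (if {a, b} \<in> E then {{a, b}} else {})" by auto
  finally show ?thesis by (auto split: if_splits dest!: card_mono[rotated])
qed

text \<open>Only the centre \<open>v\<close> of a heavy star enters \<open>S\<close>. The vertices
  of \<open>T\<close> then have degree at most 2 and can be peeled off, so a single deleted vertex
  disposes of all edges meeting \<open>insert v T\<close>, and there are at least 7 of them.\<close>

theorem degen_2:
  assumes "sparse5 V E"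
  shows "\<exists>S\<subseteq>V. 7 * card S \<le> card E \<and> degen 2 (V - S) E"
  using assms
proof (induction "card V" arbitrary: V E rule: less_induct)
  case less
  note s = less.prems
  have g: "gr V E" using s by (simp add: sparse5_def)
  have fin: "finite V" "finite E" using grD[OF g] by blast+
  have step: "\<exists>S'\<subseteq>V - X. 7 * card S' \<le> card (del E X) \<and> degen 2 (V - X - S') (del E X)"
    if "X \<subseteq> V" "X \<noteq> {}" for X
  proof (rule less.hyps)
    show "card (V - X) < card V" using that fin by (intro psubset_card_mono) auto
    show "sparse5 (V - X) (del E X)"
      by (rule sparse5_mono[OF s]) (use grD(4)[OF g] in \<open>auto simp: del_def\<close>)
  qed
  have ext: "\<exists>v\<in>U. card {e \<in> E. e \<subseteq> U \<and> v \<in> e} \<le> 2"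
    if "degen 2 W (del E X)" "U \<subseteq> W" "U \<inter> X = {}" "U \<noteq> {}" for U W X
  proof -
    have "{e \<in> del E X. e \<subseteq> U \<and> v \<in> e} = {e \<in> E. e \<subseteq> U \<and> v \<in> e}" for v
      using that(3) by (auto simp: del_def)
    moreover have "\<exists>v\<in>U. card {e \<in> del E X. e \<subseteq> U \<and> v \<in> e} \<le> 2"
      using that(1,2,4) unfolding degen_def by blast
    ultimately show ?thesis by (simp only:)
  qed
  consider "V = {}" | v where "v \<in> V" "deg E v \<le> 2" | "V \<noteq> {}" "\<And>v. v \<in> V \<Longrightarrow> 3 \<le> deg E v"
    by (metis not_less_eq_eq numeral_2_eq_2 numeral_3_eq_3)
  then show ?case
  proof cases
    case 1
    then show ?thesis by (intro exI[of _ "{}"]) (simp add: degen_def)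
  next
    case 2
    obtain S where S: "S \<subseteq> V - {v}" "7 * card S \<le> card (del E {v})" "degen 2 (V - {v} - S) (del E {v})"
      using step[of "{v}"] 2(1) by blast
    have "card (del E {v}) \<le> card E" by (rule card_mono[OF fin(2) del_subset])
    moreover have "degen 2 (V - S) E"
      unfolding degen_def
    proof (intro allI impI)
      fix U assume U: "U \<subseteq> V - S" "U \<noteq> {}"
      show "\<exists>w\<in>U. card {e \<in> E. e \<subseteq> U \<and> w \<in> e} \<le> 2"
      proof (cases "v \<in> U")
        case True
        have "card {e \<in> E. e \<subseteq> U \<and> v \<in> e} \<le> deg E v"
          unfolding deg_def using fin by (intro card_mono) auto
        then show ?thesis using 2(2) True by (meson order_trans)
      next
        case False
        then show ?thesis using U by (intro ext[OF S(3)]) auto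
      qed
    qed
    ultimately show ?thesis using S by (intro exI[of _ S]) auto
  next
    case 3
    obtain v T where v: "v \<in> V" and T: "T \<subseteq> {u \<in> V. deg E u = 3 \<and> {v, u} \<in> E}"
      "card T = 2 \<or> card T = 1 \<and> 5 \<le> deg E v" using heavy_star_exists[OF s 3] by blast
    have vT: "v \<notin> T" using T(1) grD(6)[OF g] by blast
    obtain S where S: "S \<subseteq> V - insert v T" "7 * card S \<le> card (del E (insert v T))"
      "degen 2 (V - insert v T - S) (del E (insert v T))"
      using step[of "insert v T"] v T(1) by blast
    have fS: "finite S" "v \<notin> S" using S(1) fin finite_subset by auto
    let ?X = "{e \<in> E. e \<inter> insert v T \<noteq> {}}"
    let ?st = "\<lambda>a. {e \<in> E. a \<in> e}"
    have fst: "finite (?st a)" for a using fin by simp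
    \<comment> \<open>Three degrees of at least 3 with at most two shared edges give 9 - 2, because
      \<open>a\<close> and \<open>b\<close> are not adjacent; degrees of at least 5 and 3 with at
      most one shared edge give 8 - 1.\<close>
    have "7 \<le> card ?X"
    proof (cases "card T = 2")
      case True
      then obtain a b where ab: "T = {a, b}" "a \<noteq> b" using True unfolding card_2_iff by blast
      have nab: "{a, b} \<notin> E" using T(1) ab sparse5_triangle_free[OF s, of v a b] by auto
      have dd: "card (?st a) = 3" "card (?st b) = 3" "3 \<le> card (?st v)"
        using T(1) ab 3(2)[OF v] by (auto simp: deg_def)
      have "card (?st v \<inter> ?st a) \<le> 1" "card (?st v \<inter> ?st b) \<le> 1" "card (?st a \<inter> ?st b) = 0"
        using card_star_edges[OF g, of v a] card_star_edges[OF g, of v b] card_star_edges[OF g, of a b] vT ab nab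
        by (auto split: if_splits)
      moreover have "card ((?st v \<union> ?st a) \<inter> ?st b) \<le> card (?st v \<inter> ?st b) + card (?st a \<inter> ?st b)"
        unfolding Int_Un_distrib2 by (rule card_Un_le)
      moreover have "card (?st v) + card (?st a) = card (?st v \<union> ?st a) + card (?st v \<inter> ?st a)"
        by (rule card_Un_Int) (use fst in auto)
      moreover have "card (?st v \<union> ?st a) + card (?st b) = card (?st v \<union> ?st a \<union> ?st b) + card ((?st v \<union> ?st a) \<inter> ?st b)"
        by (rule card_Un_Int) (use fst in auto)
      moreover have "?X = ?st v \<union> ?st a \<union> ?st b" using ab by auto
      ultimately show ?thesis using dd by simp
    next
      case False
      then obtain a where a: "T = {a}" "5 \<le> deg E v" using T(2) card_1_singletonE by metis
      have dd: "card (?st a) = 3" "5 \<le> card (?st v)" using T(1) a by (auto simp: deg_def)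
      have "card (?st v \<inter> ?st a) \<le> 1"
        using card_star_edges[OF g, of v a] vT a by (auto split: if_splits)
      moreover have "card (?st v) + card (?st a) = card (?st v \<union> ?st a) + card (?st v \<inter> ?st a)"
        by (rule card_Un_Int) (use fst in auto)
      moreover have "?X = ?st v \<union> ?st a" using a by auto
      ultimately show ?thesis using dd by simp
    qed
    moreover have "card (del E (insert v T)) + card ?X = card E"
    proof -
      have "card (del E (insert v T) \<union> ?X) = card (del E (insert v T)) + card ?X"
        using fin by (intro card_Un_disjoint) (auto simp: del_def)
      moreover have "del E (insert v T) \<union> ?X = E" by (auto simp: del_def)
      ultimately show ?thesis by simp
    qed
    ultimately have "7 * card (insert v S) \<le> card E" using S(2) fS by simp
    moreover have "degen 2 (V - insert v S) E"
      unfolding degen_def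
    proof (intro allI impI)
      fix U assume U: "U \<subseteq> V - insert v S" "U \<noteq> {}"
      show "\<exists>w\<in>U. card {e \<in> E. e \<subseteq> U \<and> w \<in> e} \<le> 2"
      proof (cases "U \<inter> T = {}")
        case True
        then show ?thesis using U by (intro ext[OF S(3)]) auto
      next
        case False
        then obtain u where u: "u \<in> U" "u \<in> T" by blast
        have "{e \<in> E. e \<subseteq> U \<and> u \<in> e} \<subseteq> ?st u - {{v, u}}" using U(1) by auto
        then have "card {e \<in> E. e \<subseteq> U \<and> u \<in> e} \<le> card (?st u - {{v, u}})"
          using fst by (intro card_mono) auto
        also have "\<dots> = 2"
        proof -
          have "{v, u} \<in> ?st u" "card (?st u) = 3" using T(1) u(2) by (auto simp: deg_def)
          then show ?thesis using fst[of u] by (simp add: card_Diff_singleton)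
        qed
        finally show ?thesis using u(1) by blast
      qed
    qed
    ultimately show ?thesis using S(1) v by (intro exI[of _ "insert v S"]) auto
  qed
qed

section \<open>Plane drawings\<close>

text \<open>An arc is homeomorphic to an interval, so an open plane set inside it would embed into
  the line, against invariance of dimension.\<close>

lemma arc_image_no_interior:
  fixes c :: "real \<Rightarrow> complex"
  assumes "arc c" "open U" "U \<noteq> {}"
  shows "\<not> U \<subseteq> path_image c"
proof
  assume U: "U \<subseteq> path_image c"
  have "path_image c homeomorphic {0..1::real}" by (rule homeomorphic_arc_image_interval[OF assms(1)]) simp
  then obtain f h where fh: "homeomorphism (path_image c) {0..1::real} f h"
    unfolding homeomorphic_def by blast
  have "continuous_on U f" using fh U unfolding homeomorphism_def by (meson continuous_on_subset)
  moreover have "inj_on f U"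
  proof (rule inj_on_inverseI)
    show "h (f x) = x" if "x \<in> U" for x using fh U that unfolding homeomorphism_def by blast
  qed
  ultimately have "DIM(complex) \<le> DIM(real)" using assms(2,3) by (intro invariance_of_dimension)
  then show False by simp
qed

locale drawing =
  fixes V :: "'a set" and E :: "'a set set" and p :: "'a \<Rightarrow> complex" and \<gamma> :: "'a set \<Rightarrow> real \<Rightarrow> complex"
  assumes g: "gr V E" and pd: "plane_drawing (V, E) p \<gamma>"
begin

abbreviation img :: "'a set \<Rightarrow> complex set" where
  "img e \<equiv> path_image (\<gamma> e)"

text \<open>The complement of \<open>K F\<close> has the faces of \<open>F\<close> as its
  components. All vertices belong to \<open>K F\<close>, whatever \<open>F\<close> is, so that a
  further edge meets \<open>K F\<close> exactly in its two ends.\<close>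

definition K :: "'a set set \<Rightarrow> complex set" where
  "K F = p ` V \<union> (\<Union>e\<in>F. img e)"

abbreviation linked :: "'a set set \<Rightarrow> complex \<Rightarrow> complex \<Rightarrow> bool" where
  "linked F \<equiv> connected_component (- K F)"

lemma inj_p: "inj_on p V"
  using pd by (simp add: plane_drawing_def)

lemma arc_e: "e \<in> E \<Longrightarrow> arc (\<gamma> e)"
  using pd by (simp add: plane_drawing_def)

lemma ends_e: "e \<in> E \<Longrightarrow> {pathstart (\<gamma> e), pathfinish (\<gamma> e)} = p ` e"
  using pd by (simp add: plane_drawing_def)

lemma ends_in_img: "e \<in> E \<Longrightarrow> p ` e \<subseteq> img e"
  using ends_e[of e, symmetric] by (simp add: pathstart_in_path_image pathfinish_in_path_image)

lemma img_vertex: "e \<in> E \<Longrightarrow> q \<in> img e \<Longrightarrow> q \<in> p ` V \<Longrightarrow> q \<in> p ` e"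
  using pd unfolding plane_drawing_def by auto

lemma img_img: "e \<in> E \<Longrightarrow> f \<in> E \<Longrightarrow> f \<noteq> e \<Longrightarrow> q \<in> img e \<Longrightarrow> q \<in> img f \<Longrightarrow> q \<in> p ` e"
proof -
  have "\<forall>e\<in>E. \<forall>f\<in>E. f \<noteq> e \<longrightarrow> (img e - p ` e) \<inter> img f = {}"
    using pd by (simp add: plane_drawing_def)
  then show "e \<in> E \<Longrightarrow> f \<in> E \<Longrightarrow> f \<noteq> e \<Longrightarrow> q \<in> img e \<Longrightarrow> q \<in> img f \<Longrightarrow> q \<in> p ` e"
    by blast
qed

lemma compact_K:
  assumes "F \<subseteq> E"
  shows "compact (K F)"
proof -
  have "finite F" using grD(2)[OF g] assms finite_subset by blast
  moreover have "compact (img e)" if "e \<in> F" for e using arc_e that assms compact_arc_image by blast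
  ultimately have "compact (\<Union>e\<in>F. img e)" by (intro compact_UN) auto
  moreover have "compact (p ` V)" using grD(1)[OF g] by (intro finite_imp_compact) simp
  ultimately show ?thesis unfolding K_def by (intro compact_Un)
qed

lemma open_compl_K: "F \<subseteq> E \<Longrightarrow> open (- K F)"
  using compact_K compact_imp_closed open_Compl by blast

lemma K_mono: "F \<subseteq> F' \<Longrightarrow> K F \<subseteq> K F'"
  by (auto simp: K_def)

lemma K_insert: "K (insert e F) = img e \<union> K F"
  by (auto simp: K_def)

lemma img_Int_K:
  assumes "e \<in> E" "F \<subseteq> E" "e \<notin> F"
  shows "img e \<inter> K F = p ` e"
proof
  show "img e \<inter> K F \<subseteq> p ` e"
  proof
    fix q assume q: "q \<in> img e \<inter> K F"
    show "q \<in> p ` e"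
    proof (cases "q \<in> p ` V")
      case True
      then show ?thesis using img_vertex[OF assms(1)] q by blast
    next
      case False
      then obtain f where f: "f \<in> F" "q \<in> img f" using q by (auto simp: K_def)
      then have "f \<in> E" "f \<noteq> e" using assms by blast+
      then show ?thesis using img_img[OF assms(1)] f(2) q by blast
    qed
  qed
  show "p ` e \<subseteq> img e \<inter> K F"
    using ends_in_img[OF assms(1)] grD(4)[OF g assms(1)] by (auto simp: K_def)
qed

lemma img_interior_connected: "e \<in> E \<Longrightarrow> connected (img e - p ` e)"
  using connected_simple_path_endless[OF arc_imp_simple_path[OF arc_e]] ends_e by metis

lemma img_interior_ne:
  assumes "e \<in> E"
  shows "img e - p ` e \<noteq> {}"
proof
  assume "img e - p ` e = {}"
  moreover have "finite (p ` e)" using grD(5)[OF g assms] by (metis card.infinite finite_imageI zero_neq_numeral)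
  ultimately have "finite (img e)" by (metis Diff_eq_empty_iff finite_subset)
  moreover have "infinite (img e)"
  proof
    assume f: "finite (img e)"
    have "inj_on (\<gamma> e) {0..1}" using arc_e[OF assms] by (simp add: arc_def)
    then have "finite {0..1::real}" using f unfolding path_image_def by (rule finite_imageD[rotated])
    then show False using infinite_Icc[of 0 "1::real"] by simp
  qed
  ultimately show False by blast
qed

lemma path_component_conn:
  assumes "F \<subseteq> E" "conn F u v" "u \<in> V"
  shows "path_component (K F) (p u) (p v)"
  using assms(2) unfolding conn_def
proof (induction rule: rtrancl_induct)
  case base
  then show ?case using assms(3) by (intro path_component_refl) (simp add: K_def)
next
  case (step a b)
  then have e: "{a, b} \<in> F" by simp
  then have eE: "{a, b} \<in> E" using assms(1) by blast
  have "path_connected (img {a, b})" using arc_e[OF eE] by (intro path_connected_path_image arc_imp_path)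
  moreover have "p a \<in> img {a, b}" "p b \<in> img {a, b}" using ends_in_img[OF eE] by auto
  ultimately have "path_component (img {a, b}) (p a) (p b)" unfolding path_connected_component by blast
  then have "path_component (K F) (p a) (p b)"
    by (rule path_component_of_subset[rotated]) (use e in \<open>auto simp: K_def\<close>)
  then show ?case using step.IH path_component_trans by blast
qed

text \<open>Janiszewski's theorem, applied once for each of the two sides of the bridge.\<close>

lemma bridge_no_separation:
  assumes e: "{u, v} \<in> E" "{u, v} \<notin> F" and F: "F \<subseteq> E" and nc: "\<not> conn F u v"
    and cc: "linked F x y" and xy: "x \<notin> img {u, v}" "y \<notin> img {u, v}"
  shows "linked (insert {u, v} F) x y"
proof -
  define A where "A = {w \<in> V. conn F u w}"
  have uv: "u \<in> V" "v \<in> V" "u \<in> A" "v \<in> V - A" using grD(6)[OF g e(1)] nc by (auto simp: A_def)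
  define K1 where "K1 = p ` A \<union> (\<Union>f\<in>{f \<in> F. f \<subseteq> A}. img f)"
  define K2 where "K2 = p ` (V - A) \<union> (\<Union>f\<in>{f \<in> F. f \<subseteq> V - A}. img f)"
  have side: "f \<subseteq> A \<or> f \<subseteq> V - A" if f: "f \<in> F" for f
  proof -
    have "f \<in> E" using f F by blast
    then obtain a b where ab: "f = {a, b}" "a \<in> V" "b \<in> V" using gr_edge[OF g] by metis
    have "conn F a b" using f ab(1) by (intro conn_edge) simp
    then have "conn F u a \<longleftrightarrow> conn F u b" using conn_trans conn_sym by metis
    then show ?thesis using ab by (auto simp: A_def)
  qed
  have K12: "K F = K1 \<union> K2"
  proof -
    have "A \<subseteq> V" by (auto simp: A_def)
    then have eq1: "p ` V = p ` A \<union> p ` (V - A)" by blast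
    have eq2: "(\<Union>f\<in>F. img f) = (\<Union>f\<in>{f \<in> F. f \<subseteq> A}. img f) \<union> (\<Union>f\<in>{f \<in> F. f \<subseteq> V - A}. img f)"
      using side by blast
    show ?thesis unfolding K_def K1_def K2_def eq2 by (subst eq1) (simp only: Un_ac)
  qed
  have fin: "finite F" using grD(2)[OF g] F finite_subset by blast
  have cA: "compact (p ` A)" "compact (p ` (V - A))"
    using grD(1)[OF g] by (auto simp: A_def intro: finite_imp_compact)
  have cU: "compact (\<Union>f\<in>{f \<in> F. f \<subseteq> X}. img f)" for X
    using fin F arc_e compact_arc_image by (intro compact_UN) auto
  have c1: "compact K1" "compact K2" unfolding K1_def K2_def using cA cU by (auto intro: compact_Un)
  have i1: "img f \<inter> p ` B \<subseteq> p ` (f \<inter> B)" if "f \<in> E" "B \<subseteq> V" for f B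
  proof
    fix q assume q: "q \<in> img f \<inter> p ` B"
    then obtain w where w: "w \<in> B" "q = p w" by blast
    then have "p w \<in> p ` f" using img_vertex[OF that(1), of q] q that(2) by blast
    then obtain w' where "w' \<in> f" "p w = p w'" by blast
    then have "w = w'" using inj_onD[OF inj_p, of w w'] w that grD(4)[OF g that(1)] by blast
    then show "q \<in> p ` (f \<inter> B)" using w \<open>w' \<in> f\<close> by blast
  qed
  have eK: "img {u, v} \<inter> (p ` B \<union> (\<Union>f\<in>{f \<in> F. f \<subseteq> B}. img f)) = p ` ({u, v} \<inter> B)" if B: "B \<subseteq> V" for B
  proof
    show "img {u, v} \<inter> (p ` B \<union> (\<Union>f\<in>{f \<in> F. f \<subseteq> B}. img f)) \<subseteq> p ` ({u, v} \<inter> B)"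
    proof
      fix q assume q: "q \<in> img {u, v} \<inter> (p ` B \<union> (\<Union>f\<in>{f \<in> F. f \<subseteq> B}. img f))"
      have "q \<in> p ` B"
      proof (cases "q \<in> p ` B")
        case False
        then obtain f where f: "f \<in> F" "f \<subseteq> B" "q \<in> img f" using q by blast
        have "q \<in> p ` f" using img_img[of f "{u, v}" q] f F e q by blast
        then show ?thesis using f(2) by blast
      qed
      then show "q \<in> p ` ({u, v} \<inter> B)" using i1[OF e(1) B] q by blast
    qed
    show "p ` ({u, v} \<inter> B) \<subseteq> img {u, v} \<inter> (p ` B \<union> (\<Union>f\<in>{f \<in> F. f \<subseteq> B}. img f))"
      using ends_in_img[OF e(1)] by blast
  qed
  have e1: "img {u, v} \<inter> K1 = {p u}"
  proof -
    have "{u, v} \<inter> A = {u}" using uv by blast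
    then show ?thesis unfolding K1_def using eK[of A] by (simp add: A_def)
  qed
  have e2: "img {u, v} \<inter> K2 = {p v}"
  proof -
    have "{u, v} \<inter> (V - A) = {v}" using uv by blast
    then show ?thesis unfolding K2_def using eK[of "V - A"] by simp
  qed
  have dis: "K1 \<inter> K2 = {}"
  proof (rule ccontr)
    assume "K1 \<inter> K2 \<noteq> {}"
    then obtain q where q: "q \<in> K1" "q \<in> K2" by blast
    have AV: "A \<subseteq> V" "V - A \<subseteq> V" by (auto simp: A_def)
    have pA: "p ` A \<inter> p ` (V - A) = {}"
      using inj_on_image_Int[OF inj_p AV] by simp
    have q1: "q \<in> p ` A \<or> (\<exists>f\<in>F. f \<subseteq> A \<and> q \<in> img f)" using q(1) unfolding K1_def by blast
    have q2: "q \<in> p ` (V - A) \<or> (\<exists>f\<in>F. f \<subseteq> V - A \<and> q \<in> img f)" using q(2) unfolding K2_def by blast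
    show False
      using q1
    proof
      assume a: "q \<in> p ` A"
      from q2 show False
      proof
        assume "q \<in> p ` (V - A)"
        then show False using a pA by blast
      next
        assume "\<exists>f\<in>F. f \<subseteq> V - A \<and> q \<in> img f"
        then obtain f where f: "f \<in> F" "f \<subseteq> V - A" "q \<in> img f" by blast
        have "f \<in> E" using f(1) F by blast
        have "q \<in> p ` (f \<inter> A)" using i1[OF \<open>f \<in> E\<close> AV(1)] f(3) a by blast
        then show False using f(2) by blast
      qed
    next
      assume "\<exists>f\<in>F. f \<subseteq> A \<and> q \<in> img f"
      then obtain f where f: "f \<in> F" "f \<subseteq> A" "q \<in> img f" by blast
      have fE: "f \<in> E" using f(1) F by blast
      from q2 show False
      proof
        assume "q \<in> p ` (V - A)"
        then have "q \<in> p ` (f \<inter> (V - A))" using i1[OF fE AV(2)] f(3) by blast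
        then show False using f(2) by blast
      next
        assume "\<exists>f\<in>F. f \<subseteq> V - A \<and> q \<in> img f"
        then obtain h where h: "h \<in> F" "h \<subseteq> V - A" "q \<in> img h" by blast
        have hE: "h \<in> E" using h(1) F by blast
        have "f \<noteq> {}" using grD(5)[OF g fE] by auto
        then have "f \<noteq> h" using f(2) h(2) by blast
        then have "q \<in> p ` f" "q \<in> p ` h"
          using img_img[OF fE hE _ f(3) h(3)] img_img[OF hE fE _ h(3) f(3)] by auto
        then show False using f(2) h(2) pA by blast
      qed
    qed
  qed
  have "connected (- img {u, v})" using arc_e[OF e(1)] by (intro connected_arc_complement) simp_all
  then have cce: "connected_component (- img {u, v}) x y"
    using xy unfolding connected_iff_connected_component by blast
  have cc1: "connected_component (- K1) x y" "connected_component (- K2) x y"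
    using cc K12 by (auto intro: connected_component_of_subset)
  have ce: "compact (img {u, v})" using arc_e[OF e(1)] by (rule compact_arc_image)
  \<comment> \<open>Janiszewski's theorem asks for a connected intersection: the edge meets
    \<open>K1\<close> in one point, and the union of both meets \<open>K2\<close> in one
    point.\<close>
  have s1: "connected_component (- (img {u, v} \<union> K1)) x y"
    using c1 by (intro Janiszewski[OF ce _ _ cce cc1(1)]) (auto simp: e1 compact_imp_closed)
  have "(img {u, v} \<union> K1) \<inter> K2 = {p v}" using e2 dis by blast
  then have "connected_component (- ((img {u, v} \<union> K1) \<union> K2)) x y"
    using c1 ce by (intro Janiszewski[OF _ _ _ s1 cc1(2)]) (auto simp: compact_imp_closed)
  moreover have "(img {u, v} \<union> K1) \<union> K2 = K (insert {u, v} F)" unfolding K_insert K12 by blast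
  ultimately show ?thesis by simp
qed

text \<open>A path in \<open>K F\<close> between the ends of the edge, reduced to an arc, closes the
  edge up to a Jordan curve \<open>J\<close>. As \<open>J\<close> meets \<open>K F\<close> in that
  arc only, a connected set, Janiszewski's theorem shows that the new edge does not separate points
  of one face of \<open>F\<close> that lie on the same side of \<open>J\<close>.\<close>

lemma nonbridge_curve:
  assumes e: "{u, v} \<in> E" "{u, v} \<notin> F" and F: "F \<subseteq> E" and c: "conn F u v"
  obtains J I O' where "open I" "open O'" "connected I" "connected O'" "I \<inter> O' = {}" "I \<union> O' = - J"
    "frontier I = J" "frontier O' = J" "img {u, v} \<subseteq> J" "J \<subseteq> K (insert {u, v} F)"
    "\<forall>x y. linked F x y \<longrightarrow> x \<in> I \<and> y \<in> I \<or> x \<in> O' \<and> y \<in> O' \<longrightarrow>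
      linked (insert {u, v} F) x y"
proof -
  have uv: "u \<in> V" "v \<in> V" "u \<noteq> v" using grD(6)[OF g e(1)] by auto
  have puv: "p u \<noteq> p v" using inj_onD[OF inj_p] uv by blast
  obtain h0 where h0: "path h0" "path_image h0 \<subseteq> K F" "pathstart h0 = p u" "pathfinish h0 = p v"
    using path_component_conn[OF F c uv(1)] unfolding path_component_def by blast
  obtain h where h: "arc h" "path_image h \<subseteq> path_image h0" "pathstart h = p u" "pathfinish h = p v"
    using path_contains_arc[OF h0(1,3,4) puv] by blast
  have hK: "path_image h \<subseteq> K F" using h(2) h0(2) by blast
  have ends: "{pathstart (\<gamma> {u, v}), pathfinish (\<gamma> {u, v})} = {p u, p v}" using ends_e[OF e(1)] by simp
  obtain a where a: "arc a" "pathstart a = p v" "pathfinish a = p u" "path_image a = img {u, v}"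
  proof (cases "pathstart (\<gamma> {u, v}) = p v")
    case True
    then have "pathfinish (\<gamma> {u, v}) = p u" using ends puv by (auto simp: doubleton_eq_iff)
    then show ?thesis using that[of "\<gamma> {u, v}"] arc_e[OF e(1)] True by blast
  next
    case False
    then have "pathstart (\<gamma> {u, v}) = p u" "pathfinish (\<gamma> {u, v}) = p v"
      using ends puv by (auto simp: doubleton_eq_iff)
    then show ?thesis using that[of "reversepath (\<gamma> {u, v})"] arc_e[OF e(1)] by (simp add: arc_reversepath)
  qed
  define j where "j = h +++ a"
  have int: "path_image h \<inter> img {u, v} \<subseteq> {p u, p v}"
    using img_Int_K[OF e(1) F e(2)] hK by auto
  have sj: "simple_path j"
    unfolding j_def using a h int by (intro simple_path_join_loop) auto
  have jl: "pathfinish j = pathstart j" unfolding j_def using a h by simp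
  have ji: "path_image j = path_image h \<union> img {u, v}"
    unfolding j_def using a h by (simp add: path_image_join)
  let ?J = "path_image j"
  note JIO = Jordan_inside_outside[OF sj jl]
  have sep: "linked (insert {u, v} F) x y"
    if cc: "linked F x y" and io: "x \<in> inside ?J \<and> y \<in> inside ?J \<or> x \<in> outside ?J \<and> y \<in> outside ?J" for x y
  proof -
    have "inside ?J \<subseteq> - ?J" "outside ?J \<subseteq> - ?J" using JIO by blast+
    then have ccJ: "connected_component (- ?J) x y"
      using io JIO unfolding connected_component_def by blast
    have "?J \<inter> K F = path_image h"
    proof -
      have "img {u, v} \<inter> K F \<subseteq> path_image h"
        using img_Int_K[OF e(1) F e(2)] h(3,4) pathstart_in_path_image[of h] pathfinish_in_path_image[of h] by auto
      then show ?thesis using hK ji by blast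
    qed
    then have "connected (?J \<inter> K F)" using h(1) by (simp add: connected_arc_image)
    moreover have "compact ?J" using sj by (rule compact_simple_path_image)
    moreover have "closed (K F)" using compact_K[OF F] by (rule compact_imp_closed)
    ultimately have "connected_component (- (?J \<union> K F)) x y" using Janiszewski ccJ cc by blast
    moreover have "?J \<union> K F = K (insert {u, v} F)" unfolding K_insert ji using hK by blast
    ultimately show ?thesis by simp
  qed
  show thesis
  proof (rule that[of "inside ?J" "outside ?J" ?J])
    show "?J \<subseteq> K (insert {u, v} F)" unfolding K_insert ji using hK by blast
    show "\<forall>x y. linked F x y \<longrightarrow>
        x \<in> inside ?J \<and> y \<in> inside ?J \<or> x \<in> outside ?J \<and> y \<in> outside ?J \<longrightarrow>
        linked (insert {u, v} F) x y"
      using sep by blast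
  qed (use JIO ji in blast)+
qed

text \<open>The edges are inserted one at a time. Each is a bridge when it arrives, as otherwise it
  would carry a flow, and a bridge separates nothing.\<close>

lemma forest_complement_connected:
  assumes "F \<subseteq> E" "beta F = 0"
  shows "connected (- K F)"
proof -
  have "finite F" using grD(2)[OF g] assms(1) finite_subset by blast
  then show ?thesis
    using assms
  proof (induction F)
    case empty
    have "connected (UNIV - p ` V)"
      using grD(1)[OF g] by (intro connected_open_delete_finite) auto
    then show ?case by (simp add: K_def Compl_eq_Diff_UNIV)
  next
    case (insert e F)
    have eE: "e \<in> E" "F \<subseteq> E" using insert.prems by auto
    have gi: "gr V (insert e F)" using gr_subset[OF g insert.prems(1)] .
    obtain u v where uv: "e = {u, v}" using gr_edge[OF g eE(1)] by metis
    have "beta F = 0" using beta_mono[OF gi, of F] insert.prems(2) by auto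
    then have IH: "connected (- K F)" using insert.IH eE(2) by blast
    have nc: "\<not> conn F u v"
    proof
      assume "conn F u v"
      then have "conn (insert e F - {{u, v}}) u v" using insert.hyps uv by simp
      moreover have "{u, v} \<in> insert e F" using uv by simp
      ultimately obtain y where y: "y \<in> cyc (insert e F)" "y u v = 1" using nonbridge_flow[OF gi] by blast
      have "\<forall>y\<in>cyc (insert e F). \<forall>u v. y u v = 0" using beta_eq_0_iff[OF gi] insert.prems(2) by simp
      then have "y u v = 0" using y(1) by blast
      then show False using y(2) by simp
    qed
    show ?case
      unfolding connected_iff_connected_component
    proof (intro ballI)
      fix x y assume xy: "x \<in> - K (insert e F)" "y \<in> - K (insert e F)"
      then have xy': "x \<in> - K F" "y \<in> - K F" "x \<notin> img e" "y \<notin> img e" by (auto simp: K_insert)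
      have "linked F x y"
        using IH xy' unfolding connected_iff_connected_component by blast
      then show "linked (insert e F) x y"
        unfolding uv using eE insert.hyps(2) xy' nc unfolding uv by (intro bridge_no_separation) auto
    qed
  qed
qed

text \<open>Faces are open, so no arc can cover one; a representative of a face can therefore be
  moved off a new edge.\<close>

lemma perturb:
  assumes F: "F \<subseteq> E" and e: "e \<in> E" and x: "x \<in> - K F"
  shows "\<exists>x'. linked F x x' \<and> x' \<notin> img e"
proof -
  have "open (connected_component_set (- K F) x)" by (rule open_connected_component[OF open_compl_K[OF F]])
  moreover have "connected_component_set (- K F) x \<noteq> {}"
    using x connected_component_eq_empty[of "- K F" x] by blast
  ultimately have "\<not> connected_component_set (- K F) x \<subseteq> img e"
    by (rule arc_image_no_interior[OF arc_e[OF e]])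
  then show ?thesis by blast
qed

text \<open>The set \<open>P\<close> holds representatives of distinct faces. A bridge does not
  change \<open>beta\<close>, and once the points are moved off it they remain in distinct faces.
  Any other edge raises \<open>beta\<close> by at most one and cuts the face that contains its
  interior into at least two.\<close>

lemma many_faces:
  assumes "F \<subseteq> E"
  shows "\<exists>P. finite P \<and> beta F + 1 \<le> card P \<and> P \<subseteq> - K F \<and>
    (\<forall>x\<in>P. \<forall>y\<in>P. linked F x y \<longrightarrow> x = y)"
proof -
  have "finite F" using grD(2)[OF g] assms(1) finite_subset by blast
  then show ?thesis
    using assms
  proof (induction F)
    case empty
    have "finite (p ` V)" using grD(1)[OF g] by simp
    then obtain x where "x \<notin> p ` V" using ex_new_if_finite[OF infinite_UNIV_char_0] by blast
    then show ?case by (intro exI[of _ "{x}"]) (simp add: K_def)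
  next
    case (insert e F)
    have eE: "e \<in> E" "F \<subseteq> E" using insert.prems by auto
    have gi: "gr V (insert e F)" using gr_subset[OF g insert.prems] .
    obtain u v where uv: "e = {u, v}" using gr_edge[OF g eE(1)] by metis
    have del: "insert e F - {{u, v}} = F" using insert.hyps(2) uv by simp
    obtain P where P: "finite P" "beta F + 1 \<le> card P" "P \<subseteq> - K F"
      "\<forall>x\<in>P. \<forall>y\<in>P. linked F x y \<longrightarrow> x = y" using insert.IH[OF eE(2)] by blast
    have "\<forall>x\<in>P. \<exists>x'. linked F x x' \<and> x' \<notin> img e"
      using perturb[OF eE(2,1)] P(3) by blast
    then obtain f where f: "\<forall>x\<in>P. linked F x (f x) \<and> f x \<notin> img e"
      unfolding bchoice_iff by (rule exE)
    define Q where "Q = f ` P"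
    have fsep: "x = y" if "x \<in> P" "y \<in> P" "linked F (f x) (f y)" for x y
    proof -
      have "linked F x y"
        using f that connected_component_trans connected_component_sym by metis
      then show ?thesis using P(4) that by blast
    qed
    have fm: "f x \<in> - K (insert e F)" if "x \<in> P" for x
      using f that connected_component_in[of "- K F" x "f x"] by (auto simp: K_insert)
    have injf: "inj_on f P"
    proof (rule inj_onI)
      fix x y assume xy: "x \<in> P" "y \<in> P" "f x = f y"
      have "f x \<in> - K F" using fm[OF xy(1)] K_mono[of F "insert e F"] by blast
      then show "x = y" using fsep[OF xy(1,2)] xy(3) by simp
    qed
    have Q: "finite Q" "beta F + 1 \<le> card Q" "Q \<subseteq> - K (insert e F)"
      "\<And>x y. x \<in> Q \<Longrightarrow> y \<in> Q \<Longrightarrow> linked F x y \<Longrightarrow> x = y"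
      using P(1,2) fm fsep by (auto simp: Q_def card_image[OF injf])
    have sub: "linked F x y" if "linked (insert e F) x y" for x y
      using that by (rule connected_component_of_subset) (auto simp: K_insert)
    show ?case
    proof (cases "conn F u v")
      case False
      have "beta (insert e F) = beta F"
      proof -
        have m: "{u, v} \<in> insert e F" using uv by simp
        have "y u v = 0" if "y \<in> cyc (insert e F)" for y
          using bridge_flow_zero[OF gi m _ that] False del by simp
        then have "cyc (insert e F - {{u, v}}) = cyc (insert e F)" by (rule cyc_delete_eq[OF gi])
        then show ?thesis by (simp add: beta_def del)
      qed
      then show ?thesis using Q sub by (intro exI[of _ Q]) auto
    next
      case True
      have e': "{u, v} \<in> E" "{u, v} \<notin> F" using eE(1) insert.hyps(2) uv by auto
      obtain J I O' where J: "open I" "open O'" "connected I" "connected O'" "I \<inter> O' = {}" "I \<union> O' = - J"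
        "frontier I = J" "frontier O' = J" "img {u, v} \<subseteq> J" "J \<subseteq> K (insert {u, v} F)"
        by (rule nonbridge_curve[OF e' eE(2) True])
      \<comment> \<open>The point \<open>x0\<close> lies on the common frontier of both sides of
        \<open>J\<close>, so the face of \<open>F\<close> around it reaches both sides;
        \<open>a\<close> and \<open>b\<close> are taken there, one on each side.\<close>
      obtain x0 where x0: "x0 \<in> img e - p ` e" using img_interior_ne[OF eE(1)] by blast
      have x0F: "x0 \<in> - K F" using x0 img_Int_K[OF eE insert.hyps(2)] by blast
      define U where "U = connected_component_set (- K F) x0"
      have U: "open U" "x0 \<in> U" "U \<subseteq> - K F"
        unfolding U_def using open_connected_component[OF open_compl_K[OF eE(2)]] x0F
          connected_component_subset by auto
      have "x0 \<in> frontier I" "x0 \<in> frontier O'" using x0 J(7,8,9) uv by auto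
      then have "x0 \<in> closure I" "x0 \<in> closure O'" by (auto simp: frontier_def)
      then obtain a b where ab: "a \<in> U" "a \<in> I" "b \<in> U" "b \<in> O'"
        using U(1,2) open_Int_closure_eq_empty[OF U(1), of I] open_Int_closure_eq_empty[OF U(1), of O'] by blast
      have abK: "a \<in> - K (insert e F)" "b \<in> - K (insert e F)"
      proof -
        have "a \<notin> J" "b \<notin> J" using ab(2,4) J(6) by blast+
        then show "a \<in> - K (insert e F)" "b \<in> - K (insert e F)"
          using ab(1,3) U(3) J(9) uv by (auto simp: K_insert)
      qed
      have nab: "\<not> linked (insert e F) a b"
      proof
        assume "linked (insert e F) a b"
        then obtain T where T: "connected T" "T \<subseteq> - K (insert e F)" "a \<in> T" "b \<in> T"
          unfolding connected_component_def by blast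
        have "T \<subseteq> I \<union> O'" using T(2) J(6,10) uv by blast
        then show False using T ab J(1,2,5) unfolding connected_def by blast
      qed
      \<comment> \<open>At most one representative lies in the face being cut. It is dropped in
        favour of \<open>a\<close> and \<open>b\<close>, a net gain of at least one.\<close>
      define Q' where "Q' = {x \<in> Q. \<not> linked F x0 x}"
      have Qrem: "card Q \<le> card Q' + 1"
      proof -
        have "card (Q - Q') \<le> 1"
        proof -
          have "\<forall>x\<in>Q - Q'. \<forall>y\<in>Q - Q'. x = y"
            using Q(4) connected_component_trans connected_component_sym unfolding Q'_def by blast
          then show ?thesis using Q(1) card_le_Suc0_iff_eq[of "Q - Q'"] by simp
        qed
        moreover have "card Q = card Q' + card (Q - Q')"
          using Q(1) card_Un_disjoint[of Q' "Q - Q'"] by (simp add: Q'_def Un_absorb1 Diff_partition)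
        ultimately show ?thesis by linarith
      qed
      have ab0: "linked F x0 a" "linked F x0 b"
        using ab(1,3) by (auto simp: U_def)
      have nQ: "\<not> linked (insert e F) a x" "\<not> linked (insert e F) b x"
        if "x \<in> Q'" for x
        using that ab0 sub connected_component_trans unfolding Q'_def by blast+
      have ne: "a \<noteq> b" "a \<notin> Q'" "b \<notin> Q'" using nab abK ab0 by (auto simp: Q'_def)
      have "card (insert a (insert b Q')) = card Q' + 2" using ne Q(1) by (simp add: Q'_def)
      moreover have "beta (insert e F) \<le> beta F + 1" using beta_delete_le[OF gi, of u v] del by simp
      ultimately have "beta (insert e F) + 1 \<le> card (insert a (insert b Q'))" using Q(2) Qrem by linarith
      moreover have "insert a (insert b Q') \<subseteq> - K (insert e F)" using abK Q(3) by (auto simp: Q'_def)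
      moreover have "\<forall>x\<in>insert a (insert b Q'). \<forall>y\<in>insert a (insert b Q').
          linked (insert e F) x y \<longrightarrow> x = y"
      proof -
        have nab': "\<not> linked (insert e F) b a"
          using nab connected_component_sym by blast
        have nQ': "\<not> linked (insert e F) x a" "\<not> linked (insert e F) x b"
          if "x \<in> Q'" for x using nQ[OF that] connected_component_sym by blast+
        have QQ: "x = y" if "x \<in> Q'" "y \<in> Q'" "linked (insert e F) x y" for x y
          using Q(4)[of x y] sub[of x y] that by (simp add: Q'_def)
        show ?thesis using nab nab' nQ nQ' QQ by auto
      qed
      moreover have "finite (insert a (insert b Q'))" using Q(1) by (simp add: Q'_def)
      ultimately show ?thesis by (intro exI[of _ "insert a (insert b Q')"] conjI)
    qed
  qed
qed

text \<open>Only the interior of an edge is tested: touching a corner of the face does not make an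
  edge incident with it.\<close>

definition inc :: "complex \<Rightarrow> 'a set set" where
  "inc x = {e \<in> E. (img e - p ` e) \<inter> closure (connected_component_set (- K E) x) \<noteq> {}}"

text \<open>All faces incident with \<open>e\<close> lie in the single face \<open>U\<close> of
  \<open>E - {e}\<close> that contains the interior of \<open>e\<close>. If \<open>e\<close> is a
  bridge, restoring it does not divide \<open>U\<close>; otherwise points of \<open>U\<close> on the
  same side of a Jordan curve remain linked, so there are at most two classes.\<close>

lemma edge_two_faces:
  assumes e: "e \<in> E" and P: "finite P" "P \<subseteq> - K E"
    and sep: "\<And>x y. x \<in> P \<Longrightarrow> y \<in> P \<Longrightarrow> linked E x y \<Longrightarrow> x = y"
  shows "card {x \<in> P. e \<in> inc x} \<le> 2"
proof -
  obtain u v where uv: "e = {u, v}" using gr_edge[OF g e] by metis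
  define F where "F = E - {e}"
  have F: "F \<subseteq> E" "e \<notin> F" "insert e F = E" using e by (auto simp: F_def)
  have intF: "img e - p ` e \<subseteq> - K F" using img_Int_K[OF e F(1,2)] by blast
  obtain x0 where x0: "x0 \<in> img e - p ` e" using img_interior_ne[OF e] by blast
  define U where "U = connected_component_set (- K F) x0"
  have U: "open U" unfolding U_def by (rule open_connected_component[OF open_compl_K[OF F(1)]])
  have intU: "img e - p ` e \<subseteq> U"
    unfolding U_def by (rule connected_component_maximal[OF x0 img_interior_connected[OF e] intF])
  have KFE: "- K E \<subseteq> - K F" using K_mono[OF F(1)] by blast
  have inU: "linked F x0 x" if x: "x \<in> P" "e \<in> inc x" for x
  proof -
    obtain q where q: "q \<in> img e - p ` e" "q \<in> closure (connected_component_set (- K E) x)"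
      using x(2) unfolding inc_def by blast
    have "U \<inter> closure (connected_component_set (- K E) x) \<noteq> {}" using q intU by blast
    then obtain y where y: "y \<in> U" "linked E x y"
      using open_Int_closure_eq_empty[OF U] by blast
    have "linked F x y" using y(2) KFE by (rule connected_component_of_subset)
    moreover have "linked F x0 y" using y(1) by (simp add: U_def)
    ultimately show ?thesis using connected_component_trans connected_component_sym by blast
  qed
  define S where "S = {x \<in> P. e \<in> inc x}"
  have fS: "finite S" using P(1) by (simp add: S_def)
  have cc: "linked F x y" if "x \<in> S" "y \<in> S" for x y
    using that inU connected_component_trans connected_component_sym unfolding S_def by blast
  have SK: "x \<notin> K (insert e F)" if "x \<in> S" for x using that P(2) F(3) unfolding S_def by auto
  have e': "{u, v} \<in> E" "{u, v} \<notin> F" using e F(2) uv by auto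
  show ?thesis
  proof (cases "conn F u v")
    case False
    have "x = y" if xy: "x \<in> S" "y \<in> S" for x y
    proof -
      have "x \<notin> img {u, v}" "y \<notin> img {u, v}" using SK[OF xy(1)] SK[OF xy(2)] uv by (auto simp: K_insert)
      then have "linked (insert {u, v} F) x y"
        using bridge_no_separation[OF e' F(1) False cc[OF xy]] by blast
      then show ?thesis using sep xy F(3) uv unfolding S_def by auto
    qed
    then have "card S \<le> Suc 0" using card_le_Suc0_iff_eq[OF fS] by blast
    then show ?thesis by (simp add: S_def)
  next
    case True
    obtain J I O' where "open I" "open O'" "connected I" "connected O'"
      and J: "I \<inter> O' = {}" "I \<union> O' = - J"
      and "frontier I = J" "frontier O' = J" "img {u, v} \<subseteq> J" and J3: "J \<subseteq> K (insert {u, v} F)"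
      and JJ: "\<forall>x y. linked F x y \<longrightarrow> x \<in> I \<and> y \<in> I \<or> x \<in> O' \<and> y \<in> O' \<longrightarrow>
        linked (insert {u, v} F) x y"
      by (rule nonbridge_curve[OF e' F(1) True])
    have one: "card (S \<inter> X) \<le> 1" if X: "X = I \<or> X = O'" for X
    proof -
      have "x = y" if xy: "x \<in> S \<inter> X" "y \<in> S \<inter> X" for x y
      proof -
        have "linked (insert {u, v} F) x y"
          using JJ cc[of x y] xy X by blast
        then show ?thesis using sep xy F(3) uv unfolding S_def by auto
      qed
      then show ?thesis using card_le_Suc0_iff_eq[of "S \<inter> X"] fS by simp
    qed
    have "S \<subseteq> I \<union> O'" using SK J(2) J3 uv by blast
    then have "S = (S \<inter> I) \<union> (S \<inter> O')" by blast
    then have "card S \<le> card (S \<inter> I) + card (S \<inter> O')" using card_Un_le[of "S \<inter> I" "S \<inter> O'"] by simp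
    then show ?thesis using one[of I] one[of O'] by (simp add: S_def)
  qed
qed

text \<open>If the edges incident with the face formed a forest, the complement of their drawing
  would be connected. The face is open and relatively closed in it, so it would be all of it and
  contain \<open>y\<close>.\<close>

lemma face_has_cycle:
  assumes x: "x \<in> - K E" and y: "y \<in> - K E" and ns: "\<not> linked E x y"
  shows "beta (inc x) \<noteq> 0"
proof
  assume "beta (inc x) = 0"
  have incE: "inc x \<subseteq> E" by (auto simp: inc_def)
  let ?C = "connected_component_set (- K E) x"
  have con: "connected (- K (inc x))" by (rule forest_complement_connected[OF incE \<open>beta (inc x) = 0\<close>])
  have KE: "- K E \<subseteq> - K (inc x)" using K_mono[OF incE] by blast
  have oC: "open ?C" by (rule open_connected_component[OF open_compl_K]) simp
  have CK: "?C \<subseteq> - K E" by (rule connected_component_subset)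
  have clo: "q \<in> ?C" if q: "q \<in> closure ?C" "q \<in> - K (inc x)" for q
  proof (cases "q \<in> K E")
    case False
    let ?D = "connected_component_set (- K E) q"
    have "open ?D" by (rule open_connected_component[OF open_compl_K]) simp
    moreover have "q \<in> ?D" using False by simp
    ultimately have "?D \<inter> ?C \<noteq> {}" using q(1) open_Int_closure_eq_empty by blast
    then obtain z where "linked E q z" "linked E x z" by blast
    then have "linked E x q"
      using connected_component_trans connected_component_sym by blast
    then show ?thesis by simp
  next
    case True
    have "q \<notin> p ` V" using q(2) by (simp add: K_def)
    then obtain e where e: "e \<in> E" "q \<in> img e" using True by (auto simp: K_def)
    have "p ` e \<subseteq> p ` V" using grD(4)[OF g e(1)] by blast
    then have "e \<in> inc x" using e q(1) \<open>q \<notin> p ` V\<close> unfolding inc_def by blast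
    then show ?thesis using q(2) e(2) by (auto simp: K_def)
  qed
  have "?C = - K (inc x)"
  proof (rule ccontr)
    assume ne: "?C \<noteq> - K (inc x)"
    have "- K (inc x) \<subseteq> ?C \<union> (- closure ?C)" using clo by blast
    moreover have "?C \<inter> (- closure ?C) = {}" using closure_subset[of ?C] by blast
    moreover have "?C \<inter> - K (inc x) \<noteq> {}"
    proof -
      have "x \<in> ?C" using x by simp
      then show ?thesis using CK KE by blast
    qed
    moreover have "(- closure ?C) \<inter> - K (inc x) \<noteq> {}" using ne CK KE clo by blast
    moreover have "open (- closure ?C)" by (rule open_Compl[OF closed_closure])
    ultimately show False using con oC unfolding connected_def by blast
  qed
  then have "y \<in> ?C" using y KE by blast
  then show False using ns by simp
qed

lemma euler_girth_bound:
  assumes girth: "\<And>F. F \<subseteq> E \<Longrightarrow> beta F \<noteq> 0 \<Longrightarrow> 5 \<le> card F" and b: "beta E \<noteq> 0"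
  shows "5 * (beta E + 1) \<le> 2 * card E"
proof -
  obtain P where P: "finite P" "beta E + 1 \<le> card P" "P \<subseteq> - K E"
    "\<And>x y. x \<in> P \<Longrightarrow> y \<in> P \<Longrightarrow> linked E x y \<Longrightarrow> x = y" using many_faces[of E] by blast
  have five: "5 \<le> card (inc x)" if x: "x \<in> P" for x
  proof -
    \<comment> \<open>A nonzero \<open>beta E\<close> guarantees a second face, as
      \<open>face_has_cycle\<close> requires.\<close>
    have "\<exists>y\<in>P. y \<noteq> x"
    proof (rule ccontr)
      assume "\<not> ?thesis"
      then have "P \<subseteq> {x}" by blast
      then have "card P \<le> card {x}" by (intro card_mono) auto
      then show False using P(2) b by simp
    qed
    then obtain y where y: "y \<in> P" "y \<noteq> x" by blast
    have "\<not> linked E x y" using P(4)[OF x y(1)] y(2) by blast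
    then have "beta (inc x) \<noteq> 0" using face_has_cycle[of x y] x y(1) P(3) by blast
    then show ?thesis using girth[of "inc x"] by (auto simp: inc_def)
  qed
  have fE: "finite E" using grD(2)[OF g] .
  have "5 * (beta E + 1) \<le> 5 * card P" using P(2) by simp
  also have "\<dots> = (\<Sum>x\<in>P. 5)" by simp
  also have "\<dots> \<le> (\<Sum>x\<in>P. card (inc x))" using five by (intro sum_mono) auto
  also have "\<dots> = (\<Sum>x\<in>P. \<Sum>e\<in>E. if e \<in> inc x then 1 else 0)"
  proof (intro sum.cong refl)
    fix x
    have "E \<inter> {e. e \<in> inc x} = inc x" by (auto simp: inc_def)
    then show "card (inc x) = (\<Sum>e\<in>E. if e \<in> inc x then 1 else 0)" using fE by (simp add: sum.If_cases)
  qed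
  also have "\<dots> = (\<Sum>e\<in>E. \<Sum>x\<in>P. if e \<in> inc x then 1 else 0)" by (rule sum.swap)
  also have "\<dots> \<le> (\<Sum>e\<in>E. 2)"
  proof (intro sum_mono)
    fix e assume e: "e \<in> E"
    have "P \<inter> {x. e \<in> inc x} = {x \<in> P. e \<in> inc x}" by blast
    then show "(\<Sum>x\<in>P. if e \<in> inc x then 1 else 0) \<le> (2::nat)"
      using edge_two_faces[OF e P(1,3,4)] P(1) by (simp add: sum.If_cases)
  qed
  finally show ?thesis by simp
qed

end

section \<open>Cycles and girth\<close>

text \<open>When the next vertex of the walk already lies on the path, the path is cut back to
  it.\<close>

lemma conn_simple_path:
  assumes "conn F u v"
  shows "\<exists>xs. xs \<noteq> [] \<and> distinct xs \<and> hd xs = u \<and> last xs = v \<and>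
    (\<forall>i. Suc i < length xs \<longrightarrow> {xs ! i, xs ! Suc i} \<in> F)"
  using assms unfolding conn_def
proof (induction rule: rtrancl_induct)
  case base
  then show ?case by (intro exI[of _ "[u]"]) simp
next
  case (step a b)
  then obtain xs where xs: "xs \<noteq> []" "distinct xs" "hd xs = u" "last xs = a"
    "\<And>i. Suc i < length xs \<Longrightarrow> {xs ! i, xs ! Suc i} \<in> F" by blast
  have ab: "{a, b} \<in> F" using step.hyps by simp
  show ?case
  proof (cases "b \<in> set xs")
    case True
    then obtain i where i: "i < length xs" "xs ! i = b" by (metis in_set_conv_nth)
    have "last (take (Suc i) xs) = b" using i by (simp add: take_Suc_conv_app_nth)
    then show ?thesis using xs i by (intro exI[of _ "take (Suc i) xs"]) (simp add: hd_take)
  next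
    case False
    have "{(xs @ [b]) ! i, (xs @ [b]) ! Suc i} \<in> F" if i: "Suc i < length (xs @ [b])" for i
    proof (cases "Suc i < length xs")
      case True
      then show ?thesis using xs(5)[OF True] by (simp add: nth_append)
    next
      case False
      then have "Suc i = length xs" using i by simp
      then have "i = length xs - 1" "i < length xs" by simp_all
      then have "xs ! i = a" using xs(1,4) by (simp add: last_conv_nth)
      then show ?thesis using ab \<open>Suc i = length xs\<close> \<open>i < length xs\<close> by (simp add: nth_append)
    qed
    then show ?thesis using xs False by (intro exI[of _ "xs @ [b]"]) simp
  qed
qed

text \<open>An edge that carries flow is not a bridge, so a simple path joins its ends without it,
  and the edge closes this path to a cycle.\<close>

lemma beta_cycle:
  assumes g: "gr V F" and b: "beta F \<noteq> 0"
  shows "\<exists>xs. cycle (V, F) xs"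
proof -
  have "\<exists>y\<in>cyc F. \<exists>u v. y u v \<noteq> 0" using b unfolding beta_eq_0_iff[OF g] by simp
  then obtain y u v where y: "y \<in> cyc F" "y u v \<noteq> 0" by (elim bexE exE) (rule that)
  have uv: "{u, v} \<in> F" using y(2) cyc_outside[OF y(1), of u v] by blast
  have "u \<noteq> v" using grD(6)[OF g uv] by blast
  have c: "conn (F - {{u, v}}) u v" using bridge_flow_zero[OF g uv _ y(1)] y(2) by blast
  obtain xs where xs0: "xs \<noteq> [] \<and> distinct xs \<and> hd xs = u \<and> last xs = v \<and>
      (\<forall>i. Suc i < length xs \<longrightarrow> {xs ! i, xs ! Suc i} \<in> F - {{u, v}})"
    using conn_simple_path[OF c] by (rule exE)
  have xs: "xs \<noteq> []" "distinct xs" "hd xs = u" "last xs = v"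
    "\<And>i. Suc i < length xs \<Longrightarrow> {xs ! i, xs ! Suc i} \<in> F - {{u, v}}"
    using xs0 by simp_all
  have ends: "xs ! 0 = u" "xs ! (length xs - 1) = v"
    using xs(1,3,4) by (simp_all add: hd_conv_nth last_conv_nth)
  have "length xs \<noteq> 0" using xs(1) by simp
  moreover have "length xs \<noteq> 1" using ends \<open>u \<noteq> v\<close> by auto
  \<comment> \<open>A path with two vertices would be the deleted edge itself.\<close>
  moreover have "length xs \<noteq> 2" using ends xs(5)[of 0] by auto
  ultimately have len: "length xs \<ge> 3" by linarith
  have "{xs ! i, xs ! (Suc i mod length xs)} \<in> F" if i: "i < length xs" for i
  proof (cases "Suc i < length xs")
    case True
    then show ?thesis using xs(5)[OF True] by simp
  next
    case False
    then have "Suc i = length xs" using i by simp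
    then have "i = length xs - 1" "Suc i mod length xs = 0" by simp_all
    then have "{xs ! i, xs ! (Suc i mod length xs)} = {v, u}" using ends by simp
    also have "{v, u} = {u, v}" by (rule insert_commute)
    finally show ?thesis using uv by simp
  qed
  then have "cycle (V, F) xs" unfolding cycle_def using len xs(2) by simp
  then show ?thesis by blast
qed

text \<open>Equal edges at two different positions would be traversed in opposite directions, so
  each position would be the cyclic successor of the other, which is impossible for length at least
  3.\<close>

lemma cycle_length_le:
  assumes g: "gr V F" and c: "cycle (V, F) xs"
  shows "length xs \<le> card F"
proof -
  let ?n = "length xs"
  define f where "f i = {xs ! i, xs ! (Suc i mod ?n)}" for i
  have n: "3 \<le> ?n" "distinct xs" and fF: "\<And>i. i < ?n \<Longrightarrow> f i \<in> F" using c by (auto simp: cycle_def f_def)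
  have "inj_on f {..<?n}"
  proof (rule inj_onI, rule ccontr)
    fix i j assume ij: "i \<in> {..<?n}" "j \<in> {..<?n}" "f i = f j" "i \<noteq> j"
    have "0 < ?n" using n(1) by linarith
    then have m: "Suc i mod ?n < ?n" "Suc j mod ?n < ?n" by (rule mod_less_divisor)+
    have ne: "xs ! i \<noteq> xs ! j" using ij n(2) by (simp add: nth_eq_iff_index_eq)
    then have "xs ! i = xs ! (Suc j mod ?n)" "xs ! (Suc i mod ?n) = xs ! j"
      using ij(3) by (auto simp: f_def doubleton_eq_iff)
    then have "i = Suc j mod ?n" "Suc i mod ?n = j"
      using ij m n(2) by (simp_all add: nth_eq_iff_index_eq)
    then show False using ij(1,2) n(1) by (auto simp: mod_Suc split: if_splits)
  qed
  then have "card {..<?n} \<le> card F"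
    using fF grD(2)[OF g] by (intro card_inj_on_le[of f]) auto
  then show ?thesis by simp
qed

lemma girth_cycle:
  assumes "girth G \<ge> 5" "cycle G xs"
  shows "5 \<le> length xs"
proof -
  have "girth G \<le> enat (length xs)"
    unfolding girth_def using assms(2) by (intro Inf_lower) blast
  then have "5 \<le> enat (length xs)" using assms(1) by (rule order_trans[rotated])
  then show ?thesis by (simp add: numeral_eq_enat)
qed

text \<open>Drawing and girth condition pass to every subgraph. There, \<open>card F\<close> is
  eliminated between \<open>5 * (beta F + 1) \<le> 2 * card F\<close> and
  \<open>card F + 1 \<le> beta F + card U\<close>.\<close>

theorem planar_sparse5:
  assumes sg: "simple_graph G" and pl: "planar G" and gi: "girth G \<ge> 5"
  shows "sparse5 (verts G) (edges G)"
proof -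
  have g: "gr (verts G) (edges G)" using sg by (simp add: gr_def simple_graph_def)
  obtain p \<gamma> where pd: "plane_drawing G p \<gamma>" using pl unfolding planar_def by blast
  have "3 * beta F + 7 \<le> 2 * card U"
    if U: "U \<subseteq> verts G" and F: "F \<subseteq> edges G" "\<Union>F \<subseteq> U" and b: "1 \<le> beta F" for U F
  proof -
    have gF: "gr U F" using F by (intro gr_restrict[OF g U]) auto
    have pd0: "inj_on p (verts G)" using pd unfolding plane_drawing_def by (rule conjunct1)
    have pd1: "\<forall>e\<in>edges G. arc (\<gamma> e) \<and> {pathstart (\<gamma> e), pathfinish (\<gamma> e)} = p ` e \<and>
        (path_image (\<gamma> e) - p ` e) \<inter> p ` verts G = {} \<and>
        (\<forall>f\<in>edges G. f \<noteq> e \<longrightarrow> (path_image (\<gamma> e) - p ` e) \<inter> path_image (\<gamma> f) = {})"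
      using pd unfolding plane_drawing_def by (rule conjunct2)
    have pU: "p ` U \<subseteq> p ` verts G" using U by blast
    have "plane_drawing (U, F) p \<gamma>"
      unfolding plane_drawing_def fst_conv snd_conv
    proof (intro conjI ballI impI)
      show "inj_on p U" using pd0 U by (rule inj_on_subset)
      fix e assume e: "e \<in> F"
      then have e': "e \<in> edges G" using F(1) by blast
      note pe = bspec[OF pd1 e']
      show "arc (\<gamma> e)" using pe by (elim conjE)
      show "{pathstart (\<gamma> e), pathfinish (\<gamma> e)} = p ` e" using pe by (elim conjE)
      have "(path_image (\<gamma> e) - p ` e) \<inter> p ` verts G = {}" using pe by (elim conjE)
      then show "(path_image (\<gamma> e) - p ` e) \<inter> p ` U = {}" using pU by blast
      have pf: "\<forall>f\<in>edges G. f \<noteq> e \<longrightarrow> (path_image (\<gamma> e) - p ` e) \<inter> path_image (\<gamma> f) = {}"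
        using pe by (elim conjE)
      fix f assume f: "f \<in> F" "f \<noteq> e"
      have "f \<in> edges G" using f(1) F(1) by blast
      then show "(path_image (\<gamma> e) - p ` e) \<inter> path_image (\<gamma> f) = {}" using pf f(2) by simp
    qed
    then interpret drawing U F p \<gamma> using gF by unfold_locales
    have "5 \<le> card F'" if F': "F' \<subseteq> F" "beta F' \<noteq> 0" for F'
    proof -
      have gF': "gr U F'" using gr_subset[OF gF F'(1)] .
      obtain xs where xs: "cycle (U, F') xs" using beta_cycle[OF gF' F'(2)] by blast
      have "cycle G xs" using xs F'(1) F(1) unfolding cycle_def by auto
      then have "5 \<le> length xs" by (rule girth_cycle[OF gi])
      then show ?thesis using cycle_length_le[OF gF' xs] by linarith
    qed
    then have "5 * (beta F + 1) \<le> 2 * card F" using b by (intro euler_girth_bound) auto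
    then have m: "5 * beta F + 5 \<le> 2 * card F" by simp
    have "F \<noteq> {}" using b by auto
    then have "U \<noteq> {}" using grD(5)[OF gF] F(2) by fastforce
    then have "card F + 1 \<le> beta F + card U" by (rule card_edges_le[OF gF])
    then show ?thesis using m by linarith
  qed
  then show ?thesis using g unfolding sparse5_def by blast
qed

section \<open>Independent sets in covers\<close>

lemma independence_number_ge:
  assumes "simple_graph H" "independent_set H S"
  shows "card S \<le> independence_number H"
proof -
  have "{card S |S. independent_set H S} \<subseteq> {..card (verts H)}"
    using assms(1) by (auto simp: independent_set_def simple_graph_def intro: card_mono)
  then have "finite {card S |S. independent_set H S}" using finite_subset by blast
  then show ?thesis unfolding independence_number_def using assms(2) by (intro Max_ge) blast+
qed

lemma coverD:
  assumes "cover G L H"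
  shows "simple_graph H" "disjoint_family_on L (verts G)" "(\<Union>u\<in>verts G. L u) = verts H"
    "\<And>u x y. u \<in> verts G \<Longrightarrow> x \<in> L u \<Longrightarrow> y \<in> L u \<Longrightarrow> x \<noteq> y \<Longrightarrow> {x, y} \<in> edges H"
    "\<And>u v. {u, v} \<in> edges G \<Longrightarrow> matching (edges_between H (L u) (L v))"
    "\<And>u v. u \<in> verts G \<Longrightarrow> v \<in> verts G \<Longrightarrow> u \<noteq> v \<Longrightarrow> {u, v} \<notin> edges G \<Longrightarrow> edges_between H (L u) (L v) = {}"
proof -
  note c = assms[unfolded cover_def]
  show "simple_graph H" using c by (elim conjE)
  show "disjoint_family_on L (verts G)" using c by (elim conjE)
  show "(\<Union>u\<in>verts G. L u) = verts H" using c by (elim conjE)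
  have c4: "\<forall>u\<in>verts G. \<forall>x\<in>L u. \<forall>y\<in>L u. x \<noteq> y \<longrightarrow> {x, y} \<in> edges H" using c by (elim conjE)
  have c5: "\<forall>u v. {u, v} \<in> edges G \<longrightarrow> matching (edges_between H (L u) (L v))" using c by (elim conjE)
  have c6: "\<forall>u\<in>verts G. \<forall>v\<in>verts G. u \<noteq> v \<and> {u, v} \<notin> edges G \<longrightarrow> edges_between H (L u) (L v) = {}"
    using c by (elim conjE)
  show "{x, y} \<in> edges H" if "u \<in> verts G" "x \<in> L u" "y \<in> L u" "x \<noteq> y" for u x y using c4 that by simp
  show "matching (edges_between H (L u) (L v))" if "{u, v} \<in> edges G" for u v using c5 that by simp
  show "edges_between H (L u) (L v) = {}" if "u \<in> verts G" "v \<in> verts G" "u \<noteq> v" "{u, v} \<notin> edges G" for u v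
    using c6 that by simp
qed

text \<open>Greedy choice: a vertex of low degree is coloured last, and by the matching condition
  each of its at most \<open>k\<close> neighbours in \<open>W\<close> excludes at most one element
  of its list.\<close>

lemma degenerate_selection:
  assumes cov: "cover G L H" and g: "gr (verts G) (edges G)"
    and "W \<subseteq> verts G" "degen k W (edges G)" "\<And>u. u \<in> W \<Longrightarrow> k < card (L u)"
  shows "\<exists>c. (\<forall>u\<in>W. c u \<in> L u) \<and> (\<forall>u\<in>W. \<forall>w\<in>W. u \<noteq> w \<longrightarrow> {c u, c w} \<notin> edges H)"
  using assms(3-5)
proof (induction "card W" arbitrary: W rule: less_induct)
  case less
  have fW: "finite W" using less.prems(1) grD(1)[OF g] finite_subset by blast
  show ?case
  proof (cases "W = {}")
    case False
    then obtain v where v: "v \<in> W" "card {e \<in> edges G. e \<subseteq> W \<and> v \<in> e} \<le> k"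
      using less.prems(2) unfolding degen_def by blast
    have "\<exists>c. (\<forall>u\<in>W - {v}. c u \<in> L u) \<and>
      (\<forall>u\<in>W - {v}. \<forall>w\<in>W - {v}. u \<noteq> w \<longrightarrow> {c u, c w} \<notin> edges H)"
    proof (rule less.hyps)
      show "card (W - {v}) < card W" using card_Diff1_less[OF fW v(1)] .
      show "degen k (W - {v}) (edges G)" using less.prems(2) unfolding degen_def by blast
    qed (use less.prems(1,3) in auto)
    then obtain c where c: "\<forall>u\<in>W - {v}. c u \<in> L u"
      "\<forall>u\<in>W - {v}. \<forall>w\<in>W - {v}. u \<noteq> w \<longrightarrow> {c u, c w} \<notin> edges H"
      by (elim exE conjE) (rule that)
    define N where "N = {w \<in> W. {v, w} \<in> edges G}"
    have vN: "v \<notin> N" using grD(6)[OF g, of v v] by (auto simp: N_def)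
    have "card N \<le> card {e \<in> edges G. e \<subseteq> W \<and> v \<in> e}"
    proof (rule card_inj_on_le[of "\<lambda>w. {v, w}"])
      show "inj_on (\<lambda>w. {v, w}) N" by (auto simp: inj_on_def doubleton_eq_iff)
      show "(\<lambda>w. {v, w}) ` N \<subseteq> {e \<in> edges G. e \<subseteq> W \<and> v \<in> e}" using v(1) by (auto simp: N_def)
      show "finite {e \<in> edges G. e \<subseteq> W \<and> v \<in> e}" using grD(2)[OF g] by simp
    qed
    then have cN: "card N \<le> k" using v(2) by linarith
    define bad where "bad w = {x \<in> L v. {x, c w} \<in> edges H}" for w
    have bad1: "card (bad w) \<le> 1" if w: "w \<in> N" for w
    proof -
      have mt: "matching (edges_between H (L v) (L w))" using coverD(5)[OF cov] w by (simp add: N_def)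
      have cw: "c w \<in> L w" using c(1) w vN by (auto simp: N_def)
      have "x = x'" if x: "x \<in> bad w" "x' \<in> bad w" for x x'
      proof (rule ccontr)
        assume ne: "x \<noteq> x'"
        have m: "{x, c w} \<in> edges_between H (L v) (L w)" "{x', c w} \<in> edges_between H (L v) (L w)"
          using x cw by (auto simp: bad_def edges_between_def)
        have d: "{x, c w} \<noteq> {x', c w}" using ne by (auto simp: doubleton_eq_iff)
        have "{x, c w} \<inter> {x', c w} = {}" by (rule mt[unfolded matching_def, rule_format, OF m d])
        then show False by blast
      qed
      then show ?thesis by (cases "finite (bad w)") (auto simp: card_le_Suc0_iff_eq)
    qed
    have fN: "finite N" using fW by (simp add: N_def)
    have "card (\<Union>w\<in>N. bad w) \<le> (\<Sum>w\<in>N. card (bad w))" by (rule card_UN_le[OF fN])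
    also have "\<dots> \<le> (\<Sum>w\<in>N. 1)" using bad1 by (intro sum_mono) auto
    finally have "card (\<Union>w\<in>N. bad w) < card (L v)" using cN less.prems(3)[OF v(1)] by simp
    moreover have "finite (L v)" using less.prems(3)[OF v(1)] by (metis card.infinite not_less0)
    then have "finite (\<Union>w\<in>N. bad w)" using fN by (auto simp: bad_def)
    ultimately have "\<not> L v \<subseteq> (\<Union>w\<in>N. bad w)" using card_mono by (metis leD)
    then obtain x where x: "x \<in> L v" "\<And>w. w \<in> N \<Longrightarrow> x \<notin> bad w" by blast
    have xw: "{x, c w} \<notin> edges H" if w: "w \<in> W - {v}" for w
    proof (cases "{v, w} \<in> edges G")
      case True
      then show ?thesis using x w by (auto simp: N_def bad_def)
    next
      case False
      then have "edges_between H (L v) (L w) = {}"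
        using coverD(6)[OF cov, of v w] v(1) w less.prems(1) by blast
      then show ?thesis using x(1) c(1) w by (auto simp: edges_between_def)
    qed
    have wx: "{c w, x} \<notin> edges H" if w: "w \<in> W - {v}" for w
      using xw[OF w] by (simp add: insert_commute)
    show ?thesis
    proof (intro exI[of _ "c(v := x)"] conjI ballI impI)
      show "(c(v := x)) u \<in> L u" if "u \<in> W" for u using that c(1) x(1) by simp
      show "{(c(v := x)) u, (c(v := x)) w} \<notin> edges H" if "u \<in> W" "w \<in> W" "u \<noteq> w" for u w
        using that c(2) xw wx by (cases "u = v"; cases "w = v") auto
    qed
  qed simp
qed

lemma degenerate_independent_set:
  assumes cov: "cover G L H" and g: "gr (verts G) (edges G)"
    and W: "W \<subseteq> verts G" "degen k W (edges G)" "\<And>u. u \<in> W \<Longrightarrow> k < card (L u)"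
  shows "\<exists>S. independent_set H S \<and> card S = card W"
proof -
  have "\<exists>c. (\<forall>u\<in>W. c u \<in> L u) \<and> (\<forall>u\<in>W. \<forall>w\<in>W. u \<noteq> w \<longrightarrow> {c u, c w} \<notin> edges H)"
    by (rule degenerate_selection[OF cov g W(1,2)]) (rule W(3))
  then obtain c where c: "\<forall>u\<in>W. c u \<in> L u" "\<forall>u\<in>W. \<forall>w\<in>W. u \<noteq> w \<longrightarrow> {c u, c w} \<notin> edges H"
    by (elim exE conjE) (rule that)
  have "inj_on c W"
  proof (rule inj_onI, rule ccontr)
    fix u w assume uw: "u \<in> W" "w \<in> W" "c u = c w" "u \<noteq> w"
    then have "c u \<in> L u \<inter> L w" using c(1) by auto
    then show False using coverD(2)[OF cov] uw W(1) unfolding disjoint_family_on_def by blast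
  qed
  then have "card (c ` W) = card W" by (rule card_image)
  moreover have "independent_set H (c ` W)"
    unfolding independent_set_def
  proof (intro conjI ballI)
    show "c ` W \<subseteq> verts H" using c(1) coverD(3)[OF cov] W(1) by blast
    fix x y assume "x \<in> c ` W" "y \<in> c ` W"
    then obtain u w where uw: "u \<in> W" "w \<in> W" "x = c u" "y = c w" by blast
    show "{x, y} \<notin> edges H"
    proof (cases "u = w")
      case True
      then have "card {x, y} = 1" using uw by simp
      then show ?thesis using coverD(1)[OF cov] unfolding simple_graph_def by auto
    next
      case False
      then show ?thesis using c(2) uw by blast
    qed
  qed
  ultimately show ?thesis by blast
qed

text \<open>Disjoint cliques without any cross edges form a cover. Its existence ensures that the
  minimum in \<open>partial_DP_number\<close> is attained.\<close>

lemma fold_cover_exists: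
  assumes sg: "simple_graph G" and t: "1 \<le> t"
  shows "\<exists>(L :: 'a \<Rightarrow> nat set) H. fold_cover t (G :: 'a graph) L H"
proof -
  define L where "L u = {u} \<times> {..<t}" for u :: 'a
  define H where "H = (verts G \<times> {..<t}, {e. e \<subseteq> verts G \<times> {..<t} \<and> card e = 2 \<and> (\<exists>u. e \<subseteq> L u)})"
  have V: "finite (verts G)" "verts G \<noteq> {}" using sg by (auto simp: simple_graph_def)
  have sH: "simple_graph H" using V t by (auto simp: simple_graph_def H_def lessThan_empty_iff)
  have em: "edges_between H (L u) (L v) = {}" if "u \<noteq> v" for u v
    using that by (auto simp: edges_between_def H_def L_def)
  have "cover G L H"
    unfolding cover_def
  proof (intro conjI ballI allI impI)
    show "simple_graph H" by (rule sH)
    show "disjoint_family_on L (verts G)" by (auto simp: disjoint_family_on_def L_def)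
    show "(\<Union>u\<in>verts G. L u) = verts H" by (auto simp: L_def H_def)
    show "{x, y} \<in> edges H" if "u \<in> verts G" "x \<in> L u" "y \<in> L u" "x \<noteq> y" for u x y
      using that by (auto simp: H_def L_def)
    show "matching (edges_between H (L u) (L v))" if "{u, v} \<in> edges G" for u v
    proof -
      have "card {u, v} = 2" using that sg by (simp add: simple_graph_def)
      then have "u \<noteq> v" by auto
      then show ?thesis using em by (simp add: matching_def)
    qed
    show "edges_between H (L u) (L v) = {}" if "u \<noteq> v \<and> {u, v} \<notin> edges G" for u v
      using em that by simp
  qed
  moreover have "card (L u) = t" for u by (simp add: L_def)
  ultimately have fc: "fold_cover t G L H" by (simp add: fold_cover_def)
  obtain f :: "'a \<times> nat \<Rightarrow> nat" where "inj_on f (verts H)" using obtain_nat_embedding[OF sH] .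
  from fold_cover_image[OF sg fc this] show ?thesis by blast
qed

lemma partial_DP_number_attained:
  assumes "simple_graph (G :: 'a graph)" "1 \<le> t"
  shows "\<exists>(L :: 'a \<Rightarrow> nat set) H. fold_cover t G L H \<and> partial_DP_number t G = independence_number H"
proof -
  obtain L :: "'a \<Rightarrow> nat set" and H where "fold_cover t G L H" using fold_cover_exists[OF assms] by blast
  then have "\<exists>k. \<exists>(L :: 'a \<Rightarrow> nat set) H. fold_cover t G L H \<and> k = independence_number H" by blast
  then show ?thesis unfolding partial_DP_number_def by (rule LeastI_ex)
qed

text \<open>
  Replacing every vertex of a 1-fold cover by a clique of \<open>m\<close> copies gives an \<open>m\<close>-fold cover;
  a colouring of it splits into \<open>m\<close> independent sets of the original cover.
\<close>

lemma one_fold_cover_bound: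
  fixes L :: "'a \<Rightarrow> nat set"
  assumes sg: "simple_graph G" and fc: "fold_cover 1 G L H" and m: "1 \<le> m" and dp: "DP_colorable G m"
  shows "card (verts G) \<le> m * independence_number H"
proof -
  have cov: "cover G L H" and c1: "\<And>u. u \<in> verts G \<Longrightarrow> card (L u) = 1" using fc by (auto simp: fold_cover_def)
  have sH: "simple_graph H" using coverD(1)[OF cov] .
  define L' where "L' u = L u \<times> {..<m}" for u
  \<comment> \<open>Copies of an edge of \<open>H\<close> join equal layers only. This keeps the
    edges between two lists a matching and makes each layer a copy of \<open>H\<close>.\<close>
  define EH where "EH = {e. \<exists>x y i j. e = {(x, i), (y, j)} \<and> x \<in> verts H \<and> y \<in> verts H \<and> i < m \<and> j < m \<and>
      (x = y \<and> i \<noteq> j \<or> i = j \<and> {x, y} \<in> edges H)}"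
  define H' where "H' = (verts H \<times> {..<m}, EH)"
  have loop: "{x, x} \<notin> edges H" for x using sH by (auto simp: simple_graph_def)
  have dis: "x \<noteq> y" if "x \<in> L u" "y \<in> L v" "u \<in> verts G" "v \<in> verts G" "u \<noteq> v" for x y u v
    using coverD(2)[OF cov] that unfolding disjoint_family_on_def by blast
  have LH: "L u \<subseteq> verts H" if "u \<in> verts G" for u using coverD(3)[OF cov] that by blast
  have sH': "simple_graph H'"
    unfolding simple_graph_def
  proof (intro conjI ballI)
    show "finite (verts H')" "verts H' \<noteq> {}"
      using sH m by (auto simp: simple_graph_def H'_def lessThan_empty_iff)
    fix e assume "e \<in> edges H'"
    then obtain x y i j where e: "e = {(x, i), (y, j)}" "x \<in> verts H" "y \<in> verts H" "i < m" "j < m"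
      "x = y \<and> i \<noteq> j \<or> i = j \<and> {x, y} \<in> edges H" by (auto simp: H'_def EH_def)
    show "e \<subseteq> verts H'" using e by (simp add: H'_def)
    have "(x, i) \<noteq> (y, j)" using e(6) loop by auto
    then show "card e = 2" using e(1) by simp
  qed
  have between: "\<exists>x y i. e = {(x, i), (y, i)} \<and> x \<in> L u \<and> y \<in> L v \<and> {x, y} \<in> edges H"
    if e: "e \<in> edges_between H' (L' u) (L' v)" and uv: "u \<in> verts G" "v \<in> verts G" "u \<noteq> v" for e u v
  proof -
    obtain x y i j where xy: "e = {(x, i), (y, j)}" "x = y \<and> i \<noteq> j \<or> i = j \<and> {x, y} \<in> edges H"
      using e by (auto simp: edges_between_def H'_def EH_def)
    obtain a b where ab: "a \<in> e" "a \<in> L' u" "b \<in> e" "b \<in> L' v" using e by (auto simp: edges_between_def)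
    have "fst a \<noteq> fst b" using dis[of "fst a" u "fst b" v] ab uv by (auto simp: L'_def)
    then have "(a = (x, i) \<and> b = (y, j) \<or> a = (y, j) \<and> b = (x, i)) \<and> x \<noteq> y" using ab xy(1) by auto
    then have ij: "i = j" "{x, y} \<in> edges H" "{y, x} \<in> edges H" using xy(2) by (auto simp: insert_commute)
    have "a = (x, i) \<and> b = (y, i) \<or> a = (y, i) \<and> b = (x, i)" using \<open>_ \<and> x \<noteq> y\<close> ij(1) by blast
    then show ?thesis
    proof
      assume "a = (x, i) \<and> b = (y, i)"
      then have "x \<in> L u" "y \<in> L v" using ab(2,4) by (auto simp: L'_def)
      moreover have "e = {(x, i), (y, i)}" using xy(1) ij(1) by simp
      ultimately show ?thesis using ij(2) by (intro exI conjI)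
    next
      assume "a = (y, i) \<and> b = (x, i)"
      then have "y \<in> L u" "x \<in> L v" using ab(2,4) by (auto simp: L'_def)
      moreover have "e = {(y, i), (x, i)}" using xy(1) ij(1) by (subst insert_commute) simp
      ultimately show ?thesis using ij(3) by (intro exI conjI)
    qed
  qed
  have g: "gr (verts G) (edges G)" using sg by (simp add: gr_def simple_graph_def)
  have EG: "u \<in> verts G \<and> v \<in> verts G \<and> u \<noteq> v" if "{u, v} \<in> edges G" for u v
    using grD(6)[OF g that] .
  have "cover G L' H'"
    unfolding cover_def
  proof (intro conjI ballI allI impI)
    show "simple_graph H'" by (rule sH')
    show "disjoint_family_on L' (verts G)"
      using coverD(2)[OF cov] unfolding disjoint_family_on_def L'_def by blast
    show "(\<Union>u\<in>verts G. L' u) = verts H'" using coverD(3)[OF cov] by (auto simp: L'_def H'_def)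
  next
    fix u a b assume u: "u \<in> verts G" and ab: "a \<in> L' u" "b \<in> L' u" "a \<noteq> b"
    obtain x where x: "L u = {x}" using c1[OF u] by (metis card_1_singletonE)
    obtain i j where ij: "a = (x, i)" "b = (x, j)" "i < m" "j < m" "i \<noteq> j"
      using ab x by (auto simp: L'_def)
    have "x \<in> verts H" using LH[OF u] x by blast
    then show "{a, b} \<in> edges H'" using ij unfolding H'_def EH_def snd_conv by blast
  next
    fix u v assume "{u, v} \<in> edges G"
    then have uv: "u \<in> verts G" "v \<in> verts G" "u \<noteq> v" using EG by blast+
    obtain x y where xy: "L u = {x}" "L v = {y}" using c1 uv by (metis card_1_singletonE)
    have ne: "x \<noteq> y" using dis[of x u y v] xy uv by simp
    show "matching (edges_between H' (L' u) (L' v))"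
      unfolding matching_def
    proof (intro ballI impI)
      fix e f assume ef: "e \<in> edges_between H' (L' u) (L' v)" "f \<in> edges_between H' (L' u) (L' v)" "e \<noteq> f"
      obtain x1 y1 i where "e = {(x1, i), (y1, i)}" "x1 \<in> L u" "y1 \<in> L v"
        using between[OF ef(1) uv] by (elim exE conjE) (rule that)
      then have i: "e = {(x, i), (y, i)}" using xy by simp
      obtain x2 y2 j where "f = {(x2, j), (y2, j)}" "x2 \<in> L u" "y2 \<in> L v"
        using between[OF ef(2) uv] by (elim exE conjE) (rule that)
      then have j: "f = {(x, j), (y, j)}" using xy by simp
      have "i \<noteq> j" using ef(3) i j by blast
      then show "e \<inter> f = {}" using i j ne by auto
    qed
  next
    fix u v assume uv: "u \<in> verts G" "v \<in> verts G" "u \<noteq> v \<and> {u, v} \<notin> edges G"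
    then have em: "edges_between H (L u) (L v) = {}" using coverD(6)[OF cov] by blast
    have False if e: "e \<in> edges_between H' (L' u) (L' v)" for e
    proof -
      obtain x y where "x \<in> L u" "y \<in> L v" "{x, y} \<in> edges H" using between[OF e uv(1,2)] uv(3) by blast
      then have "{x, y} \<in> edges_between H (L u) (L v)" by (auto simp: edges_between_def)
      then show False using em by blast
    qed
    then show "edges_between H' (L' u) (L' v) = {}" by blast
  qed
  moreover have "card (L' u) = m" if "u \<in> verts G" for u
    using c1[OF that] by (simp add: L'_def card_cartesian_product)
  ultimately have "fold_cover m G L' H'" by (simp add: fold_cover_def)
  then obtain S where S: "independent_set H' S" "card S = card (verts G)"
    using DP_colorable_imp_coloring[OF sg dp] unfolding cover_coloring_def by blast
  define T where "T i = {x. (x, i) \<in> S}" for i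
  have SV: "S \<subseteq> verts H \<times> {..<m}" using S(1) by (simp add: independent_set_def H'_def)
  have TH: "T i \<subseteq> verts H" for i using SV by (auto simp: T_def)
  have fH: "finite (verts H)" using sH by (simp add: simple_graph_def)
  have "independent_set H (T i)" if i: "i < m" for i
    unfolding independent_set_def
  proof (intro conjI ballI)
    fix x y assume xy: "x \<in> T i" "y \<in> T i"
    show "{x, y} \<notin> edges H"
    proof
      assume "{x, y} \<in> edges H"
      then have "{(x, i), (y, i)} \<in> edges H'" using i xy TH unfolding H'_def EH_def snd_conv by blast
      then show False using S(1) xy unfolding independent_set_def T_def by blast
    qed
  qed (rule TH)
  then have Ti: "card (T i) \<le> independence_number H" if "i < m" for i
    using independence_number_ge[OF sH] that by blast
  have "S = (\<lambda>(i, x). (x, i)) ` Sigma {..<m} T" using SV by (force simp: T_def)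
  then have "card S \<le> card (Sigma {..<m} T)"
    using fH TH by (metis card_image_le finite_SigmaI finite_lessThan finite_subset)
  also have "\<dots> = (\<Sum>i<m. card (T i))" using fH TH finite_subset by (intro card_SigmaI) blast+
  also have "\<dots> \<le> (\<Sum>i<m. independence_number H)" using Ti by (intro sum_mono) auto
  finally show ?thesis using S(2) by simp
qed

theorem mainTheorem11:
  fixes G :: "'a graph"
  assumes "simple_graph G" and "nontrivial G" and "planar G" and "girth G \<ge> 5"
  shows "partially_DP_nice G"
proof -
  let ?n = "card (verts G)" and ?\<chi> = "DP_chromatic_number G"
  have s: "sparse5 (verts G) (edges G)" using planar_sparse5[OF assms(1,3,4)] .
  have g: "gr (verts G) (edges G)" using s by (simp add: sparse5_def)
  have Vne: "verts G \<noteq> {}" using assms(1) by (simp add: simple_graph_def)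
  have "DP_colorable G 4"
    unfolding DP_colorable_def
  proof (intro allI impI)
    fix L :: "'a \<Rightarrow> nat set" and H assume fc: "fold_cover 4 G L H"
    then show "\<exists>S. cover_coloring G H S"
      using degenerate_independent_set[OF _ g subset_refl degen_3[OF s], of L H]
      unfolding fold_cover_def cover_coloring_def by simp
  qed
  then have ex: "1 \<le> (4::nat) \<and> DP_colorable G 4" by simp
  have chi: "1 \<le> ?\<chi>" "DP_colorable G ?\<chi>"
    unfolding DP_chromatic_number_def using LeastI[of "\<lambda>m. 1 \<le> m \<and> DP_colorable G m", OF ex] by blast+
  have chi4: "?\<chi> \<le> 4" unfolding DP_chromatic_number_def by (rule Least_le[of "\<lambda>m. 1 \<le> m \<and> DP_colorable G m", OF ex])
  have "t * ?n \<le> ?\<chi> * partial_DP_number t G" if t: "t \<in> {1..?\<chi>}" for t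
  proof -
    obtain L :: "'a \<Rightarrow> nat set" and H where LH: "fold_cover t G L H" "partial_DP_number t G = independence_number H"
      using partial_DP_number_attained[OF assms(1), of t] t by auto
    have cov: "cover G L H" and cL: "\<And>u. u \<in> verts G \<Longrightarrow> card (L u) = t"
      using LH(1) by (auto simp: fold_cover_def)
    have sH: "simple_graph H" using coverD(1)[OF cov] .
    have deg: "?n - card S \<le> independence_number H" if S: "S \<subseteq> verts G" "degen k (verts G - S) (edges G)" "k < t" for S k
    proof -
      obtain I where "independent_set H I" "card I = card (verts G - S)"
        using degenerate_independent_set[OF cov g _ S(2)] cL S(3) by auto
      then have "card (verts G - S) \<le> independence_number H" using independence_number_ge[OF sH] by metis
      then show ?thesis using grD(1)[OF g] S(1) by (simp add: card_Diff_subset finite_subset)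
    qed
    \<comment> \<open>Once \<open>t = 1\<close> and \<open>t = ?\<chi>\<close> are set aside,
      \<open>?\<chi> \<le> 4\<close> leaves \<open>t = 2\<close> or \<open>t = 3\<close>, and the
      latter forces \<open>?\<chi> = 4\<close>.\<close>
    consider "t = ?\<chi>" | "t = 1" | "t = 2" "3 \<le> ?\<chi>" | "t = 3" "?\<chi> = 4"
      using t chi4 by fastforce
    then have "t * ?n \<le> ?\<chi> * independence_number H"
    proof cases
      case 1
      obtain S where "independent_set H S" "card S = ?n"
        using chi(2) LH(1) 1 unfolding DP_colorable_def cover_coloring_def by blast
      then have "?n \<le> independence_number H" using independence_number_ge[OF sH] by metis
      then show ?thesis using 1 by simp
    next
      case 2
      then show ?thesis using one_fold_cover_bound[OF assms(1) _ chi] LH(1) by simp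
    next
      case 3
      obtain S where S: "S \<subseteq> verts G" "3 * card S \<le> ?n" "degen 1 (verts G - S) (edges G)"
        using feedback_forest[OF s] by blast
      have "?n - card S \<le> independence_number H" using deg[OF S(1,3)] 3(1) by simp
      \<comment> \<open>At least two thirds of the vertices survive, which is what
        \<open>?\<chi> = 3\<close> demands; a larger \<open>?\<chi>\<close> only weakens the
        claim.\<close>
      then have "2 * ?n \<le> 3 * independence_number H" using S(2) by linarith
      also have "\<dots> \<le> ?\<chi> * independence_number H" using 3(2) by (rule mult_le_mono1)
      finally show ?thesis using 3(1) by simp
    next
      case 4
      obtain S where S: "S \<subseteq> verts G" "7 * card S \<le> card (edges G)" "degen 2 (verts G - S) (edges G)"
        using degen_2[OF s] by blast
      have "?n - card S \<le> independence_number H" using deg[OF S(1,3)] 4(1) by simp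
      \<comment> \<open>Here \<open>21 * card S \<le> 3 * card (edges G)\<close> and
        \<open>3 * card (edges G) + 3 \<le> 5 * ?n\<close>, so fewer than a quarter of the vertices
        are deleted.\<close>
      then have "3 * ?n \<le> 4 * independence_number H"
        using S(2) sparse5_edges[OF s Vne] by linarith
      then show ?thesis using 4 by simp
    qed
    then show ?thesis by (simp only: LH(2))
  qed
  then have "real t * real ?n / real ?\<chi> \<le> real (partial_DP_number t G)" if "t \<in> {1..?\<chi>}" for t
  proof -
    have "real (t * ?n) \<le> real (?\<chi> * partial_DP_number t G)"
      using \<open>\<And>t. t \<in> {1..?\<chi>} \<Longrightarrow> _\<close> that by (intro of_nat_mono) blast
    then show ?thesis using chi(1) by (simp add: divide_le_eq mult.commute)
  qed
  then show ?thesis unfolding partially_DP_nice_def by blast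
qed

end
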